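(* Let $D$ be a division ring with center $F$, and let $G$ be an ascendant subgroup of the multiplicative group $D^*$. If $G$ is radical over $F$, then every periodic element of $G$ lies in $F$. Consequently, $T(G)=\mathrm{Tor}(G)$ is a normal abelian subgroup of $G$, and $G/\mathrm{Tor}(G)$ is a torsion-free group.
   Context: $D^*=D\setminus\{0\}$. A subgroup $H$ of a group $X$ is ascendant in $X$ if there is an ordinal $\gamma$ and a family of subgroups $(H_\alpha)_{\alpha\le\gamma}$ with $H_0=H$, $H_\gamma=X$, $H_\alpha\trianglelefteq H_{\alpha+1}$ for all $\alpha<\gamma$, and $H_\lambda=\bigcup_{\alpha<\lambda}H_\alpha$ for every limit ordinal $\lambda\le\gamma$. $G$ is radical over $F$ if for every $x\in G$ there is a positive integer $m(x)$ with $x^{m(x)}\in F$. A periodic element is an element of finite order. $T(G)$ is the set of all periodic elements of $G$, and $\mathrm{Tor}(G)$ (the periodic radical) is the unique maximal normal subgroup of $G$ all of whose elements have finite order. *)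

theory Defs
  imports "HOL-Algebra.SndIsomorphismGrp"
begin

section \<open>Division rings\<close>

definition mult_group :: "'a::division_ring monoid"
  where "mult_group = \<lparr>carrier = UNIV - {0}, monoid.mult = (*), one = 1\<rparr>"

definition center :: "'a::division_ring set"
  where "center = {z. \<forall>x. z * x = x * z}"

definition radical_over :: "'a::division_ring set \<Rightarrow> 'a set \<Rightarrow> bool"
  where "radical_over G F \<longleftrightarrow> (\<forall>x\<in>G. \<exists>m::nat. m > 0 \<and> x ^ m \<in> F)"

section \<open>Ascendant subgroups\<close>

text \<open>
  The ordinals up to \<open>\<gamma>\<close> are modelled by the elements up to \<open>\<gamma>\<close> of a well-order
  \<open>r\<close> on a subset of a type \<open>'i\<close>. The first element \<open>z\<close> is characterised by
  \<open>underS r z = {}\<close>, and \<open>\<beta>\<close> is the successor of \<open>\<alpha>\<close> iff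
  \<open>underS r \<beta> = under r \<alpha>\<close>.
\<close>

definition limit_elem :: "'i rel \<Rightarrow> 'i \<Rightarrow> bool"
  where "limit_elem r l \<longleftrightarrow>
    underS r l \<noteq> {} \<and> (\<forall>\<alpha>\<in>underS r l. \<exists>\<beta>\<in>underS r l. \<alpha> \<in> underS r \<beta>)"

definition ascending_series ::
    "('a, 'b) monoid_scheme \<Rightarrow> 'a set \<Rightarrow> 'i rel \<Rightarrow> 'i \<Rightarrow> ('i \<Rightarrow> 'a set) \<Rightarrow> bool"
  where "ascending_series X H r \<gamma> K \<longleftrightarrow>
    Well_order r \<and> \<gamma> \<in> Field r \<and>
    (\<forall>\<alpha>\<in>under r \<gamma>. subgroup (K \<alpha>) X) \<and>
    (\<forall>z\<in>under r \<gamma>. underS r z = {} \<longrightarrow> K z = H) \<and>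
    K \<gamma> = carrier X \<and>
    (\<forall>\<alpha>\<in>underS r \<gamma>. \<forall>\<beta>\<in>under r \<gamma>. underS r \<beta> = under r \<alpha> \<longrightarrow>
        K \<alpha> \<lhd> X\<lparr>carrier := K \<beta>\<rparr>) \<and>
    (\<forall>l\<in>under r \<gamma>. limit_elem r l \<longrightarrow> K l = (\<Union>\<alpha>\<in>underS r l. K \<alpha>))"

text \<open>
  HOL cannot quantify existentially over the type carrying the ordinal \<open>\<gamma>\<close>, so this
  type is a parameter. A theorem with the hypothesis \<open>ascendant TYPE('i) H X\<close> for a
  type variable \<open>'i\<close> applies to ascending series of arbitrary ordinal length.
\<close>

definition ascendant :: "'i itself \<Rightarrow> 'a set \<Rightarrow> ('a, 'b) monoid_scheme \<Rightarrow> bool"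
  where "ascendant _ H X \<longleftrightarrow>
    subgroup H X \<and> (\<exists>(r :: 'i rel) \<gamma> K. ascending_series X H r \<gamma> K)"

section \<open>Periodic elements and the periodic radical\<close>

definition periodic_elems :: "('a, 'b) monoid_scheme \<Rightarrow> 'a set"
  where "periodic_elems G = {x \<in> carrier G. \<exists>n::nat. n > 0 \<and> x [^]\<^bsub>G\<^esub> n = \<one>\<^bsub>G\<^esub>}"

definition torsion_free :: "('a, 'b) monoid_scheme \<Rightarrow> bool"
  where "torsion_free G \<longleftrightarrow> periodic_elems G = {\<one>\<^bsub>G\<^esub>}"

definition periodic_normal :: "('a, 'b) monoid_scheme \<Rightarrow> 'a set \<Rightarrow> bool"
  where "periodic_normal G N \<longleftrightarrow> N \<lhd> G \<and> N \<subseteq> periodic_elems G"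

definition Tor :: "('a, 'b) monoid_scheme \<Rightarrow> 'a set"
  where "Tor G =
    (THE N. periodic_normal G N \<and> (\<forall>M. periodic_normal G M \<and> N \<subseteq> M \<longrightarrow> M = N))"

lemma group_mult_group: "group (mult_group :: 'a::division_ring monoid)"
proof (rule groupI)
  fix x :: 'a assume "x \<in> carrier mult_group"
  then show "\<exists>y\<in>carrier mult_group. y \<otimes>\<^bsub>mult_group\<^esub> x = \<one>\<^bsub>mult_group\<^esub>"
    by (intro bexI[of _ "inverse x"]) (auto simp: mult_group_def)
qed (auto simp: mult_group_def mult.assoc)

text \<open>The description defining \<^const>\<open>Tor\<close> is proper in every group.\<close>

lemma (in group) periodic_normal_set_mult:
  assumes M: "periodic_normal G M" and N: "periodic_normal G N"
  shows "periodic_normal G (M <#> N)"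
proof -
  interpret M: normal M G using M by (simp add: periodic_normal_def)
  interpret N: normal N G using N by (simp add: periodic_normal_def)
  have norm: "M <#> N \<lhd> G"
    by (rule normal_subgroup_set_mult_closed) (fact M.normal_axioms N.normal_axioms)+
  have "x \<in> periodic_elems G" if x: "x \<in> M <#> N" for x
  proof -
    obtain a b where ab: "a \<in> M" "b \<in> N" "x = a \<otimes> b"
      using x by (auto simp: set_mult_def)
    have xc: "x \<in> carrier G" and bc: "b \<in> carrier G" using ab by auto
    obtain n :: nat where n: "n > 0" "b [^] n = \<one>"
      using N ab by (auto simp: periodic_normal_def periodic_elems_def)
    have "M #> x = M #> b"
      using ab bc by (metis M.mem_carrier M.rcos_const M.subset coset_mult_assoc is_group)
    then have "M #> (x [^] n) = M #> (b [^] n)"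
      using M.FactGroup_pow[OF xc] M.FactGroup_pow[OF bc] by metis
    then have "x [^] n \<in> M"
      using n xc by (metis M.subset coset_mult_one coset_join1 M.subgroup_axioms nat_pow_closed)
    then obtain k :: nat where "k > 0" "(x [^] n) [^] k = \<one>"
      using M by (auto simp: periodic_normal_def periodic_elems_def)
    then show ?thesis
      using n xc unfolding periodic_elems_def by (auto simp: nat_pow_pow intro!: exI[of _ "n * k"])
  qed
  with norm show ?thesis by (auto simp: periodic_normal_def)
qed

lemma (in group) periodic_normal_Union: "periodic_normal G (\<Union>{N. periodic_normal G N})"
proof -
  let ?U = "\<Union>{N. periodic_normal G N}"
  have nrm: "N \<lhd> G" and sbg: "subgroup N G" if "periodic_normal G N" for N
    using that normal_imp_subgroup by (auto simp: periodic_normal_def)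
  have one: "periodic_normal G {\<one>}"
    using one_is_normal by (auto simp: periodic_normal_def periodic_elems_def intro!: exI[of _ 1])
  have "subgroup ?U G"
  proof
    show "?U \<subseteq> carrier G" by (auto dest: sbg subgroup.mem_carrier)
    show "\<one> \<in> ?U" using one by blast
    show "inv x \<in> ?U" if "x \<in> ?U" for x
      using that by (auto dest: sbg subgroup.m_inv_closed)
    show "x \<otimes> y \<in> ?U" if xy: "x \<in> ?U" "y \<in> ?U" for x y
    proof -
      obtain M N where MN: "x \<in> M" "periodic_normal G M" "y \<in> N" "periodic_normal G N"
        using xy by auto
      then have "x \<otimes> y \<in> M <#> N" by (auto simp: set_mult_def)
      then show ?thesis using periodic_normal_set_mult MN by blast
    qed
  qed
  moreover have "x \<otimes> h \<otimes> inv x \<in> ?U" if "x \<in> carrier G" "h \<in> ?U" for x h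
    using that by (auto dest: nrm normal.inv_op_closed2)
  ultimately have "?U \<lhd> G" using normal_inv_iff by blast
  then show ?thesis by (auto simp: periodic_normal_def)
qed

lemma (in group) Tor_eq_Union: "Tor G = \<Union>{N. periodic_normal G N}"
  unfolding Tor_def
proof (rule the_equality)
  show "periodic_normal G (\<Union>{N. periodic_normal G N}) \<and>
    (\<forall>M. periodic_normal G M \<and> \<Union>{N. periodic_normal G N} \<subseteq> M
      \<longrightarrow> M = \<Union>{N. periodic_normal G N})"
    using periodic_normal_Union by blast
next
  fix N assume "periodic_normal G N \<and> (\<forall>M. periodic_normal G M \<and> N \<subseteq> M \<longrightarrow> M = N)"
  then show "N = \<Union>{N. periodic_normal G N}"
    using periodic_normal_Union by blast
qed

end

theory Submission
  imports Defs "HOL-Computational_Algebra.Computational_Algebra"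
begin

text \<open>
  Suppose \<open>x \<in> G\<close> is a noncentral root of unity. Splitting the division ring into eigenspaces of
  conjugation by \<open>x\<close> yields \<open>y\<close> with \<open>y x y\<^sup>-\<^sup>1 = x\<^sup>j \<noteq> x\<close>, and replacing \<open>y\<close> by a power one may
  assume that \<open>a = y\<^sup>l\<close> commutes with \<open>x\<close> for a prime \<open>l\<close>. Along an ascending series every
  \<open>u \<noteq> 0\<close> reaches \<open>G\<close> after finitely many steps \<open>u \<mapsto> u\<^sup>-\<^sup>1 x u x\<^sup>-\<^sup>1\<close>, but their number is
  not under control. So one starts with \<open>u = 1 + \<pi> y\<close>, where \<open>\<pi>\<close> is a central uniformiser (an
  integer prime \<open>P\<close> if \<open>a\<close> is algebraic in characteristic \<open>0\<close>, and \<open>a - 1\<close> if \<open>a\<close> is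
  transcendental) of a local ring over which \<open>x\<close> and \<open>y\<close> generate an order \<open>A\<close>. Then every
  iterate is \<open>1 + \<pi> w\<close> with \<open>w\<close> congruent modulo \<open>\<pi> A\<close> to a unit times \<open>y\<close>, and some iterate
  has a central power.

  Comparing leading terms refutes this unless the characteristic is \<open>l\<close>. In that case an element
  of \<open>G\<close> congruent to \<open>1\<close> is, up to \<open>\<pi>\<close>-adic approximation, purely inseparable over the centre,
  hence an additive commutator, hence of reduced trace \<open>0\<close>, while products of the iterate's
  conjugates generate elements of nonzero trace. Finally, if \<open>a\<close> is algebraic in positive
  characteristic, then \<open>x\<close> and \<open>a\<close> lie in a finite field, and surjectivity of the norm
  (Hilbert 90 and counting) gives \<open>z = e y\<close> with \<open>z\<^sup>l = 1\<close>, so that \<open>1 + z + \<dots> + z\<^sup>l\<^sup>-\<^sup>1 = 0\<close>,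
  contradicting the independence of the eigenspaces.
\<close>

section \<open>Commuting elements\<close>

definition commutes :: "'a::times \<Rightarrow> 'a \<Rightarrow> bool"
  where "commutes a b \<longleftrightarrow> a * b = b * a"

lemma commutes_refl [simp]: "commutes a a"
  by (simp add: commutes_def)

lemma commutes_sym: "commutes a b \<Longrightarrow> commutes b a"
  by (simp add: commutes_def)

lemma commutes_0 [simp]: "commutes a (0 :: 'a::ring_1)"
  by (simp add: commutes_def)

lemma commutes_1 [simp]: "commutes a (1 :: 'a::ring_1)"
  by (simp add: commutes_def)

lemma commutes_add: "commutes a b \<Longrightarrow> commutes a c \<Longrightarrow> commutes a (b + c :: 'a::ring_1)"
  by (simp add: commutes_def algebra_simps)

lemma commutes_minus: "commutes a b \<Longrightarrow> commutes a (- b :: 'a::ring_1)"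
  by (simp add: commutes_def)

lemma commutes_diff: "commutes a b \<Longrightarrow> commutes a c \<Longrightarrow> commutes a (b - c :: 'a::ring_1)"
  by (simp add: commutes_def algebra_simps)

lemma commutes_mult: "commutes a b \<Longrightarrow> commutes a c \<Longrightarrow> commutes a (b * c :: 'a::ring_1)"
  unfolding commutes_def by (metis mult.assoc)

lemma commutes_power: "commutes a b \<Longrightarrow> commutes a (b ^ k :: 'a::ring_1)"
  by (induction k) (auto intro: commutes_mult)

lemma commutes_of_nat [simp]: "commutes a (of_nat k :: 'a::ring_1)"
  unfolding commutes_def by (rule mult_of_nat_commute [symmetric])

lemma commutes_of_int [simp]: "commutes a (of_int k :: 'a::ring_1)"
  unfolding commutes_def by (rule mult_of_int_commute [symmetric])

lemma commutes_sum:
  "(\<And>i. i \<in> I \<Longrightarrow> commutes a (f i)) \<Longrightarrow> commutes a (sum f I :: 'a::ring_1)"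
  by (simp add: commutes_def sum_distrib_left sum_distrib_right cong: sum.cong)

lemma commutes_inverse:
  fixes a b :: "'a::division_ring"
  assumes "commutes a b"
  shows "commutes a (inverse b)"
proof (cases "b = 0")
  case False
  have "a * inverse b = inverse b * (b * a) * inverse b"
    using False by (simp add: mult.assoc [symmetric])
  also have "\<dots> = inverse b * a"
    using False assms by (simp add: commutes_def mult.assoc) (metis mult.assoc mult.right_neutral right_inverse)
  finally show ?thesis by (simp add: commutes_def)
qed simp

lemmas commutes_intros =
  commutes_add commutes_minus commutes_diff commutes_mult commutes_power commutes_sum
  commutes_inverse

lemma commutes_eq: "commutes a b \<Longrightarrow> a * b = b * a"
  by (simp add: commutes_def)

lemma commutes_left_commute: "commutes a b \<Longrightarrow> a * (b * c) = b * (a * c :: 'a::ring_1)"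
  by (metis commutes_def mult.assoc)

lemma commutes_power_mult: "commutes a b \<Longrightarrow> (a * b) ^ k = a ^ k * (b ^ k :: 'a::ring_1)"
proof (induction k)
  case (Suc k)
  have "commutes b (a ^ k)" by (rule commutes_power [OF commutes_sym [OF Suc.prems]])
  then have "b * (a ^ k * b ^ k) = a ^ k * (b * b ^ k)" by (rule commutes_left_commute)
  then show ?case
    using Suc by (simp add: mult.assoc)
qed simp

lemma commutes_conj:
  fixes g :: "'a::division_ring"
  assumes "g \<noteq> 0"
  shows "g * h * inverse g = h \<longleftrightarrow> commutes g h"
  using assms unfolding commutes_def
  by (metis mult.assoc mult.right_neutral right_inverse left_inverse)

lemma conj_mult:
  fixes g :: "'a::division_ring"
  assumes "g \<noteq> 0"
  shows "g * (h * k) * inverse g = (g * h * inverse g) * (g * k * inverse g)"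
  using assms by (simp add: mult.assoc) (metis mult.assoc mult_1 left_inverse)

lemma conj_power:
  fixes g :: "'a::division_ring"
  assumes "g \<noteq> 0"
  shows "g * h ^ k * inverse g = (g * h * inverse g) ^ k"
  by (induction k) (use assms conj_mult [of g h] in \<open>auto\<close>)

lemma conj_inverse:
  fixes g :: "'a::division_ring"
  assumes "g \<noteq> 0"
  shows "g * inverse h * inverse g = inverse (g * h * inverse g)"
  using assms by (cases "h = 0") (auto simp: nonzero_inverse_mult_distrib mult.assoc)

lemma commutes_conj_conj:
  fixes g :: "'a::division_ring"
  assumes "g \<noteq> 0" "commutes h k"
  shows "commutes (g * h * inverse g) (g * k * inverse g)"
  using assms unfolding commutes_def by (simp flip: conj_mult)

section \<open>The Frobenius identity for commuting operators\<close>

lemma additive_of_nat_mult: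
  fixes L :: "'a::ring_1 \<Rightarrow> 'a"
  assumes "\<And>u v. L (u + v) = L u + L v"
  shows "L (of_nat k * v) = of_nat k * L v"
proof -
  have "L 0 = 0" using assms [of 0 0] by simp
  then show ?thesis by (induction k) (auto simp: algebra_simps assms)
qed

lemma additive_sum:
  fixes L :: "'a::ring_1 \<Rightarrow> 'a"
  assumes "\<And>u v. L (u + v) = L u + L v"
  shows "L (sum f I) = (\<Sum>i\<in>I. L (f i))"
proof -
  have "L 0 = 0" using assms [of 0 0] by simp
  then show ?thesis by (induction I rule: infinite_finite_induct) (auto simp: assms)
qed

lemma additive_funpow:
  fixes L :: "'a::ring_1 \<Rightarrow> 'a"
  assumes "\<And>u v. L (u + v) = L u + L v"
  shows "(L ^^ k) (u + v) = (L ^^ k) u + (L ^^ k) v"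
  by (induction k) (auto simp: assms)

lemma funpow_commute_funpow:
  assumes "\<And>v. L (R v) = R (L v)"
  shows "(L ^^ i) ((R ^^ k) v) = (R ^^ k) ((L ^^ i) v)"
proof -
  have *: "L ((R ^^ k) v) = (R ^^ k) (L v)" for v
    by (induction k) (auto simp: assms)
  show ?thesis by (induction i) (auto simp: *)
qed

text \<open>Stated for operators rather than ring elements, so that it also covers left and right
  multiplication by one element, which commute although the ring does not.\<close>

lemma funpow_binomial:
  fixes L R :: "'a::ring_1 \<Rightarrow> 'a"
  assumes L: "\<And>u v. L (u + v) = L u + L v" and R: "\<And>u v. R (u + v) = R u + R v"
    and LR: "\<And>v. L (R v) = R (L v)"
  shows "((\<lambda>v. L v + R v) ^^ m) c =
    (\<Sum>i\<le>m. of_nat (m choose i) * (L ^^ i) ((R ^^ (m - i)) c))"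
proof (induction m)
  case (Suc m)
  let ?t = "\<lambda>i k. (L ^^ i) ((R ^^ k) c)"
  have Rt: "R (?t i k) = ?t i (Suc k)" for i k
    using funpow_commute_funpow [of L R i 1 "(R ^^ k) c"] LR by simp
  have "((\<lambda>v. L v + R v) ^^ Suc m) c =
      (\<Sum>i\<le>m. of_nat (m choose i) * ?t (Suc i) (m - i)) +
      (\<Sum>i\<le>m. of_nat (m choose i) * ?t i (Suc m - i))"
    by (simp add: Suc additive_sum [where L = L, OF L] additive_sum [where L = R, OF R]
        additive_of_nat_mult [where L = L, OF L] additive_of_nat_mult [where L = R, OF R]
        Rt Suc_diff_le)
  also have "(\<Sum>i\<le>m. of_nat (m choose i) * ?t i (Suc m - i)) =
      (\<Sum>i\<le>Suc m. of_nat (m choose i) * ?t i (Suc m - i))"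
    by (simp add: binomial_eq_0)
  also have "\<dots> = ?t 0 (Suc m) + (\<Sum>i\<le>m. of_nat (m choose Suc i) * ?t (Suc i) (m - i))"
    by (subst sum.atMost_Suc_shift) simp
  also have "(\<Sum>i\<le>m. of_nat (m choose i) * ?t (Suc i) (m - i)) +
      (?t 0 (Suc m) + (\<Sum>i\<le>m. of_nat (m choose Suc i) * ?t (Suc i) (m - i))) =
      ?t 0 (Suc m) + (\<Sum>i\<le>m. of_nat (Suc m choose Suc i) * ?t (Suc i) (m - i))"
    by (simp add: sum.distrib algebra_simps)
  also have "\<dots> = (\<Sum>i\<le>Suc m. of_nat (Suc m choose i) * ?t i (Suc m - i))"
    by (subst sum.atMost_Suc_shift) simp
  finally show ?case .
qed simp

lemma of_nat_eq_0_dvd: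
  assumes "of_nat q = (0 :: 'a::ring_1)" "q dvd k"
  shows "of_nat k = (0 :: 'a)"
  using assms by (auto simp: dvd_def)

lemma funpow_add_prime:
  fixes L R :: "'a::ring_1 \<Rightarrow> 'a"
  assumes L: "\<And>u v. L (u + v) = L u + L v" and R: "\<And>u v. R (u + v) = R u + R v"
    and LR: "\<And>v. L (R v) = R (L v)" and q: "prime q" "of_nat q = (0 :: 'a)"
  shows "((\<lambda>v. L v + R v) ^^ q) c = (L ^^ q) c + (R ^^ q) c"
proof -
  have "q > 0" using q prime_gt_0_nat by blast
  have "((\<lambda>v. L v + R v) ^^ q) c =
      (\<Sum>i\<le>q. of_nat (q choose i) * (L ^^ i) ((R ^^ (q - i)) c))"
    by (rule funpow_binomial [where L = L and R = R, OF L R LR])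
  also have "\<dots> = (\<Sum>i\<in>{0, q}. of_nat (q choose i) * (L ^^ i) ((R ^^ (q - i)) c))"
  proof (rule sum.mono_neutral_right)
    show "\<forall>i\<in>{..q} - {0, q}. of_nat (q choose i) * (L ^^ i) ((R ^^ (q - i)) c) = 0"
    proof
      fix i assume "i \<in> {..q} - {0, q}"
      then have "q dvd q choose i" by (intro dvd_choose_prime) (use q in auto)
      then have "of_nat (q choose i) = (0 :: 'a)" using q by (auto intro: of_nat_eq_0_dvd)
      then show "of_nat (q choose i) * (L ^^ i) ((R ^^ (q - i)) c) = 0" by simp
    qed
  qed auto
  also have "\<dots> = (L ^^ q) c + (R ^^ q) c"
    using \<open>q > 0\<close> by (simp add: add.commute)
  finally show ?thesis .
qed

lemma funpow_add_prime_power: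
  fixes L R :: "'a::ring_1 \<Rightarrow> 'a"
  assumes L: "\<And>u v. L (u + v) = L u + L v" and R: "\<And>u v. R (u + v) = R u + R v"
    and LR: "\<And>v. L (R v) = R (L v)" and q: "prime q" "of_nat q = (0 :: 'a)"
  shows "((\<lambda>v. L v + R v) ^^ (q ^ e)) c = (L ^^ (q ^ e)) c + (R ^^ (q ^ e)) c"
proof (induction e arbitrary: c)
  case (Suc e)
  have "((\<lambda>v. L v + R v) ^^ (q ^ Suc e)) c = (((\<lambda>v. L v + R v) ^^ (q ^ e)) ^^ q) c"
    by (simp add: funpow_mult mult.commute)
  also have "((\<lambda>v. L v + R v) ^^ (q ^ e)) = (\<lambda>v. (L ^^ (q ^ e)) v + (R ^^ (q ^ e)) v)"
    using Suc by auto
  also have "(\<dots> ^^ q) c = ((L ^^ (q ^ e)) ^^ q) c + ((R ^^ (q ^ e)) ^^ q) c"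
    by (rule funpow_add_prime)
      (use additive_funpow [where L = L, OF L] additive_funpow [where L = R, OF R] q
        funpow_commute_funpow [where L = L and R = R, OF LR] in blast)+
  finally show ?case by (simp add: funpow_mult mult.commute)
qed simp

lemma funpow_times_left: "((*) a ^^ k) c = a ^ k * (c :: 'a::ring_1)"
  by (induction k) (auto simp: mult.assoc)

lemma funpow_times_right: "((\<lambda>v. v * a) ^^ k) c = c * a ^ k" for c :: "'a::ring_1"
  by (induction k) (auto simp: mult.assoc power_commutes)

lemma power_add_commutes:
  fixes a b :: "'a::ring_1"
  assumes "commutes a b" "prime q" "of_nat q = (0 :: 'a)"
  shows "(a + b) ^ (q ^ e) = a ^ (q ^ e) + b ^ (q ^ e)"
proof -
  have "(*) (a + b) = (\<lambda>v. a * v + b * v)"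
    by (simp add: fun_eq_iff distrib_right)
  then have "(a + b) ^ (q ^ e) = ((\<lambda>v. a * v + b * v) ^^ (q ^ e)) 1"
    using funpow_times_left [where a = "a + b" and k = "q ^ e" and c = 1]
    by simp
  also have "\<dots> = ((*) a ^^ (q ^ e)) 1 + ((*) b ^^ (q ^ e)) 1"
    by (rule funpow_add_prime_power)
      (use assms commutes_left_commute in \<open>auto simp: algebra_simps\<close>)
  finally show ?thesis by (simp add: funpow_times_left)
qed

text \<open>Expanding \<open>(1 + - 1) ^ (q ^ e)\<close> treats \<open>q = 2\<close> and odd
  \<open>q\<close> alike.\<close>

lemma minus_one_prime_power:
  assumes "prime q" "of_nat q = (0 :: 'a::ring_1)"
  shows "(- 1 :: 'a) ^ (q ^ e) = - 1"
proof -
  have "(1 + - 1 :: 'a) ^ (q ^ e) = 1 + (- 1) ^ (q ^ e)"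
    using power_add_commutes [of 1 "- 1 :: 'a" q e] assms by (simp add: commutes_def)
  moreover have "q ^ e \<noteq> 0" using assms by auto
  ultimately show ?thesis by (metis add_eq_0_iff add.right_inverse power_0_left power_one)
qed

lemma power_diff_commutes:
  fixes a b :: "'a::ring_1"
  assumes "commutes a b" "prime q" "of_nat q = (0 :: 'a)"
  shows "(a - b) ^ (q ^ e) = a ^ (q ^ e) - b ^ (q ^ e)"
proof -
  have "(- b) ^ (q ^ e) = - (b ^ (q ^ e))"
    using minus_one_prime_power [OF assms(2,3), of e] power_minus [of b "q ^ e"] by simp
  then show ?thesis
    using power_add_commutes [of a "- b" q e] assms by (simp add: commutes_minus)
qed

text \<open>The operator is left multiplication by \<open>b\<close> plus right multiplication by
  \<open>- b\<close>, and the Frobenius identity applies to these two.\<close>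

lemma funpow_commutator:
  fixes b c :: "'a::ring_1"
  assumes "prime q" "of_nat q = (0 :: 'a)"
  shows "((\<lambda>v. b * v - v * b) ^^ (q ^ e)) c = b ^ (q ^ e) * c - c * b ^ (q ^ e)"
proof -
  have "((\<lambda>v. b * v + v * (- b)) ^^ (q ^ e)) c =
      ((*) b ^^ (q ^ e)) c + ((\<lambda>v. v * (- b)) ^^ (q ^ e)) c"
    by (rule funpow_add_prime_power) (use assms in \<open>auto simp: algebra_simps\<close>)
  moreover have "(- b) ^ (q ^ e) = - (b ^ (q ^ e))"
    using minus_one_prime_power [OF assms, of e] power_minus [of b "q ^ e"] by simp
  ultimately show ?thesis
    using funpow_times_right [where a = "- b" and k = "q ^ e" and c = c] by (simp add: funpow_times_left)
qed

text \<open>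
  As \<open>ad b\<close> is nilpotent on \<open>c\<close>, some iterated commutator \<open>u\<close> has \<open>w = [b, u] \<noteq> 0\<close> and
  \<open>[b, w] = 0\<close>. Then \<open>d = u / w\<close> satisfies \<open>[b, d] = 1\<close>, hence \<open>b = [b, d b]\<close>.
\<close>

lemma purely_inseparable_is_commutator:
  fixes b c :: "'a::division_ring"
  assumes q: "prime q" "of_nat q = (0 :: 'a)"
    and b: "commutes (b ^ (q ^ e)) c" "\<not> commutes b c"
    and S: "\<And>s. s \<in> S \<Longrightarrow> commutes s b" "\<And>s. s \<in> S \<Longrightarrow> commutes s c"
  obtains h where "b = b * h - h * b" "\<And>s. s \<in> S \<Longrightarrow> commutes s h"
proof -
  define ad where "ad = (\<lambda>v. b * v - v * b)"
  have "(ad ^^ (q ^ e)) c = 0"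
    using b funpow_commutator [where b = b and e = e and c = c, OF q] by (simp add: ad_def commutes_def)
  then obtain m where m: "(ad ^^ m) c = 0" "\<And>k. k < m \<Longrightarrow> (ad ^^ k) c \<noteq> 0"
    using ex_least_nat_le [of "\<lambda>m. (ad ^^ m) c = 0"] by blast
  have "ad c \<noteq> 0" "c \<noteq> 0" using b by (auto simp: ad_def commutes_def)
  then have "m \<noteq> 0" "m \<noteq> 1" using m(1) by (metis funpow_0, cases "m = 1") auto
  then obtain k where k: "m = Suc (Suc k)" by (metis One_nat_def not0_implies_Suc)
  define u where "u = (ad ^^ k) c"
  define w where "w = ad u"
  have w: "w \<noteq> 0" "ad w = 0" using m(1) m(2) [of "Suc k"] k by (auto simp: w_def u_def)
  then have bw: "commutes b w" by (simp add: ad_def commutes_def)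
  have Sc: "commutes s ((ad ^^ k) c)" if "s \<in> S" for s k
    using S [OF that] by (induction k) (auto simp: ad_def intro!: commutes_intros)
  have Su: "commutes s u" "commutes s w" if "s \<in> S" for s
    using Sc [OF that, of k] Sc [OF that, of "Suc k"] by (auto simp: u_def w_def)
  define d where "d = u * inverse w"
  have iw: "inverse w * b = b * inverse w"
    using bw by (intro commutes_eq commutes_sym [OF commutes_inverse])
  have "b * d - d * b = (b * u - u * b) * inverse w"
    by (simp add: d_def algebra_simps iw)
  then have "b * d - d * b = 1" using w by (simp add: w_def ad_def)
  then have "b = b * (d * b) - (d * b) * b"
    by (metis left_diff_distrib mult.assoc mult_1)
  moreover have "commutes s (d * b)" if "s \<in> S" for s
    using that S(1) Su unfolding d_def by (intro commutes_intros) auto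
  ultimately show ?thesis using that by blast
qed

lemma power_char_eq_1:
  fixes u :: "'a::division_ring"
  assumes q: "prime q" "of_nat q = (0 :: 'a)" and "u ^ (q ^ e) = 1"
  shows "u = 1"
proof -
  have "(u - 1) ^ (q ^ e) = 0"
    using power_diff_commutes [of u 1 q e] assms by simp
  then show ?thesis by simp
qed

section \<open>Independence of distinct commuting elements\<close>

text \<open>Vandermonde argument: relation \<open>k + 1\<close> minus relation \<open>k\<close>
  times \<open>t m\<close> on the right removes the index \<open>m\<close> and multiplies the other
  coefficients by \<open>t i - t m\<close>. The coefficients may fail to commute with the
  \<open>t i\<close>.\<close>

lemma power_sums_eq_0_imp_coeffs_0:
  fixes t c :: "'i \<Rightarrow> 'a::division_ring"
  assumes "finite I" "inj_on t I" "\<And>i j. i \<in> I \<Longrightarrow> j \<in> I \<Longrightarrow> commutes (t i) (t j)"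
    and "\<And>k::nat. (\<Sum>i\<in>I. c i * t i ^ k) = 0"
  shows "\<forall>i\<in>I. c i = 0"
  using assms
proof (induction I arbitrary: c rule: finite_induct)
  case (insert m I)
  have "\<forall>i\<in>I. c i * (t i - t m) = 0"
  proof (rule insert.IH)
    fix k
    have "(\<Sum>i\<in>I. c i * (t i - t m) * t i ^ k) =
        (\<Sum>i\<in>insert m I. c i * t i ^ Suc k - c i * t i ^ k * t m)"
    proof -
      have "c i * (t i - t m) * t i ^ k = c i * t i ^ Suc k - c i * t i ^ k * t m" if "i \<in> I" for i
      proof -
        have "commutes (t m) (t i ^ k)" using insert.prems that by (intro commutes_power) auto
        then show ?thesis by (simp add: right_diff_distrib left_diff_distrib mult.assoc
              flip: commutes_eq power_Suc power_Suc2)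
      qed
      then show ?thesis
        using insert.hyps by (simp add: power_commutes mult.assoc cong: sum.cong)
    qed
    also have "\<dots> = (\<Sum>i\<in>insert m I. c i * t i ^ Suc k) - (\<Sum>i\<in>insert m I. c i * t i ^ k) * t m"
      by (simp add: sum_subtractf sum_distrib_right)
    also have "\<dots> = 0"
      by (simp only: insert.prems(3) mult_zero_left diff_zero)
    finally show "(\<Sum>i\<in>I. c i * (t i - t m) * t i ^ k) = 0" .
  qed (use insert.prems(1,2) in auto)
  moreover have "t i \<noteq> t m" if "i \<in> I" for i using insert.prems(1) insert.hyps that by (auto simp: inj_on_def)
  ultimately have *: "\<forall>i\<in>I. c i = 0" by (metis eq_iff_diff_eq_0 mult_eq_0_iff)
  have "c m = 0"
  proof -
    have "(\<Sum>i\<in>I. c i) = 0" using * by (intro sum.neutral) auto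
    then show ?thesis using insert.prems(3) [of 0] insert.hyps by simp
  qed
  with * show ?case by simp
qed simp

section \<open>Finitely generated modules over a local ring of scalars\<close>

text \<open>Left linear combinations; the inductive form lets closure properties be proved one
  summand at a time.\<close>

inductive_set ospan :: "'a::ring_1 set \<Rightarrow> 'a set \<Rightarrow> 'a set" for R S where
  zero: "0 \<in> ospan R S"
| add: "c \<in> R \<Longrightarrow> e \<in> S \<Longrightarrow> v \<in> ospan R S \<Longrightarrow> c * e + v \<in> ospan R S"

lemma ospan_closed_add:
  assumes "u \<in> ospan R S" "v \<in> ospan R S"
  shows "u + v \<in> ospan R S"
  using assms(1) by induction (auto simp: assms(2) add.assoc intro: ospan.add)

lemma ospan_sum: "(\<And>i. i \<in> I \<Longrightarrow> f i \<in> ospan R S) \<Longrightarrow> sum f I \<in> ospan R S"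
  by (induction I rule: infinite_finite_induct) (auto intro: ospan.zero ospan_closed_add)

lemma ospan_base: "1 \<in> R \<Longrightarrow> e \<in> S \<Longrightarrow> e \<in> ospan R S"
  using ospan.add [OF _ _ ospan.zero, of 1 R e S] by simp

lemma ospan_insertE:
  assumes "u \<in> ospan R (insert e S)" "0 \<in> R" "\<And>c d. c \<in> R \<Longrightarrow> d \<in> R \<Longrightarrow> c + d \<in> R"
  obtains c v where "c \<in> R" "v \<in> ospan R S" "u = c * e + v"
proof -
  have "\<exists>c v. c \<in> R \<and> v \<in> ospan R S \<and> u = c * e + v"
    using assms(1)
  proof induction
    case zero
    then show ?case using assms(2) ospan.zero [of R S] by (intro exI [of _ 0]) auto
  next
    case (add b g w)
    then obtain c v where cv: "c \<in> R" "v \<in> ospan R S" "w = c * e + v" by blast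
    show ?case
    proof (cases "g = e")
      case True
      have "b * g + w = (b + c) * e + v" using cv True by (simp add: algebra_simps)
      then show ?thesis using cv assms(3) add.hyps by blast
    next
      case False
      have "b * g + w = c * e + (b * g + v)" using cv by (simp add: algebra_simps)
      moreover have "b * g + v \<in> ospan R S" using False add.hyps cv by (auto intro: ospan.add)
      ultimately show ?thesis using cv by blast
    qed
  qed
  then show ?thesis using that by blast
qed

lemma finite_ospan:
  fixes R S :: "'a::ring_1 set"
  assumes "finite S" "finite R" "0 \<in> R" "\<And>c d. c \<in> R \<Longrightarrow> d \<in> R \<Longrightarrow> c + d \<in> R"
  shows "finite (ospan R S)"
  using assms(1)
proof induction
  case empty
  have "u = 0" if "u \<in> ospan R {}" for u using that by induction auto
  then show ?case by (auto intro: finite_subset [of _ "{0}"])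
next
  case (insert e S)
  have "ospan R (insert e S) \<subseteq> (\<lambda>(c, v). c * e + v) ` (R \<times> ospan R S)"
  proof
    fix u assume "u \<in> ospan R (insert e S)"
    then obtain c v where "c \<in> R" "v \<in> ospan R S" "u = c * e + v"
      using ospan_insertE assms(3,4) by metis
    then show "u \<in> (\<lambda>(c, v). c * e + v) ` (R \<times> ospan R S)" by force
  qed
  then show ?case using insert.IH assms(2) finite_subset by blast
qed

text \<open>A commutative subring that may fail to be central: it can contain fractions in a power
  of \<open>y\<close>. Commutation with generators is therefore demanded separately.\<close>

locale scalars =
  fixes R :: "'a::division_ring set"
  assumes R_0 [simp, intro]: "0 \<in> R" and R_1 [simp, intro]: "1 \<in> R"
    and R_uminus: "c \<in> R \<Longrightarrow> - c \<in> R"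
    and R_add: "c \<in> R \<Longrightarrow> d \<in> R \<Longrightarrow> c + d \<in> R"
    and R_mult: "c \<in> R \<Longrightarrow> d \<in> R \<Longrightarrow> c * d \<in> R"
    and R_commutes: "c \<in> R \<Longrightarrow> d \<in> R \<Longrightarrow> commutes c d"
begin

lemma R_of_nat: "of_nat k \<in> R"
  by (induction k) (auto intro: R_add)

lemma ospan_scale:
  assumes "c \<in> R" "v \<in> ospan R S"
  shows "c * v \<in> ospan R S"
  using assms(2)
proof induction
  case (add d e v)
  then show ?case using ospan.add [of "c * d" R e S "c * v"]
    by (auto simp: algebra_simps R_mult assms(1))
qed (auto intro: ospan.zero)

lemma ospan_uminus: "v \<in> ospan R S \<Longrightarrow> - v \<in> ospan R S"
  using ospan_scale [of "- 1" v S] R_uminus by auto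

lemma ospan_commutes:
  assumes "v \<in> ospan R S" "\<And>c. c \<in> R \<Longrightarrow> commutes h c" "\<And>e. e \<in> S \<Longrightarrow> commutes h e"
  shows "commutes h v"
  using assms(1) by induction (auto simp: assms(2,3) intro!: commutes_add commutes_mult)

lemma ospan_mult:
  assumes RS: "\<And>c e. c \<in> R \<Longrightarrow> e \<in> S \<Longrightarrow> commutes c e"
    and SS: "\<And>e g. e \<in> S \<Longrightarrow> g \<in> S \<Longrightarrow> e * g \<in> ospan R S"
    and u: "u \<in> ospan R S" and v: "v \<in> ospan R S"
  shows "u * v \<in> ospan R S"
proof -
  have ev: "e * v \<in> ospan R S" if "e \<in> S" for e
    using v
  proof induction
    case (add c g w)
    have "e * (c * g + w) = c * (e * g) + e * w"
      by (simp add: distrib_left commutes_left_commute [OF RS [OF add.hyps(1) that]])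
    then show ?case using add SS that by (auto intro: ospan_closed_add ospan_scale)
  qed (auto intro: ospan.zero)
  show ?thesis using u
    by induction (auto intro: ospan.zero ospan_closed_add ospan_scale ev
        simp: distrib_right mult.assoc)
qed

text \<open>An integral equation of degree \<open>L\<close> makes the span of the first
  \<open>L\<close> powers stable under multiplication by \<open>y\<close>.\<close>

lemma power_integral:
  assumes "L > 0" "y ^ L \<in> ospan R ((^) y ` {..<L})" and R_y: "\<And>c. c \<in> R \<Longrightarrow> commutes c y"
  shows "y ^ m \<in> ospan R ((^) y ` {..<L})"
proof (induction m)
  case 0
  have "y ^ 0 \<in> (^) y ` {..<L}" using assms(1) by blast
  then show ?case by (intro ospan_base) auto
next
  case (Suc m)
  have "y * v \<in> ospan R ((^) y ` {..<L})" if "v \<in> ospan R ((^) y ` {..<L})" for v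
    using that
  proof induction
    case (add c e v)
    obtain j where j: "j < L" "e = y ^ j" using add.hyps by auto
    have "y * e \<in> ospan R ((^) y ` {..<L})"
    proof (cases "Suc j < L")
      case True
      then have "y ^ Suc j \<in> (^) y ` {..<L}" by blast
      then show ?thesis using j by (auto intro: ospan_base)
    next
      case False
      then have "Suc j = L" using j by simp
      then show ?thesis using assms(2) j by auto
    qed
    moreover have "y * (c * e + v) = c * (y * e) + y * v"
      by (simp add: distrib_left commutes_left_commute [OF R_y [OF add.hyps(1)]])
    ultimately show ?case using add by (auto intro: ospan_closed_add ospan_scale)
  qed (auto intro: ospan.zero)
  then show ?case using Suc by simp
qed

end

text \<open>Locality enters as the condition that \<open>\<pi>\<close> lies in the Jacobson radical
  of \<open>R\<close>, which is what Nakayama's lemma uses.\<close>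

locale local_scalars = scalars R for R :: "'a::division_ring set" +
  fixes \<pi> :: 'a
  assumes pi_R: "\<pi> \<in> R" and pi_nz: "\<pi> \<noteq> 0"
    and local_unit: "c \<in> R \<Longrightarrow> 1 + \<pi> * c \<noteq> 0 \<and> inverse (1 + \<pi> * c) \<in> R"
begin

text \<open>Elimination of generators: the equation of \<open>e\<close> is solved for
  \<open>e\<close> by dividing by a unit \<open>1 - \<pi> * c\<close>, and the solution is
  substituted into the equations of the remaining generators.\<close>

lemma nakayama:
  assumes "finite S" and N_add: "\<And>u v. u \<in> N \<Longrightarrow> v \<in> N \<Longrightarrow> u + v \<in> N" and N_0: "0 \<in> N"
    and N_scale: "\<And>c v. c \<in> R \<Longrightarrow> v \<in> N \<Longrightarrow> c * v \<in> N"
    and "\<And>e. e \<in> S \<Longrightarrow> \<exists>\<nu>\<in>N. \<exists>v\<in>ospan R S. e = \<nu> + \<pi> * v"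
  shows "S \<subseteq> N"
  using assms(1,5)
proof (induction S rule: finite_induct)
  case (insert e S)
  have solve: "\<exists>\<nu>\<in>N. \<exists>v\<in>ospan R S. e = \<nu> + \<pi> * v"
  proof -
    obtain \<nu> v where \<nu>: "\<nu> \<in> N" "v \<in> ospan R (insert e S)" "e = \<nu> + \<pi> * v"
      using insert.prems by blast
    obtain c w where cw: "c \<in> R" "w \<in> ospan R S" "v = c * e + w"
      using \<nu>(2) ospan_insertE R_add R_0 by metis
    define d where "d = inverse (1 + \<pi> * (- c))"
    have d: "1 + \<pi> * (- c) \<noteq> 0" "d \<in> R" using local_unit [of "- c"] cw R_uminus by (auto simp: d_def)
    have "(1 + \<pi> * (- c)) * e = e - \<pi> * (c * e)" by (simp add: algebra_simps)
    also have "\<dots> = \<nu> + \<pi> * w" using \<nu>(3) cw(3) by (simp add: algebra_simps)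
    finally have "e = d * (\<nu> + \<pi> * w)" using d(1) unfolding d_def
      by (metis mult.assoc left_inverse mult_1)
    also have "\<dots> = d * \<nu> + \<pi> * (d * w)"
      by (simp add: distrib_left commutes_left_commute [OF R_commutes [OF d(2) pi_R]])
    finally show ?thesis using d(2) \<nu>(1) cw(2) N_scale ospan_scale by blast
  qed
  then obtain \<nu>\<^sub>0 v\<^sub>0 where \<nu>0: "\<nu>\<^sub>0 \<in> N" "v\<^sub>0 \<in> ospan R S" "e = \<nu>\<^sub>0 + \<pi> * v\<^sub>0" by blast
  have "S \<subseteq> N"
  proof (rule insert.IH)
    fix g assume "g \<in> S"
    then obtain \<nu> v where \<nu>: "\<nu> \<in> N" "v \<in> ospan R (insert e S)" "g = \<nu> + \<pi> * v"
      using insert.prems by blast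
    obtain c w where cw: "c \<in> R" "w \<in> ospan R S" "v = c * e + w"
      using \<nu>(2) ospan_insertE R_add R_0 by metis
    have "g = (\<nu> + (\<pi> * c) * \<nu>\<^sub>0) + \<pi> * (c * (\<pi> * v\<^sub>0) + w)"
      by (simp add: \<nu>(3) cw(3) \<nu>0(3) algebra_simps)
    moreover have "\<nu> + (\<pi> * c) * \<nu>\<^sub>0 \<in> N" using \<nu> \<nu>0 cw N_add N_scale R_mult pi_R by blast
    moreover have "c * (\<pi> * v\<^sub>0) + w \<in> ospan R S"
      using cw \<nu>0 by (intro ospan_closed_add ospan_scale pi_R) auto
    ultimately show "\<exists>\<nu>\<in>N. \<exists>v\<in>ospan R S. g = \<nu> + \<pi> * v" by blast
  qed
  moreover have "e \<in> N"
  proof -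
    have "v \<in> N" if "v \<in> ospan R S" for v
      using that by induction (use \<open>S \<subseteq> N\<close> N_0 N_add N_scale in auto)
    then show ?thesis using \<nu>0 N_add N_scale pi_R by auto
  qed
  ultimately show ?case by blast
qed simp

text \<open>Nakayama's lemma for the set \<open>N\<close> of left multiples of
  \<open>1 + \<pi> * r\<close>: each generator \<open>e\<close> differs from
  \<open>e * (1 + \<pi> * r)\<close> by a multiple of \<open>\<pi>\<close>.\<close>

lemma one_plus_pi_unit:
  assumes "finite S" "1 \<in> S"
    and RS: "\<And>c e. c \<in> R \<Longrightarrow> e \<in> S \<Longrightarrow> commutes c e"
    and SS: "\<And>e g. e \<in> S \<Longrightarrow> g \<in> S \<Longrightarrow> e * g \<in> ospan R S"
    and r: "r \<in> ospan R S"
  shows "\<exists>v\<in>ospan R S. v * (1 + \<pi> * r) = 1"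
proof -
  define N where "N = (\<lambda>v. v * (1 + \<pi> * r)) ` ospan R S"
  have "S \<subseteq> N"
  proof (rule nakayama)
    show "finite S" by fact
    show "u + v \<in> N" if "u \<in> N" "v \<in> N" for u v
      using that unfolding N_def by (auto simp flip: distrib_right intro!: imageI ospan_closed_add)
    show "0 \<in> N" unfolding N_def using ospan.zero by force
    show "c * v \<in> N" if "c \<in> R" "v \<in> N" for c v
      using that unfolding N_def by (auto simp flip: mult.assoc intro!: imageI ospan_scale)
    show "\<exists>\<nu>\<in>N. \<exists>v\<in>ospan R S. e = \<nu> + \<pi> * v" if e: "e \<in> S" for e
    proof (intro bexI)
      have "\<pi> * (e * r) = e * (\<pi> * r)"
        using RS [OF pi_R e] by (rule commutes_left_commute)
      then show "e = e * (1 + \<pi> * r) + \<pi> * (- (e * r))" by (simp add: algebra_simps)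
      show "e * (1 + \<pi> * r) \<in> N" unfolding N_def using e ospan_base by blast
      show "- (e * r) \<in> ospan R S"
        using ospan_mult [OF RS SS _ r] e by (intro ospan_uminus) (auto intro: ospan_base)
    qed
  qed
  with \<open>1 \<in> S\<close> show ?thesis unfolding N_def by force
qed

end

section \<open>A root of unity and an element normalising its powers\<close>

text \<open>By Bezout, \<open>y\<close> is a product of integer powers of \<open>y ^ l\<close> and
  \<open>y ^ r\<close>.\<close>

lemma commutes_prime_power:
  fixes h y :: "'a::division_ring"
  assumes "prime (l::nat)" "\<not> l dvd r" and l: "commutes h (y ^ l)" and r: "commutes h (y ^ r)"
    and "y \<noteq> 0"
  shows "commutes h y"
proof -
  have "coprime r l" using assms(1,2) by (metis coprime_commute prime_imp_coprime)
  moreover have "r \<noteq> 0" using assms(2) by (metis dvd_0_right)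
  ultimately obtain i k where ik: "r * i = l * k + 1"
    using bezout_nat [of r l] by auto
  have "inverse ((y ^ l) ^ k) * (y ^ r) ^ i = inverse (y ^ (l * k)) * (y ^ (l * k) * y)"
    by (simp add: power_mult [symmetric] ik power_commutes)
  also have "\<dots> = y" using \<open>y \<noteq> 0\<close> by (simp flip: mult.assoc)
  finally have "y = inverse ((y ^ l) ^ k) * (y ^ r) ^ i" ..
  moreover have "commutes h (inverse ((y ^ l) ^ k) * (y ^ r) ^ i)"
    by (rule commutes_mult [OF commutes_inverse [OF commutes_power [OF l]] commutes_power [OF r]])
  ultimately show ?thesis by metis
qed

lemma geometric_sum: "(1 - u) * (\<Sum>i<k. u ^ i) = 1 - u ^ k" for u :: "'a::ring_1"
proof (induction k)
  case (Suc k)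
  have "(1 - u) * (\<Sum>i<Suc k. u ^ i) = (1 - u) * (\<Sum>i<k. u ^ i) + (1 - u) * u ^ k"
    by (simp add: distrib_left)
  also have "\<dots> = 1 - u ^ Suc k" by (simp only: Suc) (simp add: left_diff_distrib)
  finally show ?case .
qed simp

text \<open>Summing \<open>1 - u ^ k\<close> over \<open>k < n\<close> gives \<open>n\<close>, since
  the powers of \<open>u\<close> sum to \<open>0\<close>. The formula keeps the inverse inside any
  ring containing \<open>u\<close> and \<open>1 / n\<close>.\<close>

lemma inverse_one_minus_root:
  fixes u :: "'a::division_ring"
  assumes "u ^ n = 1" "u \<noteq> 1" and n: "of_nat n \<noteq> (0 :: 'a)"
  shows "inverse (1 - u) = (\<Sum>k<n. \<Sum>i<k. u ^ i) * inverse (of_nat n)"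
proof -
  have 0: "(\<Sum>k<n. u ^ k) = 0" using geometric_sum [of u n] assms by simp
  have "(1 - u) * (\<Sum>k<n. \<Sum>i<k. u ^ i) = (\<Sum>k<n. 1 - u ^ k)"
    by (subst sum_distrib_left) (simp only: geometric_sum)
  also have "\<dots> = of_nat n" by (simp add: sum_subtractf 0)
  finally have "(1 - u) * ((\<Sum>k<n. \<Sum>i<k. u ^ i) * inverse (of_nat n)) = 1"
    using n by (simp flip: mult.assoc)
  then show ?thesis by (rule inverse_unique)
qed

text \<open>Conjugation by \<open>y\<close> is an automorphism of prime order \<open>l\<close> of
  the cyclic group generated by \<open>x\<close>, so \<open>x\<close> and \<open>y\<close> behave
  like the generators of a cyclic algebra of degree \<open>l\<close>.\<close>

locale twisted_pair =
  fixes x y :: "'a::division_ring" and n l :: nat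
  assumes x_pow: "x ^ n = 1" and x_order: "\<And>k. 0 < k \<Longrightarrow> k < n \<Longrightarrow> x ^ k \<noteq> 1"
    and n_nz: "of_nat n \<noteq> (0 :: 'a)" and y_nz [simp]: "y \<noteq> 0"
    and conj_x: "y * x * inverse y \<in> range ((^) x)"
    and prime_l: "prime l" and not_commutes: "\<not> commutes y x" and pow_commutes: "commutes (y ^ l) x"
begin

definition X :: "'a set" where "X = range ((^) x)"

lemma n_pos: "n > 0" using n_nz by (cases n) auto

lemma l_pos: "l > 0" using prime_l by (rule prime_gt_0_nat)

lemma x_nz [simp]: "x \<noteq> 0"
  using x_pow n_pos by (auto simp: power_0_left)

lemma x_X [simp]: "x \<in> X" unfolding X_def by (metis power_one_right rangeI)

lemma one_X [simp]: "1 \<in> X" unfolding X_def by (metis power_0 rangeI)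

lemma X_mult: "u \<in> X \<Longrightarrow> v \<in> X \<Longrightarrow> u * v \<in> X"
  unfolding X_def by (auto simp flip: power_add)

lemma X_power: "u \<in> X \<Longrightarrow> u ^ k \<in> X"
  by (induction k) (auto intro: X_mult)

lemma X_root: "u \<in> X \<Longrightarrow> u ^ n = 1"
  unfolding X_def by auto (metis mult.commute power_mult power_one x_pow)

lemma X_nz: "u \<in> X \<Longrightarrow> u \<noteq> 0"
  unfolding X_def by auto

lemma X_inverse: "u \<in> X \<Longrightarrow> inverse u \<in> X"
proof -
  assume u: "u \<in> X"
  have "u * u ^ (n - 1) = 1"
    using X_root [OF u] n_pos by (metis power_Suc Suc_pred' )
  then have "inverse u = u ^ (n - 1)" by (rule inverse_unique)
  then show ?thesis using X_power [OF u] by simp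
qed

lemma X_commutes: "u \<in> X \<Longrightarrow> v \<in> X \<Longrightarrow> commutes u v"
  unfolding X_def commutes_def by (auto simp: add.commute simp flip: power_add)

lemma X_eq: "X = (^) x ` {..<n}"
proof -
  have "x ^ k = x ^ (k mod n)" for k
  proof -
    have "x ^ k = x ^ (n * (k div n) + k mod n)" by simp
    also have "\<dots> = x ^ (k mod n)" by (simp only: power_add power_mult x_pow power_one mult_1)
    finally show ?thesis .
  qed
  moreover have "k mod n < n" for k using n_pos by simp
  ultimately show ?thesis unfolding X_def by blast
qed

lemma finite_X: "finite X"
  by (simp add: X_eq)

lemma card_X: "card X = n"
proof -
  have "x ^ i \<noteq> x ^ k" if "i < k" "k < n" for i k
  proof
    assume "x ^ i = x ^ k"
    also have "x ^ k = x ^ i * x ^ (k - i)" using that by (simp flip: power_add)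
    finally have "x ^ (k - i) = 1" by simp
    then show False using x_order [of "k - i"] that by simp
  qed
  then have "inj_on ((^) x) {..<n}"
    by (intro inj_onI) (metis lessThan_iff linorder_neqE_nat)
  then show ?thesis by (simp add: X_eq card_image)
qed

lemma X_conj: "u \<in> X \<Longrightarrow> y * u * inverse y \<in> X"
  unfolding X_def using conj_x
  by (auto simp: conj_power) (metis power_mult rangeI)

lemma X_conj_power: "u \<in> X \<Longrightarrow> y ^ r * u * inverse (y ^ r) \<in> X"
proof (induction r)
  case (Suc r)
  have "y ^ Suc r * u * inverse (y ^ Suc r) = y * (y ^ r * u * inverse (y ^ r)) * inverse y"
    by (simp add: nonzero_inverse_mult_distrib mult.assoc)
  then show ?case using X_conj Suc by simp
qed simp

lemma X_conj_image: "(\<lambda>u. y * u * inverse y) ` X = X"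
proof (rule endo_inj_surj [OF finite_X])
  show "inj_on (\<lambda>u. y * u * inverse y) X"
    by (auto simp: inj_on_def)
qed (use X_conj in auto)

lemma X_commutes_pow: "u \<in> X \<Longrightarrow> commutes (y ^ l) u"
  unfolding X_def using pow_commutes by (auto intro: commutes_power)

text \<open>The commutator of \<open>x\<close> and \<open>y ^ r\<close>; it is the eigenvalue of
  \<open>y ^ r\<close> under conjugation by \<open>x\<close>.\<close>

definition lam :: "nat \<Rightarrow> 'a" where "lam r = x * y ^ r * inverse x * inverse (y ^ r)"

lemma lam_X: "lam r \<in> X"
proof -
  have "lam r = x * (y ^ r * inverse x * inverse (y ^ r))"
    by (simp add: lam_def mult.assoc)
  then show ?thesis using X_mult [OF x_X X_conj_power [OF X_inverse [OF x_X]], of r] by simp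
qed

lemma conj_pow: "x * y ^ r * inverse x = lam r * y ^ r"
  by (simp add: lam_def mult.assoc)

lemma lam_ne_1:
  assumes "\<not> l dvd r"
  shows "lam r \<noteq> 1"
proof
  assume "lam r = 1"
  then have "x * y ^ r * inverse x = y ^ r" by (simp add: conj_pow)
  then have "commutes x (y ^ r)" by (simp add: commutes_conj)
  then have "commutes x y"
    by (rule commutes_prime_power [OF prime_l assms commutes_sym [OF pow_commutes] _ y_nz])
  then show False using not_commutes commutes_sym by blast
qed

lemma lam_1_ne_1: "lam 1 \<noteq> 1"
  using lam_ne_1 [of 1] prime_l by (metis not_prime_unit)

end

section \<open>The order generated by the pair\<close>

text \<open>If \<open>x\<close> lies in a normal subgroup \<open>H\<close> of \<open>K\<close>, one
  step sends \<open>K\<close> into \<open>H\<close>; this drives the descent along the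
  series.\<close>

definition commutator_step :: "'a::division_ring \<Rightarrow> 'a \<Rightarrow> 'a"
  where "commutator_step x v = inverse v * x * v * inverse x"

text \<open>The conditions make the span of the products \<open>u * y ^ j\<close> an order
  containing \<open>x\<close>, \<open>y\<close> and their inverses. The bound \<open>L\<close> is
  the degree of the integral equation of \<open>y\<close> and may exceed \<open>l\<close>.\<close>

locale twisted_order = twisted_pair x y n l + local_scalars R \<pi>
  for x y :: "'a::division_ring" and n l :: nat and R :: "'a set" and \<pi> :: 'a +
  fixes L :: nat
  assumes R_x: "c \<in> R \<Longrightarrow> commutes c x" and R_y: "c \<in> R \<Longrightarrow> commutes c y"
    and L_pos: "L > 0" and y_integral: "y ^ L \<in> ospan R ((^) y ` {..<L})"
    and y_inverse: "inverse y \<in> ospan R ((^) y ` {..<L})"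
    and n_inverse: "inverse (of_nat n) \<in> R"
begin

definition words :: "'a set" where "words = {u * y ^ j | u j. u \<in> X \<and> j < L}"

definition A :: "'a set" where "A = ospan R words"

lemma R_X: "c \<in> R \<Longrightarrow> u \<in> X \<Longrightarrow> commutes c u"
  unfolding X_def by (auto intro: commutes_power R_x)

lemma R_words: "c \<in> R \<Longrightarrow> e \<in> words \<Longrightarrow> commutes c e"
  unfolding words_def by (auto intro: commutes_mult commutes_power R_X R_y)

lemma y_power_integral: "y ^ m \<in> ospan R ((^) y ` {..<L})"
  by (rule power_integral [OF L_pos y_integral R_y])

lemma X_times_A: "u \<in> X \<Longrightarrow> v \<in> ospan R ((^) y ` {..<L}) \<Longrightarrow> u * v \<in> A"
proof -
  assume u: "u \<in> X" and "v \<in> ospan R ((^) y ` {..<L})"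
  from this(2) show ?thesis
  proof induction
    case (add c e v)
    then have "u * e \<in> words" using u by (auto simp: words_def)
    moreover have "u * (c * e + v) = c * (u * e) + u * v"
      by (simp add: distrib_left commutes_left_commute [OF R_X [OF add.hyps(1) u]])
    ultimately show ?case using add by (auto simp: A_def intro: ospan.add)
  qed (auto simp: A_def intro: ospan.zero)
qed

lemma A_word: "u \<in> X \<Longrightarrow> u * y ^ m \<in> A"
  by (intro X_times_A y_power_integral)

text \<open>Since \<open>y\<close> normalises \<open>X\<close>, moving \<open>y ^ i\<close> past
  \<open>v\<close> replaces \<open>v\<close> by another element of \<open>X\<close>.\<close>

lemma words_mult: "e \<in> words \<Longrightarrow> g \<in> words \<Longrightarrow> e * g \<in> A"
proof -
  assume "e \<in> words" "g \<in> words"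
  then obtain u i v j where uv: "u \<in> X" "v \<in> X" "e = u * y ^ i" "g = v * y ^ j"
    unfolding words_def by blast
  have "e * g = (u * (y ^ i * v * inverse (y ^ i))) * y ^ (i + j)"
    by (simp add: uv power_add mult.assoc) (simp flip: mult.assoc)
  then show ?thesis using A_word X_mult X_conj_power uv by metis
qed

lemma A_0 [simp, intro]: "0 \<in> A"
  unfolding A_def by (rule ospan.zero)

lemma A_add: "u \<in> A \<Longrightarrow> v \<in> A \<Longrightarrow> u + v \<in> A"
  unfolding A_def by (rule ospan_closed_add)

lemma A_uminus: "u \<in> A \<Longrightarrow> - u \<in> A"
  unfolding A_def by (rule ospan_uminus)

lemma A_diff: "u \<in> A \<Longrightarrow> v \<in> A \<Longrightarrow> u - v \<in> A"
  using A_add [of u "- v"] A_uminus by simp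

lemma A_mult: "u \<in> A \<Longrightarrow> v \<in> A \<Longrightarrow> u * v \<in> A"
  unfolding A_def by (rule ospan_mult) (auto intro: R_words words_mult simp flip: A_def)

lemma A_X: "u \<in> X \<Longrightarrow> u \<in> A"
  using A_word [of u 0] by simp

lemma A_1 [simp, intro]: "1 \<in> A"
  by (rule A_X) simp

lemma A_power: "u \<in> A \<Longrightarrow> u ^ k \<in> A"
  by (induction k) (auto intro: A_mult)

lemma A_sum: "(\<And>i. i \<in> I \<Longrightarrow> f i \<in> A) \<Longrightarrow> sum f I \<in> A"
  unfolding A_def by (rule ospan_sum)

lemma A_R: "c \<in> R \<Longrightarrow> c \<in> A"
  using ospan_scale [of c 1 words] A_1 by (simp add: A_def)

lemma A_x: "x \<in> A" "inverse x \<in> A"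
  by (rule A_X [OF x_X], rule A_X [OF X_inverse [OF x_X]])

lemma A_y: "y \<in> A" "inverse y \<in> A"
  using A_word [of 1 1] X_times_A [OF one_X y_inverse] by auto

lemma commutes_A:
  assumes "v \<in> A" "\<And>c. c \<in> R \<Longrightarrow> commutes h c" "commutes h x" "commutes h y"
  shows "commutes h v"
  using assms(1) unfolding A_def
proof (rule ospan_commutes)
  show "commutes h e" if "e \<in> words" for e
    using that unfolding words_def X_def by (auto intro!: commutes_mult commutes_power assms(3,4))
qed (rule assms(2))

lemma R_A: "c \<in> R \<Longrightarrow> v \<in> A \<Longrightarrow> commutes c v"
  by (rule commutes_A) (auto intro: R_commutes R_x R_y)

lemmas pi_A = R_A [OF pi_R]

lemma pi_left_commute: "v \<in> A \<Longrightarrow> v * (\<pi> ^ k * w) = \<pi> ^ k * (v * w)"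
  by (rule commutes_left_commute, rule commutes_power, rule commutes_sym, rule pi_A)

lemmas pi_left_commute_1 = pi_left_commute [of _ 1, simplified]

lemma finite_words: "finite words"
proof -
  have "words = (\<lambda>(u, j). u * y ^ j) ` (X \<times> {..<L})" unfolding words_def by auto
  then show ?thesis using finite_X by simp
qed

text \<open>The left inverse supplied by Nakayama's lemma is the inverse in the division
  ring.\<close>

lemma A_unit:
  assumes "r \<in> A"
  shows "1 + \<pi> * r \<noteq> 0" "inverse (1 + \<pi> * r) \<in> A"
proof -
  have "(1::'a) * y ^ 0 \<in> words" unfolding words_def using L_pos one_X by blast
  then have "1 \<in> words" by simp
  then obtain v where v: "v \<in> A" "v * (1 + \<pi> * r) = 1"
    using one_plus_pi_unit [OF finite_words _ R_words] words_mult assms unfolding A_def by metis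
  then show nz: "1 + \<pi> * r \<noteq> 0" by auto
  then have "inverse (1 + \<pi> * r) = v" using v(2) by (metis inverse_unique left_inverse mult.assoc mult_1_right)
  then show "inverse (1 + \<pi> * r) \<in> A" using v by simp
qed

lemma one_not_pi_multiple: "t \<in> A \<Longrightarrow> 1 \<noteq> \<pi> * t"
  using A_unit(1) [of "- t"] A_uminus by auto

text \<open>Congruence modulo \<open>\<pi> * A\<close>, a two-sided ideal of \<open>A\<close>
  because \<open>\<pi>\<close> commutes with \<open>A\<close>.\<close>

definition cg :: "'a \<Rightarrow> 'a \<Rightarrow> bool" where "cg u v \<longleftrightarrow> (\<exists>t\<in>A. u - v = \<pi> * t)"

lemma cgI: "u = v + \<pi> * t \<Longrightarrow> t \<in> A \<Longrightarrow> cg u v"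
  unfolding cg_def by auto

lemma cg_refl [simp]: "cg u u"
  unfolding cg_def by (auto intro: bexI [of _ 0])

lemma cg_sym: "cg u v \<Longrightarrow> cg v u"
  unfolding cg_def by (metis A_uminus minus_diff_eq mult_minus_right)

lemma cg_add: "cg u v \<Longrightarrow> cg u' v' \<Longrightarrow> cg (u + u') (v + v')"
  unfolding cg_def by (metis A_add add_diff_add distrib_left)

lemma cg_trans [trans]: "cg u v \<Longrightarrow> cg v w \<Longrightarrow> cg u w"
  unfolding cg_def by (metis A_add diff_add_cancel add_diff_eq distrib_left)

lemma cg_uminus: "cg u v \<Longrightarrow> cg (- u) (- v)"
  unfolding cg_def by (metis A_uminus minus_diff_minus mult_minus_right)

lemma cg_diff: "cg u v \<Longrightarrow> cg u' v' \<Longrightarrow> cg (u - u') (v - v')"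
  using cg_add [of u v "- u'" "- v'"] cg_uminus by simp

lemma cg_mult_right: "cg u v \<Longrightarrow> w \<in> A \<Longrightarrow> cg (u * w) (v * w)"
  unfolding cg_def by (metis A_mult left_diff_distrib mult.assoc)

lemma cg_mult_left: "cg u v \<Longrightarrow> w \<in> A \<Longrightarrow> cg (w * u) (w * v)"
  unfolding cg_def by (metis A_mult right_diff_distrib pi_left_commute_1)

lemma cg_mult: "cg u v \<Longrightarrow> cg u' v' \<Longrightarrow> v \<in> A \<Longrightarrow> u' \<in> A \<Longrightarrow> cg (u * u') (v * v')"
  by (metis cg_mult_left cg_mult_right cg_trans)

lemma cg_power: "cg u v \<Longrightarrow> u \<in> A \<Longrightarrow> v \<in> A \<Longrightarrow> cg (u ^ k) (v ^ k)"
  by (induction k) (auto intro: cg_mult A_power)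

lemma unit_not_cg_0: "a \<in> A \<Longrightarrow> inverse a \<in> A \<Longrightarrow> a \<noteq> 0 \<Longrightarrow> \<not> cg a 0"
  unfolding cg_def by (metis A_mult diff_zero mult.assoc one_not_pi_multiple right_inverse)

lemma cg_cancel:
  assumes "c \<in> A" "inverse c \<in> A" "c \<noteq> 0" "cg (c * u) (c * v)"
  shows "cg u v"
  using cg_mult_left [OF assms(4,2)] assms(3) by (simp flip: mult.assoc)

text \<open>Consequently distinct elements of \<open>X\<close> stay distinct modulo
  \<open>\<pi>\<close>; this is where \<open>1 / n\<close> in \<open>R\<close> enters.\<close>

lemma inverse_one_minus_A: "u \<in> X \<Longrightarrow> u \<noteq> 1 \<Longrightarrow> inverse (1 - u) \<in> A"
proof -
  assume u: "u \<in> X" "u \<noteq> 1"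
  have "(\<Sum>k<n. \<Sum>i<k. u ^ i) * inverse (of_nat n) \<in> A"
    by (intro A_mult A_sum A_power A_X [OF u(1)] A_R n_inverse)
  then show ?thesis
    by (simp add: inverse_one_minus_root [OF X_root [OF u(1)] u(2) n_nz])
qed

lemma inverse_lam_minus_one:
  assumes "\<not> l dvd r"
  shows "inverse (lam r - 1) \<in> A"
proof -
  have "inverse (lam r - 1) = - inverse (1 - lam r)"
    by (metis inverse_minus_eq minus_diff_eq)
  then show ?thesis
    using inverse_one_minus_A [OF lam_X lam_ne_1 [OF assms]] A_uminus by simp
qed

lemma A_lam: "lam r \<in> A"
  by (rule A_X [OF lam_X])

text \<open>The coefficient of \<open>y\<close> in the leading term after \<open>k\<close>
  commutator steps from \<open>1 + \<pi> * y\<close>: each step contributes a factor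
  \<open>lam 1 - 1\<close>, a unit of \<open>A\<close>.\<close>

definition eps :: "nat \<Rightarrow> 'a" where "eps k = (lam 1 - 1) ^ k"

lemma eps_facts: "eps k \<in> A" "inverse (eps k) \<in> A" "eps k \<noteq> 0" "u \<in> X \<Longrightarrow> commutes u (eps k)"
proof -
  have "\<not> l dvd 1" using prime_l by (metis not_prime_unit)
  then have "inverse (lam 1 - 1) \<in> A" by (rule inverse_lam_minus_one)
  then show "inverse (eps k) \<in> A"
    by (simp add: eps_def power_inverse [symmetric] A_power)
  show "eps k \<in> A" unfolding eps_def by (intro A_power A_diff A_lam A_1)
  show "eps k \<noteq> 0" unfolding eps_def using lam_1_ne_1 by simp
  show "commutes u (eps k)" if "u \<in> X"
    unfolding eps_def using that lam_X X_commutes by (intro commutes_power commutes_diff) auto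
qed

lemma A_conj_x: "u \<in> A \<Longrightarrow> x * u * inverse x \<in> A"
  by (intro A_mult A_x)

lemma cg_conj_x: "cg u v \<Longrightarrow> cg (x * u * inverse x) (x * v * inverse x)"
  by (intro cg_mult_right cg_mult_left A_x)

lemma conj_x_word: "commutes x c \<Longrightarrow> x * (c * y ^ r) * inverse x = c * lam r * y ^ r"
proof -
  assume c: "commutes x c"
  have "x * (c * y ^ r) * inverse x = c * (x * y ^ r * inverse x)"
    by (simp add: mult.assoc commutes_left_commute [OF c])
  also have "\<dots> = c * lam r * y ^ r" by (subst conj_pow) (rule mult.assoc [symmetric])
  finally show ?thesis .
qed

text \<open>To first order in \<open>\<pi>\<close> the step replaces \<open>w\<close> by
  \<open>x * w * inverse x - w\<close>, and conjugation by \<open>x\<close> multiplies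
  \<open>eps k * y\<close> by \<open>lam 1\<close>.\<close>

lemma commutator_step_cg:
  assumes w: "w \<in> A" "cg w (eps k * y)"
  obtains w' where "w' \<in> A" "commutator_step x (1 + \<pi> * w) = 1 + \<pi> * w'" "cg w' (eps (Suc k) * y)"
proof -
  define v where "v = inverse (1 + \<pi> * w)"
  have v: "v \<in> A" "v * (1 + \<pi> * w) = 1" using A_unit [OF w(1)] by (auto simp: v_def)
  define z where "z = x * w * inverse x - w"
  have z: "z \<in> A" unfolding z_def by (intro A_diff A_conj_x w)
  have "x * (1 + \<pi> * w) * inverse x = 1 + \<pi> * (x * w * inverse x)"
    by (simp add: distrib_left distrib_right pi_left_commute_1 A_x mult.assoc)
  also have "\<dots> = (1 + \<pi> * w) + \<pi> * z" by (simp add: z_def algebra_simps)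
  finally have "commutator_step x (1 + \<pi> * w) = v * ((1 + \<pi> * w) + \<pi> * z)"
    by (simp add: commutator_step_def v_def mult.assoc)
  also have "\<dots> = v * (1 + \<pi> * w) + v * (\<pi> * z)" by (rule distrib_left)
  also have "\<dots> = 1 + \<pi> * (v * z)"
    by (simp only: v(2) pi_left_commute_1 [OF v(1)])
  finally have 1: "commutator_step x (1 + \<pi> * w) = 1 + \<pi> * (v * z)" .
  have "v = 1 + \<pi> * (- (v * w))"
    using v(2) by (simp add: distrib_left pi_left_commute_1 [OF v(1)] algebra_simps eq_diff_eq)
  then have "cg v 1" by (rule cgI) (intro A_uminus A_mult v w)
  moreover have "cg z (eps k * lam 1 * y - eps k * y)"
    unfolding z_def
    using cg_conj_x [OF w(2)] w(2) conj_x_word [OF eps_facts(4) [OF x_X], of k 1]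
    by (intro cg_diff) auto
  ultimately have "cg (v * z) (1 * (eps k * lam 1 * y - eps k * y))"
    by (intro cg_mult z A_1)
  then have "cg (v * z) (eps (Suc k) * y)"
    by (simp add: eps_def algebra_simps power_commutes [symmetric])
  with 1 v(1) z that show ?thesis using A_mult by blast
qed

lemma iterated_commutator:
  obtains w where "w \<in> A" "(commutator_step x ^^ k) (1 + \<pi> * y) = 1 + \<pi> * w" "cg w (eps k * y)"
proof -
  have "\<exists>w\<in>A. (commutator_step x ^^ k) (1 + \<pi> * y) = 1 + \<pi> * w \<and> cg w (eps k * y)"
  proof (induction k)
    case 0
    show ?case by (rule bexI [of _ y]) (auto simp: eps_def A_y)
  next
    case (Suc k)
    then obtain w where "w \<in> A" "(commutator_step x ^^ k) (1 + \<pi> * y) = 1 + \<pi> * w"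
      "cg w (eps k * y)" by blast
    then show ?case using commutator_step_cg [of w k] by (metis comp_apply funpow.simps(2))
  qed
  then show ?thesis using that by blast
qed

text \<open>Invariance under conjugation by \<open>x\<close> would make \<open>lam r\<close>
  congruent to \<open>1\<close>, after cancelling the unit \<open>c\<close> and the power of
  \<open>y\<close>. But \<open>lam r - 1\<close> is a unit of \<open>A\<close>.\<close>

lemma not_commutes_x:
  assumes "c \<in> A" "inverse c \<in> A" "c \<noteq> 0" "commutes x c" "\<not> l dvd r" "cg w (c * y ^ r)"
  shows "\<not> commutes x w"
proof
  assume "commutes x w"
  then have "x * w * inverse x = w" by (simp add: commutes_conj)
  then have "cg w (c * lam r * y ^ r)"
    using cg_conj_x [OF assms(6)] conj_x_word [OF assms(4)] by simp
  then have "cg (c * lam r * y ^ r) (c * y ^ r)"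
    using assms(6) cg_sym cg_trans by blast
  then have "cg (c * (lam r * y ^ r)) (c * y ^ r)"
    by (simp add: mult.assoc)
  then have "cg (lam r * y ^ r) (y ^ r)"
    by (rule cg_cancel [OF assms(1-3)])
  then have "cg (lam r * y ^ r * inverse y ^ r) (y ^ r * inverse y ^ r)"
    by (intro cg_mult_right A_power A_y)
  then have "cg (lam r) 1"
    by (simp add: power_inverse mult.assoc)
  then have "cg (lam r - 1) (1 - 1)" by (rule cg_diff) simp
  then show False
    using unit_not_cg_0 [of "lam r - 1"] inverse_lam_minus_one [OF assms(5)] lam_ne_1 [OF assms(5)]
    by (auto intro: A_diff A_lam)
qed

end

section \<open>Powers in finite sets, and prime fields\<close>

lemma finite_power_eq_1:
  fixes t :: "'a::division_ring"
  assumes "finite W" "\<And>k. t ^ k \<in> W" "t \<noteq> 0"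
  obtains m where "m > 0" "t ^ m = 1"
proof -
  have "\<not> inj (\<lambda>k. t ^ k)"
    using assms(1,2) by (metis finite_imageD finite_subset image_subsetI infinite_UNIV_nat)
  then obtain i k where ik: "i < k" "t ^ i = t ^ k"
    by (metis injI linorder_neqE_nat)
  have "t ^ k = t ^ i * t ^ (k - i)"
    using ik(1) by (metis le_add_diff_inverse less_imp_le power_add)
  then have "t ^ (k - i) = 1" using ik assms(3) by simp
  then show ?thesis using that [of "k - i"] ik by simp
qed

lemma of_nat_eq_0_iff_dvd:
  assumes q: "prime q" "of_nat q = (0 :: 'a::ring_1)" and nontrivial: "(1 :: 'a) \<noteq> 0"
  shows "of_nat m = (0 :: 'a) \<longleftrightarrow> q dvd m"
proof
  assume m: "of_nat m = (0 :: 'a)"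
  show "q dvd m"
  proof (rule ccontr)
    assume *: "\<not> q dvd m"
    then have "coprime m q" using q(1) by (metis coprime_commute prime_imp_coprime)
    moreover have "m \<noteq> 0" using * by (metis dvd_0_right)
    ultimately obtain i k where ik: "m * i = q * k + 1"
      using bezout_nat [of m q] by auto
    have "(of_nat (m * i) :: 'a) = of_nat (q * k + 1)" by (simp only: ik)
    then show False using m q(2) nontrivial by simp
  qed
qed (use q(2) of_nat_eq_0_dvd in blast)

lemma of_nat_eq_0_prime_factor:
  assumes "of_nat m = (0 :: 'a::division_ring)" "m > 0"
  obtains q where "prime q" "of_nat q = (0 :: 'a)" "q dvd m"
proof -
  have "\<exists>q. prime q \<and> of_nat q = (0 :: 'a) \<and> q dvd m"
    using assms
  proof (induction m rule: less_induct)
    case (less m)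
    have "m \<noteq> 1" using less.prems by auto
    then obtain p where p: "prime p" "p dvd m" using prime_factor_nat by blast
    then obtain k where k: "m = p * k" by auto
    show ?case
    proof (cases "of_nat p = (0 :: 'a)")
      case False
      then have "of_nat k = (0 :: 'a)" using less.prems(1) k by simp
      moreover have "k < m" "k > 0" using k prime_gt_1_nat [OF p(1)] less.prems(2) by auto
      ultimately show ?thesis using less.IH [of k] k by auto
    qed (use p in blast)
  qed
  then show ?thesis using that by blast
qed

lemma range_of_nat_char:
  assumes q: "q > 0" "of_nat q = (0 :: 'a::ring_1)"
  shows "range (of_nat :: nat \<Rightarrow> 'a) = of_nat ` {..<q}"
proof -
  have "(of_nat k :: 'a) = of_nat (k mod q)" for k
  proof -
    have "(of_nat k :: 'a) = of_nat (q * (k div q) + k mod q)" by simp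
    also have "\<dots> = of_nat (k mod q)" by (simp only: of_nat_add of_nat_mult q(2)) simp
    finally show ?thesis .
  qed
  moreover have "k mod q < q" for k using q by simp
  ultimately show ?thesis by blast
qed

text \<open>In positive characteristic the image of the natural numbers is closed under negation,
  since \<open>- 1\<close> is the image of \<open>q - 1\<close>.\<close>

lemma scalars_range_of_nat:
  assumes q: "q > 0" "of_nat q = (0 :: 'a::division_ring)"
  shows "scalars (range (of_nat :: nat \<Rightarrow> 'a))"
proof
  show "0 \<in> range (of_nat :: nat \<Rightarrow> 'a)" by (metis of_nat_0 rangeI)
  show "1 \<in> range (of_nat :: nat \<Rightarrow> 'a)" by (metis of_nat_1 rangeI)
  fix c d :: 'a
  assume c: "c \<in> range of_nat"
  then obtain k where k: "c = of_nat k" by blast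
  have "- c = of_nat ((q - 1) * k)"
    using q by (simp add: k of_nat_diff)
  then show "- c \<in> range of_nat" by blast
  assume "d \<in> range of_nat"
  then obtain i where i: "d = of_nat i" by blast
  show "c + d \<in> range of_nat" using k i by (metis of_nat_add rangeI)
  show "c * d \<in> range of_nat" using k i by (metis of_nat_mult rangeI)
  show "commutes c d" by (simp add: i)
qed

context twisted_order
begin

section \<open>Powers of principal units\<close>

lemma commutes_x_principal:
  assumes "commutes x (1 + \<pi> ^ r * w)"
  shows "commutes x w"
proof -
  have "x * (\<pi> ^ r * w) = \<pi> ^ r * (w * x)"
    using assms by (simp add: commutes_def distrib_left distrib_right mult.assoc)
  then have "\<pi> ^ r * (x * w) = \<pi> ^ r * (w * x)"
    using pi_left_commute [OF A_x(1), of r w] by simp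
  then show ?thesis using pi_nz by (simp add: commutes_def)
qed

lemma pi_power_Suc_cg: "r > 0 \<Longrightarrow> t \<in> A \<Longrightarrow> cg (w + \<pi> ^ r * t) w"
  by (rule cgI [of _ _ "\<pi> ^ (r - 1) * t"])
    (auto simp: A_mult A_power A_R pi_R simp flip: mult.assoc power_Suc)

text \<open>First-order expansion: products of two terms of order \<open>r\<close> vanish modulo
  \<open>\<pi>\<close> relative to \<open>\<pi> ^ r\<close>, because \<open>r\<close> is
  positive.\<close>

lemma principal_power:
  assumes "w \<in> A" "r > 0"
  obtains w' where "w' \<in> A" "(1 + \<pi> ^ r * w) ^ M = 1 + \<pi> ^ r * w'" "cg w' (of_nat M * w)"
proof -
  have "\<exists>w'\<in>A. (1 + \<pi> ^ r * w) ^ M = 1 + \<pi> ^ r * w' \<and> cg w' (of_nat M * w)"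
  proof (induction M)
    case 0
    show ?case by (rule bexI [of _ 0]) auto
  next
    case (Suc M)
    then obtain v where v: "v \<in> A" "(1 + \<pi> ^ r * w) ^ M = 1 + \<pi> ^ r * v" "cg v (of_nat M * w)"
      by blast
    have "(1 + \<pi> ^ r * w) ^ Suc M = 1 + \<pi> ^ r * (w + v + \<pi> ^ r * (w * v))"
      by (simp add: v(2) algebra_simps pi_left_commute [OF assms(1)])
    moreover have "cg (w + v + \<pi> ^ r * (w * v)) (w + v)"
      by (intro pi_power_Suc_cg assms A_mult v)
    then have "cg (w + v + \<pi> ^ r * (w * v)) (w + of_nat M * w)"
      by (rule cg_trans) (intro cg_add cg_refl v)
    moreover have "w + v + \<pi> ^ r * (w * v) \<in> A"
      by (intro A_add A_mult A_power A_R pi_R assms v)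
    ultimately show ?case by (auto simp: distrib_right)
  qed
  then show ?thesis using that by blast
qed

text \<open>The power has leading coefficient \<open>M * c\<close>, still a unit, so the comparison
  of leading terms applies to it.\<close>

lemma not_commutes_x_unit_power:
  assumes s: "s = 1 + \<pi> ^ r * w" "r > 0" "w \<in> A" "c \<in> A" "inverse c \<in> A" "c \<noteq> 0" "commutes x c"
    and w: "\<not> l dvd k" "cg w (c * y ^ k)" and M: "of_nat M \<noteq> (0::'a)" "inverse (of_nat M) \<in> R"
  shows "\<not> commutes x (s ^ M)"
proof
  assume "commutes x (s ^ M)"
  obtain w' where w': "w' \<in> A" "s ^ M = 1 + \<pi> ^ r * w'" "cg w' (of_nat M * w)"
    using principal_power [OF s(3,2), of M] s(1) by blast
  then have "commutes x w'"
    using commutes_x_principal \<open>commutes x (s ^ M)\<close> by simp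
  moreover have "cg w' (of_nat M * c * y ^ k)"
    using cg_trans [OF w'(3) cg_mult_left [OF w(2)]] by (simp add: A_R R_of_nat mult.assoc)
  moreover have "inverse (of_nat M * c) \<in> A"
    using M s by (simp add: nonzero_inverse_mult_distrib A_mult A_R)
  ultimately show False
    using not_commutes_x [of "of_nat M * c" k w'] M s w
    by (auto simp: A_mult A_R R_of_nat commutes_mult)
qed

text \<open>Serves characteristic \<open>0\<close> with \<open>y ^ l\<close> transcendental.\<close>

lemma no_central_power_of_units:
  assumes "M > 0" "\<And>m. m > 0 \<Longrightarrow> of_nat m \<noteq> (0::'a) \<and> inverse (of_nat m) \<in> R"
  shows "\<not> commutes x ((commutator_step x ^^ k) (1 + \<pi> * y) ^ M)"
proof -
  obtain w where w: "w \<in> A" "(commutator_step x ^^ k) (1 + \<pi> * y) = 1 + \<pi> * w" "cg w (eps k * y)"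
    using iterated_commutator .
  have "\<not> l dvd 1" using prime_l by (metis not_prime_unit)
  then show ?thesis
    using not_commutes_x_unit_power [of _ 1 w "eps k" 1 M] w assms eps_facts x_X by simp
qed

text \<open>The quadratic term is kept explicit because \<open>M choose 2\<close> is divisible by
  \<open>M\<close> when \<open>M\<close> is an odd prime.\<close>

lemma second_order_power:
  assumes "w \<in> A"
  shows "\<exists>t\<in>A. (1 + \<pi> ^ r * w) ^ M = 1 + of_nat M * (\<pi> ^ r * w) +
    of_nat (M choose 2) * (\<pi> ^ (2 * r) * w ^ 2) + \<pi> ^ (3 * r) * t"
proof (induction M)
  case 0
  show ?case by (rule bexI [of _ 0]) (auto simp: binomial_eq_0)
next
  case (Suc M)
  then obtain t where t: "t \<in> A" "(1 + \<pi> ^ r * w) ^ M = 1 + of_nat M * (\<pi> ^ r * w) +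
    of_nat (M choose 2) * (\<pi> ^ (2 * r) * w ^ 2) + \<pi> ^ (3 * r) * t" by blast
  define a where "a = \<pi> ^ r"
  have ch: "Suc M choose 2 = M + (M choose 2)" by (simp add: numeral_2_eq_2)
  have cm: "v * (a * z) = a * (v * z)" if "v \<in> A" for v z
    unfolding a_def by (rule pi_left_commute [OF that])
  have nat: "v * (of_nat k * z) = of_nat k * (v * z)" for v z :: 'a and k
    by (rule commutes_left_commute) simp
  have a2: "\<pi> ^ (2 * r) = a * a" "\<pi> ^ (3 * r) = a * (a * a)"
    by (simp_all add: a_def mult_2 power_add numeral_3_eq_3)
  have aA: "a \<in> A" by (simp add: a_def A_power A_R pi_R)
  have "(1 + a * w) * (1 + of_nat M * (a * w) + of_nat (M choose 2) * (a * a * w ^ 2) + a * (a * a) * t) =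
      1 + of_nat (Suc M) * (a * w) + of_nat (Suc M choose 2) * (a * a * w ^ 2) +
      a * (a * a) * (of_nat (M choose 2) * w ^ 3 + t + a * (w * t))"
    by (simp add: ch distrib_left distrib_right mult.assoc cm [OF assms] nat [of a] nat [of w]
        power2_eq_square power3_eq_cube)
  moreover have "of_nat (M choose 2) * w ^ 3 + t + a * (w * t) \<in> A"
    by (intro A_add A_mult A_power A_R R_of_nat assms t aA)
  ultimately show ?case
    unfolding power_Suc a2 a_def [symmetric] t(2) [unfolded a2, folded a_def] by blast
qed

text \<open>The linear term has order \<open>r + 1\<close>. The quadratic one has order at least
  \<open>2 * r + 1\<close>, since \<open>P\<close> is odd, and the rest at least
  \<open>3 * r\<close>; both bounds are at least \<open>r + 2\<close>.\<close>

lemma residue_char_power: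
  assumes P: "prime P" "odd P" "\<pi> = of_nat P" and w: "w \<in> A" and r: "r > 0"
  obtains w' where "w' \<in> A" "(1 + \<pi> ^ r * w) ^ P = 1 + \<pi> ^ Suc r * w'" "cg w' w"
proof -
  obtain t where t: "t \<in> A" "(1 + \<pi> ^ r * w) ^ P = 1 + of_nat P * (\<pi> ^ r * w) +
      of_nat (P choose 2) * (\<pi> ^ (2 * r) * w ^ 2) + \<pi> ^ (3 * r) * t"
    using second_order_power [OF w] by blast
  obtain p where p: "r = Suc p" using r by (cases r) auto
  obtain h where h: "P = 2 * h + 1" using P(2) by (auto elim: oddE)
  have "P choose 2 = P * h" using h by (simp add: choose_two)
  then have ch: "of_nat (P choose 2) = \<pi> * of_nat h" by (simp add: P(3))
  have nat: "\<pi> ^ k * (of_nat h * z) = of_nat h * (\<pi> ^ k * z)" for z k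
    by (rule commutes_left_commute) simp
  have pw: "\<pi> ^ (2 * r) = \<pi> ^ r * \<pi> ^ Suc p" "\<pi> ^ (3 * r) = \<pi> ^ Suc r * (\<pi> * \<pi> ^ (2 * p))"
  proof -
    have "2 * r = r + Suc p" "3 * r = Suc r + Suc (2 * p)" using p by simp_all
    then show "\<pi> ^ (2 * r) = \<pi> ^ r * \<pi> ^ Suc p" "\<pi> ^ (3 * r) = \<pi> ^ Suc r * (\<pi> * \<pi> ^ (2 * p))"
      by (simp_all only: power_add power_Suc)
  qed
  define w' where "w' = w + \<pi> * (of_nat h * (\<pi> ^ p * w ^ 2) + \<pi> ^ (2 * p) * t)"
  have "(1 + \<pi> ^ r * w) ^ P = 1 + \<pi> ^ Suc r * w'"
  proof -
    have "\<pi> * of_nat h * (\<pi> ^ (2 * r) * w ^ 2) = \<pi> ^ Suc r * (\<pi> * (of_nat h * (\<pi> ^ p * w ^ 2)))"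
      using nat [of r] nat [of 1] by (simp add: pw(1) mult.assoc)
    moreover have "\<pi> ^ (3 * r) * t = \<pi> ^ Suc r * (\<pi> * (\<pi> ^ (2 * p) * t))"
      by (simp add: pw(2) mult.assoc)
    ultimately show ?thesis
      unfolding t(2) ch P(3) [symmetric] w'_def by (simp add: distrib_left mult.assoc)
  qed
  moreover have "of_nat h * (\<pi> ^ p * w ^ 2) + \<pi> ^ (2 * p) * t \<in> A"
    by (intro A_add A_mult A_power A_R R_of_nat pi_R w t)
  then have "cg w' w" "w' \<in> A"
    unfolding w'_def by (auto intro: cgI A_add A_mult A_R pi_R w)
  ultimately show ?thesis using that by blast
qed

text \<open>Serves characteristic \<open>0\<close> with \<open>y ^ l\<close> algebraic. The
  \<open>P\<close>-part of \<open>M\<close> raises the order but keeps the leading coefficient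
  modulo \<open>\<pi>\<close>; the remaining factor of \<open>M\<close> is a unit.\<close>

lemma no_central_power_residue_char:
  assumes P: "prime P" "odd P" "\<pi> = of_nat P" and M: "M > 0"
    and unit: "\<And>m. \<not> P dvd m \<Longrightarrow> of_nat m \<noteq> (0::'a) \<and> inverse (of_nat m) \<in> R"
  shows "\<not> commutes x ((commutator_step x ^^ k) (1 + \<pi> * y) ^ M)"
proof -
  obtain w where w: "w \<in> A" "(commutator_step x ^^ k) (1 + \<pi> * y) = 1 + \<pi> * w" "cg w (eps k * y)"
    using iterated_commutator .
  have *: "\<exists>w'\<in>A. (1 + \<pi> * w) ^ (P ^ e) = 1 + \<pi> ^ Suc e * w' \<and> cg w' w" for e
  proof (induction e)
    case 0
    show ?case using w by (intro bexI [of _ w]) auto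
  next
    case (Suc e)
    then obtain v where v: "v \<in> A" "(1 + \<pi> * w) ^ (P ^ e) = 1 + \<pi> ^ Suc e * v" "cg v w" by blast
    obtain v' where "v' \<in> A" "(1 + \<pi> ^ Suc e * v) ^ P = 1 + \<pi> ^ Suc (Suc e) * v'" "cg v' v"
      using residue_char_power [OF P v(1)] by blast
    moreover have "(1 + \<pi> * w) ^ (P ^ Suc e) = ((1 + \<pi> * w) ^ (P ^ e)) ^ P"
      by (metis mult.commute power_Suc power_mult)
    ultimately show ?case using v cg_trans by metis
  qed
  obtain e m where em: "M = P ^ e * m" "\<not> P dvd m"
    using multiplicity_decompose' [of M P] M P(1) by (metis not_prime_unit not_gr_zero)
  obtain v where v: "v \<in> A" "(1 + \<pi> * w) ^ (P ^ e) = 1 + \<pi> ^ Suc e * v" "cg v w"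
    using * by blast
  have "\<not> l dvd 1" using prime_l by (metis not_prime_unit)
  moreover have "cg v (eps k * y ^ 1)" using cg_trans [OF v(3) w(3)] by simp
  ultimately have "\<not> commutes x ((1 + \<pi> ^ Suc e * v) ^ m)"
    using not_commutes_x_unit_power [of _ "Suc e" v "eps k" 1 m] v unit [OF em(2)] eps_facts x_X by simp
  then show ?thesis by (simp add: w(2) em(1) power_mult v(2))
qed

text \<open>The element is a product of conjugates of \<open>eps k\<close> under powers of
  \<open>y\<close>. The induction varies \<open>u\<close>, because pulling \<open>u\<close> through
  conjugation by \<open>y\<close> replaces it by another element of \<open>X\<close>.\<close>

lemma eps_y_power_commutes:
  assumes "u \<in> X"
  shows "commutes u ((eps k * y) ^ r * inverse (y ^ r))"
  using assms
proof (induction r arbitrary: u)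
  case (Suc r)
  define v where "v = (eps k * y) ^ r * inverse (y ^ r)"
  have "(eps k * y) ^ Suc r * inverse (y ^ Suc r) = eps k * (y * v * inverse y)"
    by (simp add: v_def nonzero_inverse_mult_distrib mult.assoc power_commutes)
  moreover have "commutes u (y * v * inverse y)"
  proof -
    have "u \<in> (\<lambda>u. y * u * inverse y) ` X" by (subst X_conj_image) (rule Suc.prems)
    then obtain u' where u': "u' \<in> X" "u = y * u' * inverse y" by blast
    have "commutes u' v" unfolding v_def by (rule Suc.IH [OF u'(1)])
    then show ?thesis unfolding u'(2) by (rule commutes_conj_conj [OF y_nz])
  qed
  ultimately show ?case using eps_facts(4) [OF Suc.prems] commutes_mult by metis
qed simp

lemma eps_y_A: "eps k * y \<in> A" "inverse (eps k * y) \<in> A" "eps k * y \<noteq> 0"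
  using eps_facts(1-3) [of k] A_y
  by (auto simp: A_mult nonzero_inverse_mult_distrib)

text \<open>Write \<open>M = q ^ e * m\<close>. Frobenius computes the power \<open>q ^ e\<close>
  exactly; its leading term involves \<open>y ^ (q ^ e)\<close>, and \<open>l\<close> does not
  divide this exponent. The factor \<open>m\<close> is invertible.\<close>

lemma no_central_power_char:
  assumes q: "prime q" "of_nat q = (0 :: 'a)" "q \<noteq> l" and M: "M > 0"
    and unit: "\<And>m. of_nat m \<noteq> (0::'a) \<Longrightarrow> inverse (of_nat m) \<in> R"
  shows "\<not> commutes x ((commutator_step x ^^ k) (1 + \<pi> * y) ^ M)"
proof -
  obtain w where w: "w \<in> A" "(commutator_step x ^^ k) (1 + \<pi> * y) = 1 + \<pi> * w" "cg w (eps k * y)"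
    using iterated_commutator .
  obtain e m where em: "M = q ^ e * m" "\<not> q dvd m"
    using multiplicity_decompose' [of M q] M q(1) by (metis not_prime_unit not_gr_zero)
  define Q where "Q = q ^ e"
  have "Q > 0" using q(1) by (simp add: Q_def prime_gt_0_nat)
  have "(1 + \<pi> * w) ^ Q = 1 ^ Q + (\<pi> * w) ^ Q"
    unfolding Q_def by (rule power_add_commutes) (auto simp: q commutes_def)
  also have "(\<pi> * w) ^ Q = \<pi> ^ Q * w ^ Q"
    by (rule commutes_power_mult [OF pi_A [OF w(1)]])
  finally have sQ: "(1 + \<pi> * w) ^ Q = 1 + \<pi> ^ Q * w ^ Q" by simp
  define c where "c = (eps k * y) ^ Q * inverse (y ^ Q)"
  have "cg (w ^ Q) ((eps k * y) ^ Q)"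
    by (intro cg_power w eps_y_A)
  also have "(eps k * y) ^ Q = c * y ^ Q" by (simp add: c_def mult.assoc)
  finally have cgw: "cg (w ^ Q) (c * y ^ Q)" .
  have c: "c \<in> A" "inverse c \<in> A" "c \<noteq> 0" "commutes x c"
    using eps_y_A [of k] A_y eps_y_power_commutes [OF x_X]
    unfolding c_def
    by (auto simp: nonzero_inverse_mult_distrib A_mult A_power simp flip: power_inverse)
  have "\<not> l dvd Q"
    unfolding Q_def using prime_l q by (metis primes_dvd_imp_eq prime_dvd_power)
  moreover have "of_nat m \<noteq> (0::'a)"
    using em(2) of_nat_eq_0_iff_dvd [OF q(1,2)] by simp
  ultimately have "\<not> commutes x (((1 + \<pi> * w) ^ Q) ^ m)"
    using not_commutes_x_unit_power [OF sQ \<open>Q > 0\<close> A_power [OF w(1)] c _ cgw] unit by blast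
  then show ?thesis by (simp add: w(2) em(1) power_mult Q_def)
qed

end

section \<open>A trace given by summing over conjugates\<close>

context twisted_pair
begin

text \<open>Up to the factor \<open>n\<close>, the projection onto the centraliser of
  \<open>X\<close>.\<close>

definition conj_sum :: "'a \<Rightarrow> 'a" where "conj_sum f = (\<Sum>g\<in>X. g * f * inverse g)"

lemma conj_sum_add: "conj_sum (f + g) = conj_sum f + conj_sum g"
  by (simp add: conj_sum_def distrib_left distrib_right sum.distrib)

lemma conj_sum_scale: "(\<And>u. u \<in> X \<Longrightarrow> commutes u c) \<Longrightarrow> conj_sum (c * f) = c * conj_sum f"
  unfolding conj_sum_def sum_distrib_left
  by (rule sum.cong) (metis commutes_left_commute mult.assoc)+

lemma conj_sum_central: "(\<And>u. u \<in> X \<Longrightarrow> commutes u c) \<Longrightarrow> conj_sum c = of_nat n * c"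
  using X_nz by (simp add: conj_sum_def commutes_conj [THEN iffD2] card_X)

lemma conj_sum_conj_X:
  assumes "u \<in> X"
  shows "conj_sum (u * f * inverse u) = conj_sum f"
proof -
  have "bij_betw (\<lambda>g. g * u) X X"
    using X_mult X_inverse X_nz assms
    by (intro bij_betwI [where g = "\<lambda>g. g * inverse u"]) (auto simp: mult.assoc)
  then have "conj_sum f = (\<Sum>g\<in>X. (g * u) * f * inverse (g * u))"
    unfolding conj_sum_def by (rule sum.reindex_bij_betw [symmetric])
  also have "\<dots> = conj_sum (u * f * inverse u)"
    unfolding conj_sum_def using X_nz assms
    by (intro sum.cong) (auto simp: nonzero_inverse_mult_distrib mult.assoc)
  finally show ?thesis ..
qed

lemma conj_sum_conj_y: "conj_sum (y * f * inverse y) = y * conj_sum f * inverse y"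
proof -
  have "bij_betw (\<lambda>u. y * u * inverse y) X X"
    using X_conj_image by (auto simp: bij_betw_def inj_on_def)
  then have "conj_sum (y * f * inverse y) =
      (\<Sum>g\<in>X. (y * g * inverse y) * (y * f * inverse y) * inverse (y * g * inverse y))"
    unfolding conj_sum_def by (rule sum.reindex_bij_betw [symmetric])
  also have "\<dots> = (\<Sum>g\<in>X. y * (g * f * inverse g) * inverse y)"
    by (intro sum.cong refl) (simp add: conj_mult conj_inverse)
  finally show ?thesis by (simp add: conj_sum_def sum_distrib_left sum_distrib_right)
qed

text \<open>Averaging over \<open>X\<close> annihilates an eigenvector of conjugation by
  \<open>x\<close> whose eigenvalue \<open>lam r\<close> differs from \<open>1\<close>.\<close>

lemma conj_sum_word:
  assumes "\<And>u. u \<in> X \<Longrightarrow> commutes u v" "\<not> l dvd r"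
  shows "conj_sum (v * y ^ r) = 0"
proof -
  have "x * (v * y ^ r) * inverse x = v * (x * y ^ r * inverse x)"
    by (simp add: mult.assoc commutes_left_commute [OF assms(1) [OF x_X]])
  also have "\<dots> = lam r * (v * y ^ r)"
    by (subst conj_pow) (rule commutes_left_commute [OF assms(1) [OF lam_X], symmetric])
  finally have "conj_sum (v * y ^ r) = lam r * conj_sum (v * y ^ r)"
    using conj_sum_conj_X [OF x_X, of "v * y ^ r"] conj_sum_scale [of "lam r"] X_commutes lam_X by simp
  then have "(lam r - 1) * conj_sum (v * y ^ r) = 0" by (simp add: left_diff_distrib)
  then show ?thesis using lam_ne_1 [OF assms(2)] by simp
qed

text \<open>Models \<open>n\<close> times the reduced trace of a cyclic algebra:
  \<open>conj_sum\<close> extracts the component at \<open>y ^ 0\<close>, and the sum over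
  \<open>r\<close> is the trace of the cyclic extension.\<close>

definition trace :: "'a \<Rightarrow> 'a" where "trace f = (\<Sum>r<l. y ^ r * conj_sum f * inverse (y ^ r))"

lemma trace_add: "trace (f + g) = trace f + trace g"
  by (simp add: trace_def conj_sum_add distrib_left distrib_right sum.distrib)

lemma trace_0: "trace 0 = 0"
  using trace_add [of 0 0] by simp

lemma trace_uminus: "trace (- f) = - trace f"
  using trace_add [of f "- f"] trace_0 by (simp add: eq_neg_iff_add_eq_0 add.commute)

lemma trace_diff: "trace (f - g) = trace f - trace g"
  using trace_add [of f "- g"] trace_uminus by simp

lemma commutes_X: "commutes c x \<Longrightarrow> u \<in> X \<Longrightarrow> commutes u c"
  unfolding X_def by (auto intro!: commutes_sym [OF commutes_power])

lemma trace_scale: "commutes c x \<Longrightarrow> commutes c y \<Longrightarrow> trace (c * f) = c * trace f"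
proof -
  assume c: "commutes c x" "commutes c y"
  have "y ^ r * (c * conj_sum f) * inverse (y ^ r) = c * (y ^ r * conj_sum f * inverse (y ^ r))" for r
    using commutes_left_commute [OF commutes_power [OF c(2)], of r "conj_sum f * inverse (y ^ r)"]
    by (simp add: mult.assoc)
  then show ?thesis
    using conj_sum_scale [OF commutes_X [OF c(1)]] by (simp add: trace_def sum_distrib_left)
qed

lemma trace_central: "commutes c x \<Longrightarrow> commutes c y \<Longrightarrow> trace c = of_nat l * (of_nat n * c)"
proof -
  assume c: "commutes c x" "commutes c y"
  have "y ^ r * of_nat n * inverse (y ^ r) = of_nat n" for r
    by (subst commutes_conj) auto
  then have "trace 1 = of_nat (l * n)"
    using conj_sum_central [of 1] by (simp add: trace_def)
  then have "trace c = c * of_nat (l * n)"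
    using trace_scale [OF c, of 1] by simp
  also have "\<dots> = of_nat (l * n) * c" by (rule commutes_eq [OF commutes_of_nat])
  finally show ?thesis by (simp add: mult.assoc)
qed

lemma trace_conj_X: "u \<in> X \<Longrightarrow> trace (u * f * inverse u) = trace f"
  by (simp add: trace_def conj_sum_conj_X)

lemma conj_sum_commutes_pow: "commutes (y ^ l) f \<Longrightarrow> commutes (y ^ l) (conj_sum f)"
  unfolding conj_sum_def
  by (rule commutes_sum) (rule commutes_mult [OF commutes_mult [OF X_commutes_pow]
      commutes_inverse [OF X_commutes_pow]])

text \<open>Conjugation by \<open>y\<close> shifts the sum over \<open>r\<close> by one; it closes
  up cyclically because \<open>y ^ l\<close> commutes with \<open>conj_sum f\<close>.\<close>

lemma trace_conj_y:
  assumes "commutes (y ^ l) f"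
  shows "trace (y * f * inverse y) = trace f"
proof -
  let ?c = "\<lambda>r. y ^ r * conj_sum f * inverse (y ^ r)"
  have "trace (y * f * inverse y) = (\<Sum>r<l. ?c (Suc r))"
    unfolding trace_def conj_sum_conj_y
    by (intro sum.cong refl)
      (simp add: power_Suc2 nonzero_inverse_mult_distrib mult.assoc del: power_Suc)
  also have "\<dots> = (\<Sum>r<Suc l. ?c r) - ?c 0"
    by (subst sum.lessThan_Suc_shift) simp
  also have "\<dots> = trace f + ?c l - ?c 0" by (simp add: trace_def)
  also have "?c l = ?c 0"
    using conj_sum_commutes_pow [OF assms] by (simp add: commutes_conj [THEN iffD2])
  finally show ?thesis by simp
qed

lemma trace_commute_X: "u \<in> X \<Longrightarrow> trace (u * f) = trace (f * u)"
  using trace_conj_X [of u "f * u"] X_nz by (simp add: mult.assoc)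

lemma trace_commute_y_power:
  assumes "commutes (y ^ l) f"
  shows "trace (y ^ r * f) = trace (f * y ^ r)"
proof -
  have "trace (y ^ r * g * inverse (y ^ r)) = trace g" if "commutes (y ^ l) g" for g
  proof (induction r)
    case (Suc r)
    have "commutes (y ^ l) (y ^ r * g * inverse (y ^ r))"
      by (intro commutes_mult commutes_inverse that)
        (auto simp: commutes_def add.commute simp flip: power_add)
    then have "trace (y * (y ^ r * g * inverse (y ^ r)) * inverse y) = trace g"
      using trace_conj_y Suc by simp
    then show ?case by (simp add: nonzero_inverse_mult_distrib mult.assoc power_commutes
        flip: power_Suc2)
  qed simp
  moreover have "commutes (y ^ l) (f * y ^ r)"
    by (intro commutes_mult assms) (auto simp: commutes_def add.commute simp flip: power_add)
  ultimately have "trace (y ^ r * (f * y ^ r) * inverse (y ^ r)) = trace (f * y ^ r)" by blast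
  then show ?thesis by (simp add: mult.assoc)
qed

lemma conj_powers_inj:
  assumes "u \<in> X" "\<not> commutes y u"
  shows "inj_on (\<lambda>r. y ^ r * u * inverse (y ^ r)) {..<l}"
proof -
  define t where "t = (\<lambda>r. y ^ r * u * inverse (y ^ r))"
  have ne: "t i \<noteq> t k" if "i < k" "k < l" for i k
  proof
    assume eq: "t i = t k"
    have "y ^ k = y ^ i * y ^ (k - i)" using that by (simp flip: power_add)
    then have "t k = y ^ i * (y ^ (k - i) * u * inverse (y ^ (k - i))) * inverse (y ^ i)"
      by (simp add: t_def nonzero_inverse_mult_distrib mult.assoc)
    then have "y ^ (k - i) * u * inverse (y ^ (k - i)) = u"
      using eq by (simp add: t_def)
    then have "commutes u (y ^ (k - i))"
      by (subst (asm) commutes_conj) (auto dest: commutes_sym)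
    moreover have "\<not> l dvd k - i" using that by (simp add: nat_dvd_not_less)
    ultimately have "commutes u y"
      using commutes_prime_power [OF prime_l _ commutes_sym [OF X_commutes_pow [OF assms(1)]]] y_nz
      by blast
    then show False using assms(2) commutes_sym by blast
  qed
  then have "inj_on t {..<l}"
    by (intro inj_onI) (metis lessThan_iff linorder_neqE_nat)
  then show ?thesis by (simp add: t_def)
qed

text \<open>The traces are \<open>n\<close> times the power sums of the \<open>l\<close> distinct
  conjugates of \<open>u\<close>. By the Vandermonde argument these do not all vanish, even in
  characteristic \<open>l\<close>.\<close>

lemma trace_X_ne_0:
  assumes "u \<in> X" "\<not> commutes y u"
  obtains i where "trace (u ^ i) \<noteq> 0"
proof -
  define t where "t = (\<lambda>r. y ^ r * u * inverse (y ^ r))"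
  have tX: "t r \<in> X" for r unfolding t_def by (rule X_conj_power [OF assms(1)])
  have tr: "trace (u ^ i) = (\<Sum>r<l. of_nat n * t r ^ i)" for i
  proof -
    have "conj_sum (u ^ i) = of_nat n * u ^ i"
      using conj_sum_central X_commutes X_power [OF assms(1)] by blast
    moreover have "y ^ r * (of_nat n * u ^ i) * inverse (y ^ r) = of_nat n * t r ^ i" for r
    proof -
      have "y ^ r * (of_nat n * u ^ i) * inverse (y ^ r) =
          of_nat n * (y ^ r * u ^ i * inverse (y ^ r))"
        by (simp only: commutes_left_commute [OF commutes_of_nat] mult.assoc)
      then show ?thesis by (simp add: t_def conj_power)
    qed
    ultimately show ?thesis by (simp add: trace_def)
  qed
  have "inj_on t {..<l}" unfolding t_def by (rule conj_powers_inj [OF assms])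
  then have "\<not> (\<forall>i. (\<Sum>r<l. of_nat n * t r ^ i) = 0)"
    using power_sums_eq_0_imp_coeffs_0 [of "{..<l}" t "\<lambda>_. of_nat n"] X_commutes tX n_nz l_pos
    by auto
  then show ?thesis using that tr by auto
qed

end

section \<open>The wild case: the characteristic equals the degree\<close>

context twisted_order
begin

lemma trace_A: "f \<in> A \<Longrightarrow> trace f \<in> A"
  unfolding trace_def conj_sum_def power_inverse [symmetric]
  by (intro A_sum A_mult A_power A_y) (auto intro: A_X X_inverse)

lemma trace_pi: "trace (\<pi> ^ r * f) = \<pi> ^ r * trace f"
proof -
  have "commutes x (\<pi> ^ r)" "commutes y (\<pi> ^ r)"
    using R_x [OF pi_R] R_y [OF pi_R] by (auto intro: commutes_power dest: commutes_sym)
  then show ?thesis by (intro trace_scale) (auto dest: commutes_sym)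
qed

lemma cg_trace: "cg u v \<Longrightarrow> cg (trace u) (trace v)"
  unfolding cg_def using trace_pi [of 1] trace_A by (metis power_one_right trace_diff)

text \<open>The element \<open>h\<close> may lie outside \<open>A\<close>, as the one produced by
  the commutator argument can. On a generator \<open>u * y ^ j\<close> the two factors are moved
  around one after the other.\<close>

lemma trace_commute:
  assumes "b \<in> A" "\<And>c. c \<in> R \<Longrightarrow> commutes c h" "commutes (y ^ l) h"
  shows "trace (b * h) = trace (h * b)"
  using assms(1) unfolding A_def
proof induction
  case (add c e v)
  obtain u j where e: "e = u * y ^ j" "u \<in> X" using add.hyps by (auto simp: words_def)
  have "trace (e * h) = trace ((y ^ j * h) * u)"
    using trace_commute_X [OF e(2), of "y ^ j * h"] by (simp add: e(1) mult.assoc)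
  also have "\<dots> = trace (h * e)"
    using trace_commute_y_power [of "h * u" j] X_commutes_pow [OF e(2)] assms(3)
    by (simp add: e(1) mult.assoc commutes_mult)
  finally have eh: "trace (e * h) = trace (h * e)" .
  have "trace (h * (c * e)) = trace (c * (h * e))"
    using commutes_left_commute [OF assms(2) [OF add.hyps(1)], of e] by simp
  also have "\<dots> = trace (c * (e * h))"
    using eh by (simp add: trace_scale R_x R_y add.hyps(1))
  finally show ?case
    using add by (simp add: distrib_left distrib_right trace_add mult.assoc)
qed (simp add: trace_0)

text \<open>If \<open>b\<close> commutes with \<open>x\<close> and \<open>y\<close>, its trace is
  \<open>l * n * b = 0\<close>; otherwise \<open>b\<close> is an additive commutator.\<close>

lemma trace_purely_inseparable:
  assumes l0: "of_nat l = (0 :: 'a)" and b: "b \<in> A" "commutes (b ^ (l ^ e)) x" "commutes (b ^ (l ^ e)) y"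
  shows "trace b = 0"
proof (cases "commutes b x \<and> commutes b y")
  case True
  then show ?thesis using trace_central [of b] l0 by simp
next
  case False
  then obtain c where c: "c = x \<or> c = y" "\<not> commutes b c" by blast
  \<comment> \<open>The set collects what \<open>h\<close> has to commute with for
    \<open>trace_commute\<close>.\<close>
  have "\<exists>h. b = b * h - h * b \<and> (\<forall>s\<in>insert (y ^ l) R. commutes s h)"
  proof -
    have yl: "commutes (y ^ l) x" "commutes (y ^ l) y"
      using pow_commutes by (auto simp: commutes_def power_commutes)
    have "commutes (y ^ l) b"
      by (rule commutes_A [OF b(1)]) (use yl in \<open>auto intro: commutes_sym [OF commutes_power] dest: R_y\<close>)
    then have "commutes s b" "commutes s c" if "s \<in> insert (y ^ l) R" for s
      using that c(1) R_A [OF _ b(1)] R_x R_y yl by auto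
    moreover have "commutes (b ^ (l ^ e)) c" using b c by blast
    ultimately show ?thesis
      using purely_inseparable_is_commutator [OF prime_l l0 _ c(2), of e "insert (y ^ l) R"] by metis
  qed
  then obtain h where h: "b = b * h - h * b" "\<And>s. s \<in> insert (y ^ l) R \<Longrightarrow> commutes s h" by blast
  have "trace b = trace (b * h) - trace (h * b)" by (metis h(1) trace_diff)
  also have "\<dots> = 0" using trace_commute [OF b(1), of h] h(2) by auto
  finally show ?thesis .
qed

text \<open>
  If a power of \<open>b \<in> 1 + \<pi> A\<close> is central, then \<open>b\<close> is \<open>\<pi>\<close>-adically close to a power of \<open>b\<close>
  that is purely inseparable over the centre.
\<close>

lemma trace_principal:
  assumes l0: "of_nat l = (0 :: 'a)" and b: "b = 1 + \<pi> * f" "f \<in> A"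
    and M: "M > 0" "commutes (b ^ M) x" "commutes (b ^ M) y"
  obtains t where "t \<in> A" "trace b = \<pi> ^ Suc l * t"
proof -
  have bA: "b \<in> A" using b by (auto intro: A_add A_mult A_R pi_R)
  obtain e m where em: "M = l ^ e * m" "\<not> l dvd m"
    using multiplicity_decompose' [of M l] M(1) prime_l by (metis not_prime_unit not_gr_zero)
  \<comment> \<open>A power of \<open>l\<close>, so that Frobenius applies, and at least the order
    \<open>Suc l\<close> claimed for the trace.\<close>
  define Q where "Q = l ^ Suc l"
  have "coprime m Q" using em(2) prime_l unfolding Q_def
    by (metis coprime_commute coprime_power_right_iff prime_imp_coprime)
  moreover have "m \<noteq> 0" using em(2) by (metis dvd_0_right)
  ultimately obtain j h where jh: "m * j = Q * h + 1"
    using bezout_nat [of m Q] by auto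
  \<comment> \<open>Raised to \<open>l ^ e\<close>, this power of \<open>b\<close> becomes a power
    of \<open>b ^ M\<close>, which commutes with \<open>x\<close> and \<open>y\<close>. Since
    \<open>m * j = Q * h + 1\<close>, it differs from \<open>b\<close> only at order
    \<open>Q\<close>.\<close>
  have "trace (b ^ (m * j)) = 0"
  proof (rule trace_purely_inseparable [OF l0 A_power [OF bA]])
    have "(b ^ (m * j)) ^ (l ^ e) = (b ^ M) ^ j" by (simp add: em ac_simps flip: power_mult)
    then show "commutes ((b ^ (m * j)) ^ (l ^ e)) x" "commutes ((b ^ (m * j)) ^ (l ^ e)) y"
      using commutes_sym [OF commutes_power [OF commutes_sym [OF M(2)]]]
        commutes_sym [OF commutes_power [OF commutes_sym [OF M(3)]]] by simp_all
  qed
  have "Q > 0" using l_pos by (simp add: Q_def)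
  have "b ^ Q = 1 ^ Q + (\<pi> * f) ^ Q"
    unfolding Q_def b(1) by (rule power_add_commutes) (auto simp: prime_l l0 commutes_def)
  also have "(\<pi> * f) ^ Q = \<pi> ^ Q * f ^ Q" by (rule commutes_power_mult [OF pi_A [OF b(2)]])
  finally have "b ^ Q = 1 + \<pi> ^ Q * f ^ Q" by simp
  then obtain f' where f': "f' \<in> A" "b ^ (Q * h) = 1 + \<pi> ^ Q * f'"
    using principal_power [OF A_power [OF b(2)] \<open>Q > 0\<close>, of Q h] by (metis power_mult)
  have "b ^ (m * j) = b * (1 + \<pi> ^ Q * f')" by (simp only: jh power_add f'(2) power_one_right)
      (metis f'(2) power_commutes)
  then have "b ^ (m * j) = b + \<pi> ^ Q * (b * f')"
    by (simp add: distrib_left pi_left_commute [OF bA])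
  then have tb: "trace b = \<pi> ^ Q * (- trace (b * f'))"
    using \<open>trace (b ^ (m * j)) = 0\<close> by (simp add: trace_add trace_pi eq_neg_iff_add_eq_0)
  have "Suc l \<le> Q"
  proof -
    have "l > 1" using prime_l by (rule prime_gt_1_nat)
    then show ?thesis unfolding Q_def by (intro less_imp_le_nat power_gt_expt) simp
  qed
  then have "\<pi> ^ Q = \<pi> ^ Suc l * \<pi> ^ (Q - Suc l)" by (metis le_add_diff_inverse power_add)
  then have "trace b = \<pi> ^ Suc l * (\<pi> ^ (Q - Suc l) * (- trace (b * f')))"
    using tb by (simp add: mult.assoc)
  moreover have "\<pi> ^ (Q - Suc l) * (- trace (b * f')) \<in> A"
    by (intro A_mult A_power A_R pi_R A_uminus trace_A bA f')
  ultimately show ?thesis using that by blast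
qed

end

section \<open>The wild case: leading coefficients of traces\<close>

context twisted_order
begin

text \<open>The span of \<open>X\<close> over the prime field is finite and closed under products,
  so \<open>t\<close> is a root of unity and its inverse is a power of \<open>t\<close>.\<close>

lemma group_ring_unit:
  assumes q: "q > 0" "of_nat q = (0 :: 'a)" and t: "t \<in> ospan (range of_nat) X" "t \<noteq> 0"
  shows "t \<in> A" "inverse t \<in> A"
proof -
  interpret F: scalars "range (of_nat :: nat \<Rightarrow> 'a)"
    by (rule scalars_range_of_nat [OF q])
  have "finite (range (of_nat :: nat \<Rightarrow> 'a))" by (simp add: range_of_nat_char [OF q])
  then have fin: "finite (ospan (range of_nat) X)"
    by (rule finite_ospan [OF finite_X _ F.R_0 F.R_add])
  have "u * v \<in> ospan (range of_nat) X" if "u \<in> ospan (range of_nat) X" "v \<in> ospan (range of_nat) X" for u v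
  proof (rule F.ospan_mult [OF _ _ that])
    show "commutes c e" if "c \<in> range of_nat" for c e :: 'a
      using that by (auto intro: commutes_sym [OF commutes_of_nat])
  qed (intro ospan_base F.R_1 X_mult)
  then have pw: "t ^ m \<in> ospan (range of_nat) X" for m
    by (induction m) (auto intro: ospan_base t)
  obtain m where m: "m > 0" "t ^ m = 1"
    using finite_power_eq_1 [OF fin pw t(2)] .
  show "t \<in> A"
    using t(1) by induction (auto intro: A_add A_mult A_R R_of_nat A_X)
  then have "t ^ (m - 1) \<in> A" by (rule A_power)
  moreover have "t * t ^ (m - 1) = 1" using m by (metis Suc_pred' power_Suc)
  then have "inverse t = t ^ (m - 1)" by (rule inverse_unique)
  ultimately show "inverse t \<in> A" by simp
qed

lemma conj_X_y: "x ^ i * y * inverse (x ^ i) = lam 1 ^ i * y"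
proof (induction i)
  case (Suc i)
  have "x ^ Suc i * y * inverse (x ^ Suc i) = x * (x ^ i * y * inverse (x ^ i)) * inverse x"
    by (simp add: nonzero_inverse_mult_distrib mult.assoc power_commutes)
  also have "\<dots> = x * (lam 1 ^ i * y ^ 1) * inverse x" by (simp add: Suc)
  also have "\<dots> = lam 1 ^ i * lam 1 * y ^ 1"
    by (rule conj_x_word) (intro commutes_power X_commutes lam_X x_X)
  finally show ?case by (simp add: power_commutes)
qed simp

text \<open>Otherwise \<open>l\<close>-th powers in \<open>x * y * inverse x = lam 1 * y\<close>
  would give \<open>lam 1 ^ l = 1\<close>, which in characteristic \<open>l\<close> means
  \<open>lam 1 = 1\<close>.\<close>

lemma not_commutes_y_lam:
  assumes l0: "of_nat l = (0 :: 'a)"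
  shows "\<not> commutes y (lam 1)"
proof
  assume c: "commutes y (lam 1)"
  have 1: "x * y * inverse x = lam 1 * y" using conj_pow [of 1] by simp
  have "lam 1 ^ l * y ^ l = (x * y * inverse x) ^ l"
    by (simp only: 1 commutes_power_mult [OF commutes_sym [OF c]])
  also have "\<dots> = x * y ^ l * inverse x" by (simp add: conj_power)
  also have "\<dots> = y ^ l" using commutes_sym [OF pow_commutes] by (simp add: commutes_conj)
  finally have "lam 1 ^ (l ^ 1) = 1" by simp
  then show False using power_char_eq_1 [OF prime_l l0] lam_1_ne_1 by blast
qed

text \<open>The power commutes with \<open>X\<close>, hence with \<open>eps k\<close>, and also with
  its base \<open>eps k * y\<close>; dividing gives \<open>y\<close>.\<close>

lemma eps_y_pow_central:
  shows "commutes ((eps k * y) ^ l) x" "commutes ((eps k * y) ^ l) y"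
proof -
  define N where "N = (eps k * y) ^ l * inverse (y ^ l)"
  have C: "(eps k * y) ^ l = N * y ^ l" by (simp add: N_def mult.assoc)
  have u: "commutes u ((eps k * y) ^ l)" if "u \<in> X" for u
    by (subst C, unfold N_def, rule commutes_mult [OF eps_y_power_commutes [OF that] commutes_sym [OF X_commutes_pow [OF that]]])
  show "commutes ((eps k * y) ^ l) x" by (rule commutes_sym [OF u]) simp
  have "commutes ((eps k * y) ^ l) (eps k)"
    by (subst (2) eps_def)
      (intro commutes_power commutes_diff commutes_1 commutes_sym [OF u [OF lam_X]])
  moreover have "commutes ((eps k * y) ^ l) (eps k * y)"
    by (simp add: commutes_def power_commutes)
  ultimately have "commutes ((eps k * y) ^ l) (inverse (eps k) * (eps k * y))"
    by (rule commutes_mult [OF commutes_inverse])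
  then show "commutes ((eps k * y) ^ l) y"
    using eps_facts(3) [of k] by (simp flip: mult.assoc)
qed

text \<open>The factor \<open>(eps k * y) ^ l\<close> commutes with \<open>x\<close> and
  \<open>y\<close> and comes out of the trace; the remaining
  \<open>inverse y * lam 1 ^ i * y\<close> is a conjugate of \<open>lam 1 ^ i\<close>.\<close>

lemma trace_eps_word:
  "trace ((eps k * y) ^ (l - 1) * (eps k * (lam 1 ^ i * y))) = (eps k * y) ^ l * trace (lam 1 ^ i)"
proof -
  define f where "f = inverse y * lam 1 ^ i * y"
  have f: "y * f = lam 1 ^ i * y" by (simp add: f_def flip: mult.assoc)
  have "(eps k * y) ^ (l - 1) * (eps k * (lam 1 ^ i * y)) = (eps k * y) ^ (l - 1) * (eps k * y) * f"
    by (simp only: f [symmetric] mult.assoc)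
  also have "(eps k * y) ^ (l - 1) * (eps k * y) = (eps k * y) ^ l"
    using l_pos by (metis Suc_pred' power_Suc2)
  finally have "trace ((eps k * y) ^ (l - 1) * (eps k * (lam 1 ^ i * y))) = (eps k * y) ^ l * trace f"
    by (simp add: trace_scale eps_y_pow_central)
  moreover have "commutes (y ^ l) f"
  proof -
    have yy: "commutes (y ^ l) y" by (simp add: commutes_def power_commutes)
    have "commutes (y ^ l) (lam 1 ^ i)" by (intro commutes_power X_commutes_pow lam_X)
    then show ?thesis
      unfolding f_def by (rule commutes_mult [OF commutes_mult [OF commutes_inverse [OF yy]] yy])
  qed
  then have "trace f = trace (lam 1 ^ i)"
    using trace_conj_y [of f] by (simp add: f mult.assoc)
  ultimately show ?thesis by simp
qed

text \<open>
  The traces of all elements of \<open>G \<inter> (1 + \<pi> A)\<close> are \<open>\<pi>\<close>-adically small, hence so are the traces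
  of products such as \<open>(s - 1)^(l - 1) (s' - 1)\<close>, whose leading coefficients are known.
\<close>

lemma wild_contradiction:
  assumes l0: "of_nat l = (0 :: 'a)"
    and G_mult: "\<And>g h. g \<in> G \<Longrightarrow> h \<in> G \<Longrightarrow> g * h \<in> G"
    and G_conj: "\<And>g. g \<in> G \<Longrightarrow> x * g * inverse x \<in> G"
    and G_1: "1 \<in> G"
    and rad: "\<And>g. g \<in> G \<Longrightarrow> \<exists>M>0. commutes (g ^ M) x \<and> commutes (g ^ M) y"
    and s: "(commutator_step x ^^ k) (1 + \<pi> * y) \<in> G"
  shows False
proof -
  obtain w where w: "w \<in> A" "(commutator_step x ^^ k) (1 + \<pi> * y) = 1 + \<pi> * w" "cg w (eps k * y)"
    using iterated_commutator .
  define B where "B = {b \<in> G. \<exists>f\<in>A. b = 1 + \<pi> * f}"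
  \<comment> \<open>The exponent \<open>Suc l\<close> is one more than the order \<open>l\<close> of
    the products considered, so smallness of their traces forces the leading coefficients to have
    trace congruent to \<open>0\<close>.\<close>
  define small where "small z \<longleftrightarrow> (\<exists>t\<in>A. z = \<pi> ^ Suc l * t)" for z
  have small_diff: "small (u - v)" if "small u" "small v" for u v
    using that unfolding small_def by (metis A_diff right_diff_distrib)
  have small_B: "small (trace b)" if b: "b \<in> B" for b
  proof -
    obtain f where f: "b \<in> G" "f \<in> A" "b = 1 + \<pi> * f" using b by (auto simp: B_def)
    obtain M where "M > 0" "commutes (b ^ M) x" "commutes (b ^ M) y" using rad [OF f(1)] by blast
    then show ?thesis using trace_principal [OF l0 f(3,2)] unfolding small_def by blast
  qed
  have B_mult: "a * b \<in> B" if ab: "a \<in> B" "b \<in> B" for a b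
  proof -
    obtain f g where f: "f \<in> A" "a = 1 + \<pi> * f" "g \<in> A" "b = 1 + \<pi> * g"
      using ab by (auto simp: B_def)
    have "a * b = 1 + \<pi> * (f + g + \<pi> * (f * g))"
      by (simp add: f distrib_left distrib_right pi_left_commute_1 [OF f(1)] mult.assoc add.assoc)
    moreover have "f + g + \<pi> * (f * g) \<in> A" by (intro A_add A_mult A_R pi_R f)
    moreover have "a * b \<in> G" using ab G_mult by (simp add: B_def)
    ultimately show ?thesis unfolding B_def by blast
  qed
  have B_1: "1 \<in> B" using G_1 by (auto simp: B_def intro!: bexI [of _ 0])
  have sB: "1 + \<pi> * w \<in> B" using s w by (auto simp: B_def)
  have claim: "cg (trace (lam 1 ^ i)) 0" for i
  proof -
    \<comment> \<open>\<open>1 + \<pi> * w'\<close> is the conjugate of the iterate by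
      \<open>x ^ i\<close>. It stays in \<open>G\<close>, and \<open>w'\<close> is congruent to
      \<open>eps k * (lam 1 ^ i * y)\<close>.\<close>
    define w' where "w' = x ^ i * w * inverse (x ^ i)"
    have w'A: "w' \<in> A" unfolding w'_def by (intro A_mult w A_X X_inverse X_power x_X)
    have "x ^ i * (1 + \<pi> * w) * inverse (x ^ i) \<in> G"
    proof (induction i)
      case 0
      show ?case using s w by simp
    next
      case (Suc i)
      then show ?case
        using G_conj [OF Suc] by (simp add: nonzero_inverse_mult_distrib mult.assoc power_commutes)
    qed
    moreover have "x ^ i * (1 + \<pi> * w) * inverse (x ^ i) = 1 + \<pi> * w'"
      by (simp add: w'_def distrib_left distrib_right mult.assoc
          pi_left_commute_1 [OF A_power [OF A_x(1)]])
    ultimately have s'B: "1 + \<pi> * w' \<in> B" using w'A by (auto simp: B_def)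
    \<comment> \<open>The factor \<open>b\<close> ranges over \<open>B\<close> so that the induction
      can absorb \<open>1 + \<pi> * w\<close> into it: \<open>\<pi> * w\<close> is the difference of
      \<open>1 + \<pi> * w\<close> and \<open>1\<close>.\<close>
    have step: "\<forall>b\<in>B. small (trace (b * ((\<pi> * w) ^ m * (\<pi> * w'))))" for m
    proof (induction m)
      case 0
      show ?case
      proof
        fix b assume b: "b \<in> B"
        have "b * ((\<pi> * w) ^ 0 * (\<pi> * w')) = b * (1 + \<pi> * w') - b" by (simp add: distrib_left)
        then show "small (trace (b * ((\<pi> * w) ^ 0 * (\<pi> * w'))))"
          by (simp only: trace_diff) (intro small_diff small_B B_mult b s'B)
      qed
    next
      case (Suc m)
      show ?case
      proof
        fix b assume b: "b \<in> B"
        define F where "F = (\<pi> * w) ^ m * (\<pi> * w')"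
        have "b * ((\<pi> * w) ^ Suc m * (\<pi> * w')) = b * (1 + \<pi> * w) * F - b * F"
          by (simp add: F_def distrib_left distrib_right mult.assoc)
        moreover have "small (trace (b * (1 + \<pi> * w) * F))" "small (trace (b * F))"
          using Suc B_mult [OF b sB] b unfolding F_def by blast+
        ultimately show "small (trace (b * ((\<pi> * w) ^ Suc m * (\<pi> * w'))))"
          by (simp only: trace_diff) (rule small_diff)
      qed
    qed
    have "(\<pi> * w) ^ (l - 1) * (\<pi> * w') = \<pi> ^ l * (w ^ (l - 1) * w')"
    proof -
      have "(\<pi> * w) ^ (l - 1) * (\<pi> * w') = \<pi> ^ (l - 1) * (\<pi> * (w ^ (l - 1) * w'))"
        by (simp add: commutes_power_mult [OF pi_A [OF w(1)]] mult.assoc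
            pi_left_commute_1 [OF A_power [OF w(1)]])
      also have "\<dots> = \<pi> ^ l * (w ^ (l - 1) * w')"
        using l_pos by (metis Suc_pred' mult.assoc power_Suc2)
      finally show ?thesis .
    qed
    then obtain t where t: "t \<in> A" "\<pi> ^ l * trace (w ^ (l - 1) * w') = \<pi> ^ Suc l * t"
      using step [of "l - 1"] B_1 unfolding small_def by (metis mult_1 trace_pi)
    then have "trace (w ^ (l - 1) * w') = \<pi> * t"
      using pi_nz by (simp add: power_Suc2 mult.assoc del: power_Suc)
    then have 0: "cg (trace (w ^ (l - 1) * w')) 0"
      using t(1) by (auto simp: cg_def)
    have "cg w' (x ^ i * (eps k * y) * inverse (x ^ i))"
      unfolding w'_def by (intro cg_mult_right cg_mult_left w A_X X_inverse X_power x_X)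
    also have "x ^ i * (eps k * y) * inverse (x ^ i) = eps k * (x ^ i * y * inverse (x ^ i))"
      using commutes_left_commute [OF eps_facts(4) [OF X_power [OF x_X]], of i k "y * inverse (x ^ i)"]
      by (simp add: mult.assoc)
    also have "\<dots> = eps k * (lam 1 ^ i * y)" by (simp only: conj_X_y)
    finally have "cg (w ^ (l - 1) * w') ((eps k * y) ^ (l - 1) * (eps k * (lam 1 ^ i * y)))"
      by (intro cg_mult cg_power w eps_y_A A_power w'A)
    then have "cg (trace (w ^ (l - 1) * w')) ((eps k * y) ^ l * trace (lam 1 ^ i))"
      using cg_trace trace_eps_word by metis
    from cg_trans [OF cg_sym [OF this] 0]
    have "cg ((eps k * y) ^ l * trace (lam 1 ^ i)) ((eps k * y) ^ l * 0)" by simp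
    then show ?thesis
      by (rule cg_cancel [rotated 3])
        (use eps_y_A in \<open>auto simp: A_power simp flip: power_inverse\<close>)
  qed
  obtain i where i: "trace (lam 1 ^ i) \<noteq> 0"
    using trace_X_ne_0 [OF lam_X not_commutes_y_lam [OF l0]] .
  \<comment> \<open>A nonzero element of this span is a unit of \<open>A\<close>, hence not
    congruent to \<open>0\<close>, against \<open>claim\<close>.\<close>
  have "trace (lam 1 ^ i) \<in> ospan (range of_nat) X"
  proof -
    interpret F: scalars "range (of_nat :: nat \<Rightarrow> 'a)"
      by (rule scalars_range_of_nat [OF l_pos l0])
    have "trace (lam 1 ^ i) = (\<Sum>r<l. of_nat n * (y ^ r * lam 1 ^ i * inverse (y ^ r)))"
    proof -
      have "conj_sum (lam 1 ^ i) = of_nat n * lam 1 ^ i"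
        using conj_sum_central X_commutes X_power [OF lam_X] by blast
      moreover have "y ^ r * (of_nat n * u) * inverse (y ^ r) = of_nat n * (y ^ r * u * inverse (y ^ r))" for r u
        by (simp only: commutes_left_commute [OF commutes_of_nat] mult.assoc)
      ultimately show ?thesis by (simp add: trace_def)
    qed
    also have "\<dots> \<in> ospan (range of_nat) X"
      by (intro ospan_sum F.ospan_scale ospan_base F.R_1 X_conj_power X_power lam_X) auto
    finally show ?thesis .
  qed
  then show False
    using group_ring_unit [OF l_pos l0 _ i] unit_not_cg_0 claim i by blast
qed

end

section \<open>Local rings of scalars\<close>

text \<open>Horner evaluation in a noncommutative ring; it is multiplicative because integers
  commute with \<open>a\<close>. Integer coefficients serve all characteristics at once.\<close>

definition ev :: "'a::division_ring \<Rightarrow> int poly \<Rightarrow> 'a"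
  where "ev a f = fold_coeffs (\<lambda>c v. of_int c + a * v) f 0"

lemma ev_0 [simp]: "ev a 0 = 0"
  by (simp add: ev_def)

lemma ev_pCons [simp]: "ev a (pCons c f) = of_int c + a * ev a f"
  by (cases "c = 0 \<and> f = 0") (auto simp: ev_def)

lemma ev_1 [simp]: "ev a 1 = 1"
  by (simp add: one_pCons)

lemma ev_add: "ev a (f + g) = ev a f + ev a g"
proof (induction f arbitrary: g)
  case (pCons c f)
  show ?case by (cases g) (simp add: pCons.IH distrib_left add.assoc add.left_commute)
qed simp

lemma ev_smult: "ev a (smult c f) = of_int c * ev a f"
proof (induction f)
  case (pCons d f)
  have "a * (of_int c * v) = of_int c * (a * v)" for v
    by (rule commutes_left_commute) simp
  then show ?case by (simp add: pCons.IH distrib_left)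
qed simp

lemma ev_mult: "ev a (f * g) = ev a f * ev a g"
  by (induction f) (simp_all add: ev_add ev_smult distrib_right mult.assoc)

lemma ev_commutes: "commutes h a \<Longrightarrow> commutes h (ev a f)"
  by (induction f) (auto intro: commutes_add commutes_mult)

lemma ev_altdef: "ev a f = (\<Sum>i\<le>degree f. of_int (coeff f i) * a ^ i)"
proof (induction f)
  case (pCons c f)
  have a: "a * (of_int c * v) = of_int c * (a * v)" for v c
    by (rule commutes_left_commute) simp
  show ?case
  proof (cases "f = 0")
    case False
    then show ?thesis
      by (simp add: pCons.IH sum.atMost_Suc_shift sum_distrib_left a del: sum.atMost_Suc)
  qed simp
qed simp

text \<open>Localisation of \<open>C\<close> at \<open>S\<close>, with membership expressed by
  clearing denominators. If \<open>u * s\<close> lies in \<open>C\<close>, then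
  \<open>s + \<pi> * (u * s)\<close> is a denominator for the inverse of
  \<open>1 + \<pi> * u\<close>.\<close>

lemma fraction_local_scalars:
  fixes \<pi> :: "'a::division_ring" and C S :: "'a set"
  assumes C: "\<And>c d. c \<in> C \<Longrightarrow> d \<in> C \<Longrightarrow> c + d \<in> C \<and> c * d \<in> C \<and> - c \<in> C \<and> commutes c d"
    and S_C: "S \<subseteq> C" and C_0: "0 \<in> C" and S_1: "1 \<in> S" and S_mult: "\<And>s t. s \<in> S \<Longrightarrow> t \<in> S \<Longrightarrow> s * t \<in> S"
    and S_0: "0 \<notin> S" and pi: "\<pi> \<in> C" "\<pi> \<noteq> 0" and S_pi: "\<And>s c. s \<in> S \<Longrightarrow> c \<in> C \<Longrightarrow> s + \<pi> * c \<in> S"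
  shows "local_scalars {u. \<exists>s\<in>S. u * s \<in> C} \<pi>"
proof -
  define Q where "Q = {u. \<exists>s\<in>S. u * s \<in> C}"
  have C_Q: "c \<in> C \<Longrightarrow> c \<in> Q" for c using S_1 unfolding Q_def by (auto intro!: bexI [of _ 1])
  have cm: "c * d = d * c" if "c \<in> C" "d \<in> C" for c d using C that commutes_eq by blast
  have S_nz: "s \<in> S \<Longrightarrow> s \<noteq> 0" for s using S_0 by blast
  have main: "u + v \<in> Q \<and> u * v \<in> Q \<and> commutes u v" if uv: "u \<in> Q" "v \<in> Q" for u v
  proof -
    obtain s t where st: "s \<in> S" "u * s \<in> C" "t \<in> S" "v * t \<in> C" using uv by (auto simp: Q_def)
    have sC: "s \<in> C" "t \<in> C" using st S_C by auto
    have "(u + v) * (s * t) = (u * s) * t + (v * t) * s"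
      using cm [OF sC] by (simp add: distrib_right mult.assoc)
    then have "(u + v) * (s * t) \<in> C" using C st sC by simp
    then have 1: "u + v \<in> Q" unfolding Q_def using S_mult st by blast
    have uv: "(u * v) * (t * s) = (u * s) * (v * t)"
      using cm [OF st(4) sC(1)] by (metis mult.assoc)
    then have "(u * v) * (t * s) \<in> C" using C st by simp
    then have 2: "u * v \<in> Q" unfolding Q_def using S_mult st by blast
    have "(v * u) * (s * t) = (v * t) * (u * s)"
      using cm [OF st(2) sC(2)] by (metis mult.assoc)
    then have "(v * u) * (t * s) = (u * v) * (t * s)"
      using uv cm [OF sC] cm [OF st(2,4)] by simp
    then have "u * v = v * u" using S_nz st by auto
    then show ?thesis using 1 2 by (simp add: commutes_def)
  qed
  have "local_scalars Q \<pi>"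
  proof
    show "0 \<in> Q" "1 \<in> Q" "\<pi> \<in> Q" using C_Q C_0 S_1 S_C pi by auto
    show "- u \<in> Q" if "u \<in> Q" for u using that C unfolding Q_def by auto
    show "1 + \<pi> * u \<noteq> 0 \<and> inverse (1 + \<pi> * u) \<in> Q" if u: "u \<in> Q" for u
    proof -
      obtain s where s: "s \<in> S" "u * s \<in> C" using u by (auto simp: Q_def)
      define t where "t = s + \<pi> * (u * s)"
      have t: "t \<in> S" "(1 + \<pi> * u) * s = t"
        using S_pi s by (auto simp: t_def distrib_right mult.assoc)
      then have nz: "1 + \<pi> * u \<noteq> 0" using S_nz [OF t(1)] by auto
      have "inverse (1 + \<pi> * u) * t = s" using nz by (simp flip: t(2) mult.assoc)
      then show ?thesis using nz t(1) s(1) S_C unfolding Q_def by auto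
    qed
  qed (use main pi in auto)
  then show ?thesis by (simp add: Q_def)
qed

section \<open>Orders for transcendental and for algebraic \<open>y ^ l\<close>\<close>

context twisted_pair
begin

lemma inverse_y: "inverse y = y ^ (l - 1) * inverse (y ^ l)"
proof -
  have "y ^ l = y * y ^ (l - 1)" "y ^ l = y ^ (l - 1) * y"
    using l_pos by (metis Suc_pred' power_Suc, metis Suc_pred' power_Suc2)
  have "y * (y ^ (l - 1) * inverse (y ^ l)) = y ^ l * inverse (y ^ l)"
    using \<open>y ^ l = y * y ^ (l - 1)\<close> by (simp add: mult.assoc)
  then have "y * (y ^ (l - 1) * inverse (y ^ l)) = 1" by simp
  then show ?thesis by (rule inverse_unique)
qed

text \<open>
  The transcendental case: scalars are the fractions \<open>f(a) / g(a)\<close> with \<open>g(1) \<noteq> 0\<close>, where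
  \<open>a = y ^ l\<close>, and the uniformiser is \<open>a - 1\<close>.
\<close>

lemma transcendental_order:
  assumes tr: "\<And>f i. ev (y ^ l) f = 0 \<Longrightarrow> of_int (coeff f i) = (0::'a)"
  obtains R where "twisted_order x y n l R (y ^ l - 1) l"
    "\<And>m. of_nat m \<noteq> (0::'a) \<Longrightarrow> inverse (of_nat m) \<in> R"
proof -
  define a where "a = y ^ l"
  define C where "C = range (ev a)"
  define S where "S = ev a ` {g. of_int (poly g 1) \<noteq> (0::'a)}"
  define R where "R = {u. \<exists>s\<in>S. u * s \<in> C}"
  \<comment> \<open>Transcendence makes the value at \<open>1\<close> well defined; in particular
    \<open>0\<close> is not a denominator.\<close>
  have poly1: "of_int (poly g 1) = (0::'a)" if "ev a g = 0" for g
    using tr that by (simp add: poly_altdef a_def)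
  have am: "a - 1 = ev a [:-1, 1:]" by simp
  have loc: "local_scalars R (a - 1)"
    unfolding R_def
  proof (rule fraction_local_scalars)
    show "c + d \<in> C \<and> c * d \<in> C \<and> - c \<in> C \<and> commutes c d" if cd: "c \<in> C" "d \<in> C" for c d
    proof -
      obtain f g where fg: "c = ev a f" "d = ev a g" using cd unfolding C_def by blast
      have "commutes c d" unfolding fg
        by (intro ev_commutes commutes_sym [OF ev_commutes]) simp
      moreover have "- c = ev a (smult (-1) f)" unfolding fg ev_smult by simp
      ultimately show ?thesis unfolding C_def fg by (metis ev_add ev_mult rangeI)
    qed
    show "S \<subseteq> C" by (auto simp: S_def C_def)
    show "0 \<in> C" unfolding C_def by (metis ev_0 rangeI)
    show "1 \<in> S" unfolding S_def by (rule image_eqI [of _ _ 1]) auto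
    show "s * t \<in> S" if st: "s \<in> S" "t \<in> S" for s t
    proof -
      obtain f g where fg: "s = ev a f" "t = ev a g" "of_int (poly f 1) \<noteq> (0::'a)"
        "of_int (poly g 1) \<noteq> (0::'a)" using st by (auto simp: S_def)
      then show ?thesis unfolding S_def by (intro image_eqI [of _ _ "f * g"]) (auto simp: ev_mult)
    qed
    show "0 \<notin> S" unfolding S_def using poly1 by auto
    show "a - 1 \<in> C" unfolding C_def am by blast
    show "a - 1 \<noteq> 0"
      using tr [of "[:-1, 1:]" 1] by (auto simp: a_def)
    show "s + (a - 1) * c \<in> S" if sc: "s \<in> S" "c \<in> C" for s c
    proof -
      obtain f g where fg: "s = ev a f" "c = ev a g" "of_int (poly f 1) \<noteq> (0::'a)"
        using sc by (auto simp: S_def C_def)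
      have "s + (a - 1) * c = ev a (f + [:-1, 1:] * g)"
        unfolding fg am ev_add ev_mult ..
      then show ?thesis unfolding S_def using fg(3)
        by (intro image_eqI [of _ _ "f + [:-1, 1:] * g"]) auto
    qed
  qed
  interpret R: local_scalars R "a - 1" by (rule loc)
  have ax: "commutes a x" "commutes a y"
    using pow_commutes by (auto simp: a_def commutes_def power_commutes)
  have comm: "commutes u h" if u: "u \<in> R" and h: "commutes h a" for u h
  proof -
    obtain s where s: "s \<in> S" "u * s \<in> C" using u by (auto simp: R_def)
    have hs: "commutes h s" "commutes h (u * s)" using s ev_commutes [OF h] by (auto simp: S_def C_def)
    have "s \<noteq> 0" using s(1) poly1 by (auto simp: S_def)
    moreover have "u * h * s = h * u * s"
      using commutes_eq [OF hs(1)] commutes_eq [OF hs(2)] by (simp add: mult.assoc)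
    ultimately show ?thesis by (simp add: commutes_def)
  qed
  have nat: "inverse (of_nat m) \<in> R" if "of_nat m \<noteq> (0::'a)" for m
    unfolding R_def
  proof (intro CollectI bexI)
    show "inverse (of_nat m) * of_nat m \<in> C"
      using that unfolding C_def by (metis ev_1 left_inverse rangeI)
    show "of_nat m \<in> S" unfolding S_def using that by (intro image_eqI [of _ _ "[:int m:]"]) auto
  qed
  have aR: "a \<in> R" "inverse a \<in> R"
  proof -
    have a: "a = ev a [:0, 1:]" by simp
    then have "a \<in> C" unfolding C_def by (metis rangeI)
    moreover have "1 \<in> S" unfolding S_def by (rule image_eqI [of _ _ 1]) auto
    ultimately show "a \<in> R" unfolding R_def by (auto intro!: bexI [of _ 1])
    have "a \<in> S" unfolding S_def by (rule image_eqI [of _ _ "[:0, 1:]"]) auto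
    moreover have "inverse a * a = ev a 1" by (simp add: a_def)
    ultimately show "inverse a \<in> R" unfolding R_def C_def by blast
  qed
  have "twisted_order x y n l R (a - 1) l"
  proof
    show "commutes c x" "commutes c y" if "c \<in> R" for c
      using comm [OF that] ax commutes_sym by blast+
    show "l > 0" by (rule l_pos)
    have "y ^ 0 \<in> (^) y ` {..<l}" using l_pos by blast
    then have "a * y ^ 0 \<in> ospan R ((^) y ` {..<l})"
      by (intro R.ospan_scale aR ospan_base R.R_1)
    then show "y ^ l \<in> ospan R ((^) y ` {..<l})" by (simp add: a_def)
    have "y ^ (l - 1) \<in> (^) y ` {..<l}" using l_pos by auto
    then have "inverse a * y ^ (l - 1) \<in> ospan R ((^) y ` {..<l})"
      by (intro R.ospan_scale aR ospan_base R.R_1)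
    moreover have "inverse y = inverse a * y ^ (l - 1)"
    proof -
      have "commutes (y ^ (l - 1)) (inverse a)"
        by (intro commutes_inverse) (simp add: a_def commutes_def add.commute flip: power_add)
      then show ?thesis using inverse_y by (simp add: commutes_def a_def)
    qed
    ultimately show "inverse y \<in> ospan R ((^) y ` {..<l})" by simp
    show "inverse (of_nat n) \<in> R" by (rule nat [OF n_nz])
  qed
  then show ?thesis using that nat unfolding a_def by blast
qed

text \<open>
  The algebraic case in characteristic \<open>0\<close>: scalars are the rational numbers with denominator
  prime to \<open>P\<close>.  The prime \<open>P\<close> avoids \<open>2 n\<close> and the outer coefficients of an integer polynomial
  annihilating \<open>y ^ l\<close>.
\<close>

lemma algebraic_order:
  assumes char_0: "\<And>m. m > 0 \<Longrightarrow> of_nat m \<noteq> (0::'a)"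
    and alg: "ev (y ^ l) f\<^sub>0 = 0" "f\<^sub>0 \<noteq> 0"
  obtains R P L where "twisted_order x y n l R (of_nat P) L" "prime P" "odd P"
    "\<And>m. \<not> P dvd m \<Longrightarrow> of_nat m \<noteq> (0::'a) \<and> inverse (of_nat m) \<in> R"
proof -
  define a where "a = y ^ l"
  have int_nz: "of_int i \<noteq> (0::'a)" if "i \<noteq> 0" for i
  proof -
    have "nat \<bar>i\<bar> > 0" using that by simp
    then have "of_nat (nat \<bar>i\<bar>) \<noteq> (0::'a)" by (rule char_0)
    then show ?thesis by (cases "i \<ge> 0") (auto simp: of_nat_nat)
  qed
  define d where "d = (LEAST d. \<exists>f. f \<noteq> 0 \<and> ev a f = 0 \<and> degree f = d)"
  have "\<exists>f. f \<noteq> 0 \<and> ev a f = 0 \<and> degree f = d"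
    unfolding d_def by (rule LeastI_ex) (use alg a_def in blast)
  then obtain f where f: "f \<noteq> 0" "ev a f = 0" "degree f = d" by blast
  have min: "d \<le> degree g" if "g \<noteq> 0" "ev a g = 0" for g
    unfolding d_def by (rule Least_le) (use that in blast)
  \<comment> \<open>A zero constant term could be removed by cancelling \<open>a\<close>, against
    the minimality of the degree.\<close>
  have c0: "coeff f 0 \<noteq> 0"
  proof
    assume "coeff f 0 = 0"
    then obtain g where g: "f = pCons 0 g" by (cases f) auto
    then have "g \<noteq> 0" "ev a g = 0" using f(1,2) by (auto simp: a_def)
    then show False using min [of g] f(3) g by simp
  qed
  have "d > 0"
  proof (rule ccontr)
    assume "\<not> d > 0"
    then obtain k where "f = [:k:]" using f(3) by (auto elim: degree_eq_zeroE)
    then show False using f(2) int_nz [OF c0] by simp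
  qed
  define h where "h i = (of_int (coeff f i) :: 'a)" for i
  have h_sum: "(\<Sum>i\<le>d. h i * a ^ i) = 0"
    using f(2,3) by (simp add: ev_altdef h_def)
  have cd: "coeff f d \<noteq> 0" using f by auto
  \<comment> \<open>The bound makes \<open>P\<close> odd and prime to \<open>n\<close> and to both
    outer coefficients, so that \<open>n\<close>, \<open>h 0\<close> and \<open>h d\<close> are
    units of \<open>R\<close>.\<close>
  obtain P where P: "prime P" "P > 2 + n + nat \<bar>coeff f 0\<bar> + nat \<bar>coeff f d\<bar>"
    using bigger_prime by blast
  have "odd P" using P prime_odd_nat by auto
  define C where "C = range (of_int :: int \<Rightarrow> 'a)"
  define S where "S = (of_int :: int \<Rightarrow> 'a) ` {m. \<not> int P dvd m}"
  define R where "R = {u. \<exists>s\<in>S. u * s \<in> C}"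
  define \<pi> where "\<pi> = (of_nat P :: 'a)"
  have S_1: "1 \<in> S"
    unfolding S_def using P(1) by (intro image_eqI [of _ _ 1]) (auto simp: prime_nat_iff)
  have "local_scalars R \<pi>"
    unfolding R_def
  proof (rule fraction_local_scalars)
    show "c + d \<in> C \<and> c * d \<in> C \<and> - c \<in> C \<and> commutes c d" if cd: "c \<in> C" "d \<in> C" for c d
    proof -
      obtain i k where "c = of_int i" "d = of_int k" using cd by (auto simp: C_def)
      then show ?thesis unfolding C_def
        by (simp flip: of_int_add of_int_mult of_int_minus)
    qed
    show "S \<subseteq> C" by (auto simp: S_def C_def)
    show "0 \<in> C" unfolding C_def by (metis of_int_0 rangeI)
    show "1 \<in> S" by (rule S_1)
    show "s * t \<in> S" if st: "s \<in> S" "t \<in> S" for s t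
    proof -
      obtain i k where "s = of_int i" "t = of_int k" "\<not> int P dvd i" "\<not> int P dvd k"
        using st by (auto simp: S_def)
      moreover have "prime (int P)" using P(1) by simp
      ultimately show ?thesis unfolding S_def
        by (intro image_eqI [of _ _ "i * k"]) (auto simp: prime_dvd_mult_iff)
    qed
    show "0 \<notin> S" unfolding S_def using int_nz by (metis dvd_0_right imageE mem_Collect_eq)
    show "\<pi> \<in> C" unfolding C_def \<pi>_def by (metis of_int_of_nat_eq rangeI)
    show "\<pi> \<noteq> 0" unfolding \<pi>_def using char_0 P by (metis prime_gt_0_nat)
    show "s + \<pi> * c \<in> S" if sc: "s \<in> S" "c \<in> C" for s c
    proof -
      obtain i k where "s = of_int i" "c = of_int k" "\<not> int P dvd i"
        using sc by (auto simp: S_def C_def)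
      then show ?thesis unfolding S_def \<pi>_def
        by (intro image_eqI [of _ _ "i + int P * k"]) (auto simp: dvd_add_left_iff)
    qed
  qed
  then interpret R: local_scalars R \<pi> .
  have inv_int: "inverse (of_int i) \<in> R" if "\<not> int P dvd i" for i
  proof -
    have "i \<noteq> 0" using that by auto
    then have "inverse (of_int i) * of_int i = (of_int 1 :: 'a)" using int_nz by simp
    moreover have "of_int i \<in> S" using that by (auto simp: S_def)
    ultimately show ?thesis unfolding R_def C_def by blast
  qed
  have int_R: "of_int i \<in> R" for i
    unfolding R_def C_def using S_1 by (intro CollectI bexI [of _ 1]) auto
  have inv_nat: "of_nat m \<noteq> (0::'a) \<and> inverse (of_nat m) \<in> R" if "\<not> P dvd m" for m
    using inv_int [of "int m"] char_0 [of m] that by (metis dvd_0_right int_dvd_int_iff not_gr_zero of_int_of_nat_eq)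
  have not_dvd: "\<not> int P dvd i" if "i \<noteq> 0" "nat \<bar>i\<bar> < P" for i
    using that by (metis dvd_imp_le_int int_dvd_int_iff linorder_not_le nat_int of_nat_nat abs_ge_zero
        zdvd_not_zless zero_less_abs_iff dvd_abs_iff nat_less_iff)
  have h0: "inverse (h 0) \<in> R" "h 0 \<noteq> 0" and hd: "inverse (h d) \<in> R" "h d \<noteq> 0"
    unfolding h_def using inv_int not_dvd c0 cd P(2) int_nz by auto
  \<comment> \<open>An equation of degree \<open>d\<close> for \<open>a = y ^ l\<close> is one of
    degree \<open>l * d\<close> for \<open>y\<close>. Dividing it by \<open>h d\<close> gives
    integrality of \<open>y\<close>, dividing by \<open>h 0\<close> that of its inverse.\<close>
  define L where "L = l * d"
  have ypow: "a ^ i = y ^ (l * i)" for i by (simp add: a_def power_mult)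
  have gen: "c * y ^ j \<in> ospan R ((^) y ` {..<L})" if "c \<in> R" "j < L" for c j
    using that by (intro R.ospan_scale ospan_base R.R_1) auto
  have "twisted_order x y n l R \<pi> L"
  proof
    have comm: "commutes c g" if c: "c \<in> R" for c g
    proof -
      obtain i k where "\<not> int P dvd i" "c * of_int i = of_int k"
        using c by (auto simp: R_def S_def C_def)
      moreover from this have "of_int i \<noteq> (0::'a)" using int_nz by (metis dvd_0_right)
      ultimately have "c = of_int k * inverse (of_int i)"
        by (metis mult.assoc mult_1_right right_inverse)
      moreover have "commutes g (of_int k * inverse (of_int i))"
        by (intro commutes_mult commutes_inverse commutes_of_int)
      ultimately show ?thesis using commutes_sym by blast
    qed
    show "commutes c x" "commutes c y" if "c \<in> R" for c using comm that by auto
    show "L > 0" using l_pos \<open>d > 0\<close> by (simp add: L_def)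
    have "h d * a ^ d + (\<Sum>i<d. h i * a ^ i) = 0"
      using h_sum by (simp add: lessThan_Suc_atMost [symmetric] add.commute)
    then have "h d * a ^ d = - (\<Sum>i<d. h i * a ^ i)" by (simp add: eq_neg_iff_add_eq_0)
    then have "a ^ d = inverse (h d) * (- (\<Sum>i<d. h i * a ^ i))"
      using hd(2) by (metis left_inverse mult.assoc mult_1)
    moreover have "(\<Sum>i<d. h i * a ^ i) \<in> ospan R ((^) y ` {..<L})"
      using l_pos unfolding ypow by (intro ospan_sum gen) (auto simp: L_def h_def int_R)
    ultimately show "y ^ L \<in> ospan R ((^) y ` {..<L})"
      using R.ospan_scale [OF hd(1) R.ospan_uminus] by (simp add: L_def ypow)
    show "inverse y \<in> ospan R ((^) y ` {..<L})"
    proof -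
      have "(\<Sum>i\<le>d. h i * a ^ i) = h 0 + (\<Sum>i<d. h (Suc i) * a ^ Suc i)"
        by (cases d) (auto simp: sum.atMost_Suc_shift lessThan_Suc_atMost \<open>d > 0\<close> simp del: sum.atMost_Suc power_Suc)
      also have "\<dots> = h 0 + (\<Sum>i<d. h (Suc i) * a ^ i) * a"
        by (simp add: sum_distrib_right power_Suc2 mult.assoc del: power_Suc)
      finally have "h 0 = - (\<Sum>i<d. h (Suc i) * a ^ i) * a"
        using h_sum by (simp add: eq_neg_iff_add_eq_0)
      then have "1 = inverse (h 0) * (- (\<Sum>i<d. h (Suc i) * a ^ i)) * a"
        using h0(2) by (metis left_inverse mult.assoc)
      then have "inverse a = inverse (h 0) * (- (\<Sum>i<d. h (Suc i) * a ^ i))"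
        (is "_ = ?v")
      proof -
        have "inverse a = (?v * a) * inverse a"
          using \<open>1 = ?v * a\<close> by (simp flip: mult.assoc)
        also have "\<dots> = ?v" by (simp only: mult.assoc) (simp add: a_def)
        finally show ?thesis .
      qed
      moreover have "inverse y = inverse a * y ^ (l - 1)"
      proof -
        have "commutes (y ^ (l - 1)) (inverse a)"
          by (intro commutes_inverse) (simp add: a_def commutes_def add.commute flip: power_add)
        then show ?thesis using inverse_y by (simp add: commutes_def a_def)
      qed
      ultimately have "inverse y = inverse (h 0) * (- (\<Sum>i<d. h (Suc i) * y ^ (l * i + (l - 1))))"
        by (simp add: ypow power_add sum_distrib_right mult.assoc)
      moreover have "l * i + (l - 1) < L" if "i < d" for i
      proof -
        have "l * i + (l - 1) < l * Suc i" using l_pos by simp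
        also have "\<dots> \<le> L" unfolding L_def using that by (intro mult_le_mono2) simp
        finally show ?thesis .
      qed
      then have "(\<Sum>i<d. h (Suc i) * y ^ (l * i + (l - 1))) \<in> ospan R ((^) y ` {..<L})"
        by (intro ospan_sum gen) (auto simp: h_def int_R)
      ultimately show ?thesis
        using R.ospan_scale [OF h0(1) R.ospan_uminus] by simp
    qed
    have "\<not> P dvd n" using P(2) n_pos by (auto dest: dvd_imp_le)
    then show "inverse (of_nat n) \<in> R" using inv_nat by blast
  qed
  then show ?thesis using that P(1) \<open>odd P\<close> inv_nat unfolding \<pi>_def by blast
qed

end

section \<open>The finite case\<close>

lemma card_le_card_image_times:
  assumes "finite K" "\<And>e. e \<in> K \<Longrightarrow> card {d \<in> K. f d = f e} \<le> m"
  shows "card K \<le> card (f ` K) * m"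
proof -
  have "card K = (\<Sum>v\<in>f ` K. card {d \<in> K. f d = v})"
    using sum.image_gen [OF assms(1), of "\<lambda>_. 1 :: nat" f] by simp
  also have "\<dots> \<le> (\<Sum>v\<in>f ` K. m)" by (rule sum_mono) (use assms(2) in auto)
  finally show ?thesis by simp
qed

lemma card_image_times_le_card:
  assumes "finite K" "\<And>e. e \<in> K \<Longrightarrow> m \<le> card {d \<in> K. f d = f e}"
  shows "card (f ` K) * m \<le> card K"
proof -
  have "card (f ` K) * m = (\<Sum>v\<in>f ` K. m)" by simp
  also have "\<dots> \<le> (\<Sum>v\<in>f ` K. card {d \<in> K. f d = v})"
    by (rule sum_mono) (use assms(2) in auto)
  also have "\<dots> = card K"
    using sum.image_gen [OF assms(1), of "\<lambda>_. 1 :: nat" f] by simp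
  finally show ?thesis .
qed

lemma inverse_of_nat_char:
  assumes q: "prime q" "of_nat q = (0 :: 'a::division_ring)" and m: "of_nat m \<noteq> (0 :: 'a)"
  shows "inverse (of_nat m) \<in> range (of_nat :: nat \<Rightarrow> 'a)"
proof -
  have "\<not> q dvd m" using m of_nat_eq_0_dvd [OF q(2)] by blast
  then have "coprime m q" using q(1) by (metis coprime_commute prime_imp_coprime)
  moreover have "m \<noteq> 0" using m by (metis of_nat_0)
  ultimately obtain i k where ik: "m * i = q * k + 1"
    using bezout_nat [of m q] by auto
  have "of_nat m * of_nat i = (of_nat (q * k + 1) :: 'a)" by (simp only: flip: ik of_nat_mult)
  then have "of_nat m * of_nat i = (1 :: 'a)" using q(2) by simp
  then have "inverse (of_nat m) = (of_nat i :: 'a)" by (rule inverse_unique)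
  then show ?thesis by simp
qed

lemma of_int_char:
  assumes "q > 0" "of_nat q = (0 :: 'a::ring_1)"
  shows "of_int c \<in> range (of_nat :: nat \<Rightarrow> 'a)"
proof -
  have "(of_int c :: 'a) = of_int (int q * (c div int q) + c mod int q)" by simp
  also have "\<dots> = of_int (c mod int q)" by (simp only: of_int_add of_int_mult of_int_of_nat_eq assms(2)) simp
  also have "\<dots> = of_nat (nat (c mod int q))" using assms(1) by (simp add: of_nat_nat)
  finally show ?thesis by simp
qed

text \<open>A relation over the prime field puts all powers of \<open>a\<close> into a finite span,
  where two of them must coincide.\<close>

lemma algebraic_imp_torsion:
  fixes a :: "'a::division_ring"
  assumes q: "prime q" "of_nat q = (0 :: 'a)" and a: "a \<noteq> 0"
    and alg: "ev a f = 0" "of_int (coeff f i) \<noteq> (0 :: 'a)"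
  obtains m where "m > 0" "a ^ m = 1"
proof -
  have q0: "q > 0" using q(1) by (rule prime_gt_0_nat)
  interpret F: scalars "range (of_nat :: nat \<Rightarrow> 'a)"
    by (rule scalars_range_of_nat [OF q0 q(2)])
  define h where "h i = (of_int (coeff f i) :: 'a)" for i
  \<comment> \<open>The degree after reduction to the prime field, where the top coefficients of
    \<open>f\<close> may vanish.\<close>
  define d where "d = Max {i. i \<le> degree f \<and> h i \<noteq> 0}"
  have ne: "finite {i. i \<le> degree f \<and> h i \<noteq> 0}" "{i. i \<le> degree f \<and> h i \<noteq> 0} \<noteq> {}"
    using alg(2) by (auto simp: h_def intro!: exI [of _ i] le_degree)
  have d: "d \<le> degree f" "h d \<noteq> 0" using Max_in [OF ne] by (auto simp: d_def)
  have top: "h i = 0" if "i \<le> degree f" "d < i" for i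
    using Max_ge [OF ne(1), of i] that unfolding d_def by fastforce
  have "0 = (\<Sum>i\<le>degree f. h i * a ^ i)" using alg(1) by (simp add: ev_altdef h_def)
  also have "\<dots> = (\<Sum>i\<le>d. h i * a ^ i)"
    by (rule sum.mono_neutral_right) (use d top in auto)
  also have "\<dots> = h d * a ^ d + (\<Sum>i<d. h i * a ^ i)"
    by (simp add: lessThan_Suc_atMost [symmetric] add.commute)
  finally have "h d * a ^ d = - (\<Sum>i<d. h i * a ^ i)" by (simp add: eq_neg_iff_add_eq_0)
  then have ad: "a ^ d = inverse (h d) * (- (\<Sum>i<d. h i * a ^ i))"
    using d(2) by (metis left_inverse mult.assoc mult_1)
  have hF: "h i \<in> range of_nat" for i unfolding h_def by (rule of_int_char [OF q0 q(2)])
  then have hd: "inverse (h d) \<in> range of_nat"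
    using inverse_of_nat_char [OF q] d(2) by (metis rangeE)
  have "d > 0"
  proof (rule ccontr)
    assume "\<not> d > 0"
    then show False using ad by simp
  qed
  have "(\<Sum>i<d. h i * a ^ i) \<in> ospan (range of_nat) ((^) a ` {..<d})"
    by (intro ospan_sum F.ospan_scale hF ospan_base F.R_1) auto
  then have "a ^ d \<in> ospan (range of_nat) ((^) a ` {..<d})"
    unfolding ad by (intro F.ospan_scale F.ospan_uminus hd)
  then have pw: "a ^ m \<in> ospan (range of_nat) ((^) a ` {..<d})" for m
    by (rule F.power_integral [OF \<open>d > 0\<close>]) (auto intro: commutes_sym [OF commutes_of_nat])
  have "finite (range (of_nat :: nat \<Rightarrow> 'a))" by (simp add: range_of_nat_char [OF q0 q(2)])
  then have "finite (ospan (range of_nat) ((^) a ` {..<d}))"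
    by (intro finite_ospan F.R_0 F.R_add) auto
  from finite_power_eq_1 [OF this pw a] show ?thesis using that by blast
qed

locale finite_twisted_pair = twisted_pair x y n l for x y :: "'a::division_ring" and n l :: nat +
  fixes q m :: nat
  assumes q: "prime q" "of_nat q = (0 :: 'a)" and m: "m > 0" "(y ^ l) ^ m = 1"
begin

lemma q_pos: "q > 0" using q(1) by (rule prime_gt_0_nat)

sublocale F: scalars "range (of_nat :: nat \<Rightarrow> 'a)"
  by (rule scalars_range_of_nat [OF q_pos q(2)])

definition words :: "'a set" where "words = {u * (y ^ l) ^ k | u k. u \<in> X \<and> k < m}"

text \<open>The finite field generated by \<open>x\<close> and \<open>y ^ l\<close>; conjugation by
  \<open>y\<close> acts on it as an automorphism of order \<open>l\<close>.\<close>

definition K :: "'a set" where "K = ospan (range of_nat) words"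

lemma word_in: "u \<in> X \<Longrightarrow> u * (y ^ l) ^ k \<in> words"
proof -
  assume u: "u \<in> X"
  have "(y ^ l) ^ k = (y ^ l) ^ (m * (k div m) + k mod m)" by simp
  also have "\<dots> = (y ^ l) ^ (k mod m)" by (simp only: power_add power_mult m(2) power_one mult_1)
  finally have "u * (y ^ l) ^ k = u * (y ^ l) ^ (k mod m)" by simp
  moreover have "k mod m < m" using m(1) by simp
  ultimately show ?thesis unfolding words_def using u by blast
qed

lemma K_word: "u \<in> X \<Longrightarrow> u * (y ^ l) ^ k \<in> K"
  unfolding K_def by (intro ospan_base F.R_1 word_in)

lemma finite_K: "finite K"
proof -
  have "words = (\<lambda>(u, k). u * (y ^ l) ^ k) ` (X \<times> {..<m})" unfolding words_def by auto
  then have "finite words" using finite_X by simp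
  moreover have "finite (range (of_nat :: nat \<Rightarrow> 'a))" by (simp add: range_of_nat_char [OF q_pos q(2)])
  ultimately show ?thesis unfolding K_def by (intro finite_ospan F.R_0 F.R_add)
qed

lemma yl_y: "commutes (y ^ l) y" by (simp add: commutes_def power_commutes)

lemma commutes_K:
  assumes "\<And>u. u \<in> X \<Longrightarrow> commutes h u" "commutes h (y ^ l)" "e \<in> K"
  shows "commutes h e"
  using assms(3) unfolding K_def
proof (rule F.ospan_commutes)
  show "commutes h c" if "c \<in> range of_nat" for c using that by auto
  show "commutes h e" if "e \<in> words" for e
    using that assms(1) commutes_power [OF assms(2)] by (auto simp: words_def intro: commutes_mult)
qed

lemma K_X: "u \<in> X \<Longrightarrow> e \<in> K \<Longrightarrow> commutes u e"
  by (rule commutes_K) (auto intro: X_commutes commutes_sym [OF X_commutes_pow])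

lemma K_yl: "e \<in> K \<Longrightarrow> commutes (y ^ l) e"
  by (rule commutes_K) (auto intro: X_commutes_pow)

lemma K_commutes: "d \<in> K \<Longrightarrow> e \<in> K \<Longrightarrow> commutes d e"
  by (rule commutes_K) (auto intro: commutes_sym [OF K_X] commutes_sym [OF K_yl])

lemma K_mult: "d \<in> K \<Longrightarrow> e \<in> K \<Longrightarrow> d * e \<in> K"
  unfolding K_def
proof (rule F.ospan_mult)
  show "commutes c e" if "c \<in> range of_nat" for c e :: 'a
    using that by (auto intro: commutes_sym [OF commutes_of_nat])
  show "e * g \<in> ospan (range of_nat) words" if eg: "e \<in> words" "g \<in> words" for e g
  proof -
    obtain u i v k where uv: "u \<in> X" "v \<in> X" "e = u * (y ^ l) ^ i" "g = v * (y ^ l) ^ k"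
      using eg by (auto simp: words_def)
    have "(y ^ l) ^ i * v = v * (y ^ l) ^ i"
      using commutes_power [OF commutes_sym [OF X_commutes_pow [OF uv(2)]], of i] by (simp add: commutes_def)
    then have "e * g = u * v * (y ^ l) ^ (i + k)"
      by (simp add: uv(3,4) power_add mult.assoc) (metis mult.assoc)
    then show ?thesis using K_word [OF X_mult [OF uv(1,2)]] by (simp add: K_def)
  qed
qed

lemma K_X_subset: "u \<in> X \<Longrightarrow> u \<in> K"
  using K_word [of u 0] by simp

lemma K_1: "1 \<in> K" by (rule K_X_subset) simp

lemma K_power: "e \<in> K \<Longrightarrow> e ^ k \<in> K"
  by (induction k) (auto intro: K_1 K_mult)

lemma K_yl_in: "y ^ l \<in> K"
  using K_word [OF one_X, of 1] by simp

lemma K_sum: "(\<And>i. i \<in> I \<Longrightarrow> f i \<in> K) \<Longrightarrow> sum f I \<in> K"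
  unfolding K_def by (rule ospan_sum)

lemma K_inverse: "e \<in> K \<Longrightarrow> inverse e \<in> K"
proof (cases "e = 0")
  case False
  assume e: "e \<in> K"
  obtain k where k: "k > 0" "e ^ k = 1"
    using finite_power_eq_1 [OF finite_K K_power [OF e] False] .
  then have "e * e ^ (k - 1) = 1" by (metis Suc_pred' power_Suc)
  then have "inverse e = e ^ (k - 1)" by (rule inverse_unique)
  then show ?thesis using K_power [OF e] by simp
qed simp

lemma K_conj: "e \<in> K \<Longrightarrow> y * e * inverse y \<in> K"
  unfolding K_def
proof (induction rule: ospan.induct)
  case zero
  show ?case by (simp add: ospan.zero)
next
  case (add c g v)
  obtain u k where g: "g = u * (y ^ l) ^ k" "u \<in> X" using add.hyps by (auto simp: words_def)
  have "y * g * inverse y = (y * u * inverse y) * (y * (y ^ l) ^ k * inverse y)"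
    unfolding g(1) by (rule conj_mult) simp
  also have "y * (y ^ l) ^ k * inverse y = (y ^ l) ^ k"
    using commutes_power [OF commutes_sym [OF yl_y], of k] by (simp add: commutes_conj)
  finally have "y * g * inverse y \<in> K" using K_word [OF X_conj [OF g(2)]] by simp
  moreover have "y * (c * g) * inverse y = c * (y * g * inverse y)"
    using add.hyps(1) by (auto simp: mult.assoc commutes_left_commute [OF commutes_of_nat])
  ultimately show ?case
    using add by (auto simp: distrib_left distrib_right K_def intro!: ospan_closed_add F.ospan_scale)
qed

text \<open>The product of the first \<open>r\<close> conjugates of \<open>e\<close> under \<open>y\<close>; for \<open>r = l\<close> it is a field norm.\<close>

definition cocycle :: "'a \<Rightarrow> nat \<Rightarrow> 'a" where "cocycle e r = (e * y) ^ r * inverse (y ^ r)"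

lemma cocycle_0 [simp]: "cocycle e 0 = 1"
  by (simp add: cocycle_def)

lemma cocycle_Suc: "cocycle e (Suc r) = e * (y * cocycle e r * inverse y)"
  by (simp add: cocycle_def nonzero_inverse_mult_distrib mult.assoc)

lemma cocycle_K: "e \<in> K \<Longrightarrow> cocycle e r \<in> K"
  by (induction r) (auto simp: cocycle_Suc intro: K_1 K_mult K_conj)

lemma cocycle_mult:
  assumes "d \<in> K" "e \<in> K"
  shows "cocycle (d * e) r = cocycle d r * cocycle e r"
proof (induction r)
  case (Suc r)
  let ?s = "\<lambda>v. y * v * inverse y"
  have "commutes e (?s (cocycle d r))"
    by (intro K_commutes assms K_conj cocycle_K)
  then have "e * (?s (cocycle d r) * z) = ?s (cocycle d r) * (e * z)" for z
    by (rule commutes_left_commute)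
  then show ?case
    unfolding cocycle_Suc Suc conj_mult [OF y_nz] by (simp add: mult.assoc)
qed simp

abbreviation nrm :: "'a \<Rightarrow> 'a" where "nrm e \<equiv> cocycle e l"

text \<open>\<open>(e * y) ^ l = nrm e * y ^ l\<close> commutes with \<open>e * y\<close> and with
  \<open>e\<close>, hence with \<open>y\<close>.\<close>

lemma nrm_fixed:
  assumes "e \<in> K" "e \<noteq> 0"
  shows "commutes y (nrm e)"
proof -
  have N: "(e * y) ^ l = nrm e * y ^ l" by (simp add: cocycle_def mult.assoc)
  have "commutes e (nrm e * y ^ l)"
    by (intro commutes_mult K_commutes assms cocycle_K commutes_sym [OF K_yl])
  moreover have "commutes (e * y) (nrm e * y ^ l)"
    unfolding N [symmetric] by (rule commutes_power) simp
  ultimately have "commutes (nrm e * y ^ l) (inverse e * (e * y))"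
    by (intro commutes_mult [OF commutes_inverse]) (rule commutes_sym, assumption)+
  then have "commutes y (nrm e * y ^ l)"
    using assms(2) commutes_sym by (simp add: mult.assoc [symmetric])
  then have "commutes y ((nrm e * y ^ l) * inverse (y ^ l))"
    by (rule commutes_mult [OF _ commutes_inverse [OF commutes_sym [OF yl_y]]])
  then show ?thesis by (simp add: mult.assoc)
qed

text \<open>The \<open>b i\<close> are Lagrange resolvents. Some \<open>b i\<close> is nonzero by
  independence of the conjugates of \<open>x\<close>, as the coefficient at \<open>r = 0\<close> is
  \<open>1\<close>.\<close>

lemma hilbert_90:
  assumes c: "c \<in> K" "nrm c = 1"
  obtains b where "b \<in> K" "b \<noteq> 0" "c = b * inverse (y * b * inverse y)"
proof -
  define t where "t r = y ^ r * x * inverse (y ^ r)" for r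
  define b where "b i = (\<Sum>r<l. cocycle c r * t r ^ i)" for i
  have tX: "t r \<in> X" for r unfolding t_def by (rule X_conj_power) simp
  have "inj_on t {..<l}"
    using conj_powers_inj [OF x_X not_commutes] by (simp add: t_def [abs_def])
  then have "\<exists>i. b i \<noteq> 0"
    using power_sums_eq_0_imp_coeffs_0 [of "{..<l}" t "cocycle c"] X_commutes tX l_pos
    unfolding b_def by (metis cocycle_0 finite_lessThan lessThan_iff zero_neq_one)
  then obtain i where i: "b i \<noteq> 0" by blast
  have bK: "b i \<in> K"
    unfolding b_def by (intro K_sum K_mult cocycle_K c K_power K_X_subset tX)
  \<comment> \<open>In this form, conjugation by \<open>y\<close> followed by left multiplication by
    \<open>c\<close> replaces \<open>r\<close> by \<open>Suc r\<close>; the norm condition closes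
    the cycle.\<close>
  let ?z = "\<lambda>r. (c * y) ^ r * x ^ i * inverse (y ^ r)"
  have z: "cocycle c r * t r ^ i = ?z r" for r
    unfolding cocycle_def t_def conj_power [OF power_not_zero [OF y_nz], symmetric]
    by (simp add: mult.assoc) (simp add: mult.assoc [symmetric])
  have "c * (y * b i * inverse y) = (\<Sum>r<l. c * (y * ?z r * inverse y))"
    by (simp add: b_def z sum_distrib_left sum_distrib_right)
  also have "\<dots> = (\<Sum>r<l. ?z (Suc r))"
    by (rule sum.cong) (simp_all add: nonzero_inverse_mult_distrib mult.assoc)
  also have "\<dots> = (\<Sum>r<Suc l. ?z r) - ?z 0"
    by (subst sum.lessThan_Suc_shift) simp
  also have "\<dots> = b i + ?z l - ?z 0" by (simp add: b_def z)
  also have "?z l = ?z 0"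
  proof -
    have "(c * y) ^ l = nrm c * y ^ l" by (simp add: cocycle_def mult.assoc)
    then have "?z l = y ^ l * x ^ i * inverse (y ^ l)" using c(2) by simp
    also have "\<dots> = x ^ i"
      using commutes_power [OF pow_commutes, of i] by (subst commutes_conj) auto
    finally show ?thesis by simp
  qed
  finally have cb: "c * (y * b i * inverse y) = b i" by simp
  have "c = v * inverse w" if "c * w = v" "w \<noteq> 0" for v w
    using that by (metis mult.assoc mult_1_right right_inverse)
  from this [OF cb] have "c = b i * inverse (y * b i * inverse y)" using i by simp
  with bK i that show ?thesis by blast
qed

text \<open>Counting: Hilbert 90 bounds the kernel of the norm by the size of the image of
  \<open>\<phi>\<close>, and the fibres of \<open>\<phi>\<close> are at least as large as
  \<open>Fix\<close>. Hence there are at least as many norms as elements of \<open>Fix\<close>,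
  which contains all norms.\<close>

lemma nrm_surj:
  assumes "v \<in> K" "v \<noteq> 0" "commutes y v"
  obtains e where "e \<in> K" "e \<noteq> 0" "nrm e = v"
proof -
  define K0 where "K0 = K - {0}"
  define Fix where "Fix = {e \<in> K0. commutes y e}"
  define ker where "ker = {e \<in> K0. nrm e = 1}"
  define \<phi> where "\<phi> e = e * inverse (y * e * inverse y)" for e
  have fin: "finite K0" "finite Fix" "finite ker" using finite_K by (auto simp: K0_def Fix_def ker_def)
  have K0: "d * e \<in> K0" "inverse e \<in> K0" if "d \<in> K0" "e \<in> K0" for d e
    using that K_mult K_inverse by (auto simp: K0_def)
  have nz: "cocycle e r \<noteq> 0" if "e \<noteq> 0" for e r using that by (simp add: cocycle_def)
  have "ker \<subseteq> \<phi> ` K0"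
  proof
    fix c assume "c \<in> ker"
    then have "c \<in> K" "nrm c = 1" by (auto simp: ker_def K0_def)
    then obtain b where "b \<in> K" "b \<noteq> 0" "c = b * inverse (y * b * inverse y)"
      using hilbert_90 by blast
    then show "c \<in> \<phi> ` K0" by (auto simp: \<phi>_def K0_def)
  qed
  then have ker_le: "card ker \<le> card (\<phi> ` K0)" using fin by (intro card_mono) auto
  have "card K0 \<le> card (nrm ` K0) * card ker"
  proof (rule card_le_card_image_times [OF fin(1)])
    fix e assume e: "e \<in> K0"
    have "(\<lambda>d. d * inverse e) ` {d \<in> K0. nrm d = nrm e} \<subseteq> ker"
    proof safe
      fix d assume d: "d \<in> K0" "nrm d = nrm e"
      have "nrm (d * inverse e) = nrm (e * inverse e)"
        using d e cocycle_mult [of d "inverse e" l] cocycle_mult [of e "inverse e" l]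
        by (simp add: K0_def K_inverse)
      also have "\<dots> = 1"
        using e by (simp add: K0_def cocycle_def)
      finally show "d * inverse e \<in> ker" using d e K0 by (simp add: ker_def)
    qed
    moreover have "inj_on (\<lambda>d. d * inverse e) {d \<in> K0. nrm d = nrm e}"
      using e by (auto simp: inj_on_def K0_def)
    ultimately show "card {d \<in> K0. nrm d = nrm e} \<le> card ker"
      using fin(3) card_mono [of ker "(\<lambda>d. d * inverse e) ` {d \<in> K0. nrm d = nrm e}"]
        card_image [of "\<lambda>d. d * inverse e" "{d \<in> K0. nrm d = nrm e}"] by simp
  qed
  moreover have "card (\<phi> ` K0) * card Fix \<le> card K0"
  proof (rule card_image_times_le_card [OF fin(1)])
    fix e assume e: "e \<in> K0"
    have "(\<lambda>d. e * d) ` Fix \<subseteq> {d \<in> K0. \<phi> d = \<phi> e}"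
    proof safe
      fix d assume d: "d \<in> Fix"
      then have d': "d \<in> K0" "y * d * inverse y = d" by (auto simp: Fix_def commutes_conj)
      show "e * d \<in> K0" using d' e K0 by simp
      have "\<phi> (e * d) = e * d * inverse ((y * e * inverse y) * d)"
        unfolding \<phi>_def conj_mult [OF y_nz] d'(2) ..
      also have "\<dots> = \<phi> e"
        using d' e by (simp add: \<phi>_def K0_def nonzero_inverse_mult_distrib mult.assoc)
          (simp add: mult.assoc [symmetric])
      finally show "\<phi> (e * d) = \<phi> e" .
    qed
    moreover have "inj_on (\<lambda>d. e * d) Fix"
      using e by (auto simp: inj_on_def K0_def)
    ultimately show "card Fix \<le> card {d \<in> K0. \<phi> d = \<phi> e}"
      using fin(1) card_mono [of "{d \<in> K0. \<phi> d = \<phi> e}" "(\<lambda>d. e * d) ` Fix"]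
        card_image [of "\<lambda>d. e * d" Fix] by simp
  qed
  ultimately have "card (\<phi> ` K0) * card Fix \<le> card (nrm ` K0) * card (\<phi> ` K0)"
    using ker_le by (meson le_trans mult_le_mono2)
  moreover have "card (\<phi> ` K0) > 0"
  proof -
    have "1 \<in> K0" using K_1 by (simp add: K0_def)
    then show ?thesis using fin by (metis card_gt_0_iff empty_iff finite_imageI image_is_empty)
  qed
  ultimately have "card Fix \<le> card (nrm ` K0)" by (simp add: mult.commute)
  moreover have "nrm ` K0 \<subseteq> Fix"
    using cocycle_K nrm_fixed nz by (auto simp: K0_def Fix_def)
  ultimately have "nrm ` K0 = Fix" using fin(2) by (metis card_seteq)
  moreover have "v \<in> Fix" using assms by (simp add: Fix_def K0_def)
  ultimately have "v \<in> nrm ` K0" by simp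
  then show ?thesis using that by (auto simp: K0_def)
qed

lemma contradiction: False
proof -
  have "commutes y (inverse (y ^ l))"
    by (rule commutes_inverse [OF commutes_sym [OF yl_y]])
  \<comment> \<open>This norm is chosen to make \<open>(e * y) ^ l = 1\<close>.\<close>
  then obtain e where e: "e \<in> K" "e \<noteq> 0" "nrm e = inverse (y ^ l)"
    using nrm_surj [OF K_inverse [OF K_yl_in]] by auto
  define z where "z = e * y"
  have z: "z ^ r = cocycle e r * y ^ r" for r
    by (simp add: z_def cocycle_def mult.assoc)
  have "z \<noteq> 1"
  proof
    assume "z = 1"
    then have "y = inverse e" by (simp add: z_def inverse_unique)
    then have "commutes y x" using K_X [OF x_X K_inverse [OF e(1)]] commutes_sym by simp
    then show False using not_commutes by blast
  qed
  moreover have "z ^ l = 1" by (simp add: z e(3))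
  then have "(1 - z) * (\<Sum>r<l. z ^ r) = 0" by (simp only: geometric_sum diff_self)
  ultimately have sum0: "(\<Sum>r<l. z ^ r) = 0" by simp
  \<comment> \<open>Averaging over \<open>X\<close> annihilates \<open>z ^ r\<close> for
    \<open>0 < r < l\<close> and turns the remaining term \<open>1\<close> into
    \<open>n\<close>.\<close>
  have "0 = conj_sum (\<Sum>r<l. z ^ r)" by (simp add: sum0 conj_sum_def)
  also have "\<dots> = (\<Sum>r<l. conj_sum (z ^ r))"
    by (rule additive_sum [where L = conj_sum, OF conj_sum_add])
  also have "\<dots> = (\<Sum>r\<in>{0}. conj_sum (z ^ r))"
  proof (rule sum.mono_neutral_right)
    show "\<forall>r\<in>{..<l} - {0}. conj_sum (z ^ r) = 0"
    proof
      fix r assume "r \<in> {..<l} - {0}"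
      then have "\<not> l dvd r" by (auto dest: dvd_imp_le)
      then show "conj_sum (z ^ r) = 0"
        unfolding z by (intro conj_sum_word K_X cocycle_K e)
    qed
  qed (use l_pos in auto)
  also have "\<dots> = of_nat n" using conj_sum_central [of 1] by simp
  finally show False using n_nz by simp
qed

end

section \<open>Noncentral roots of unity\<close>

text \<open>Characteristic \<open>0\<close> splits by whether \<open>y ^ l\<close> is algebraic. In
  characteristic \<open>q\<close> the algebraic case is the finite one, and the transcendental case
  splits by whether \<open>q = l\<close>.\<close>

lemma (in twisted_pair) pair_contradiction:
  assumes G_1: "1 \<in> G" and G_mult: "\<And>g h. g \<in> G \<Longrightarrow> h \<in> G \<Longrightarrow> g * h \<in> G"
    and G_conj: "\<And>g. g \<in> G \<Longrightarrow> x * g * inverse x \<in> G"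
    and rad: "\<And>g. g \<in> G \<Longrightarrow> \<exists>M>0. commutes (g ^ M) x \<and> commutes (g ^ M) y"
    and descent: "\<And>u. u \<noteq> 0 \<Longrightarrow> \<exists>k. (commutator_step x ^^ k) u \<in> G"
  shows False
proof -
  \<comment> \<open>Common ending of the cases that use an order: some iterate of
    \<open>1 + \<pi> * y\<close> lies in \<open>G\<close> and so has a power commuting with
    \<open>x\<close>.\<close>
  have principal: False
    if ord: "twisted_order x y n l R \<pi> L"
      and bad: "\<And>k M. M > 0 \<Longrightarrow> (commutator_step x ^^ k) (1 + \<pi> * y) \<in> G \<Longrightarrow>
        \<not> commutes x ((commutator_step x ^^ k) (1 + \<pi> * y) ^ M)" for R \<pi> L
  proof -
    interpret T: twisted_order x y n l R \<pi> L by (rule ord)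
    obtain k where k: "(commutator_step x ^^ k) (1 + \<pi> * y) \<in> G"
      using descent T.A_unit(1) [OF T.A_y(1)] by blast
    then show False using rad [OF k] bad commutes_sym by blast
  qed
  show False
  proof (cases "\<exists>m>0. of_nat m = (0::'a)")
    case False
    then have char_0: "of_nat m \<noteq> (0::'a)" if "m > 0" for m using that by blast
    show False
    proof (cases "\<exists>f. f \<noteq> 0 \<and> ev (y ^ l) f = 0")
      case True
      then obtain f where f: "ev (y ^ l) f = 0" "f \<noteq> 0" by blast
      obtain R P L where R: "twisted_order x y n l R (of_nat P) L" "prime P" "odd P"
        "\<And>m. \<not> P dvd m \<Longrightarrow> of_nat m \<noteq> (0::'a) \<and> inverse (of_nat m) \<in> R"
        using algebraic_order [OF char_0 f] by blast
      interpret T: twisted_order x y n l R "of_nat P" L by (rule R(1))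
      show False
        by (rule principal [OF R(1)]) (rule T.no_central_power_residue_char [OF R(2,3) refl _ R(4)])
    next
      case False
      then have "of_int (coeff f i) = (0::'a)" if "ev (y ^ l) f = 0" for f i
        using that by (metis coeff_0 of_int_0)
      then obtain R where R: "twisted_order x y n l R (y ^ l - 1) l"
        "\<And>m. of_nat m \<noteq> (0::'a) \<Longrightarrow> inverse (of_nat m) \<in> R"
        using transcendental_order by blast
      interpret T: twisted_order x y n l R "y ^ l - 1" l by (rule R(1))
      show False
        by (rule principal [OF R(1)]) (rule T.no_central_power_of_units, auto simp: char_0 R(2))
    qed
  next
    case True
    then obtain q where q: "prime q" "of_nat q = (0::'a)"
      using of_nat_eq_0_prime_factor by blast
    show False
    proof (cases "\<exists>f i. ev (y ^ l) f = 0 \<and> of_int (coeff f i) \<noteq> (0::'a)")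
      case True
      then obtain m where "m > 0" "(y ^ l) ^ m = 1"
        using algebraic_imp_torsion [OF q, of "y ^ l"] by (metis power_not_zero y_nz)
      then interpret F: finite_twisted_pair x y n l q m
        by unfold_locales (use q in auto)
      show False by (rule F.contradiction)
    next
      case False
      then obtain R where R: "twisted_order x y n l R (y ^ l - 1) l"
        "\<And>m. of_nat m \<noteq> (0::'a) \<Longrightarrow> inverse (of_nat m) \<in> R"
        using transcendental_order by blast
      interpret T: twisted_order x y n l R "y ^ l - 1" l by (rule R(1))
      show False
      proof (cases "q = l")
        case True
        then have l0: "of_nat l = (0::'a)" using q by simp
        show False
          by (rule principal [OF R(1)])
            (use T.wild_contradiction [OF l0 G_mult G_conj G_1 rad] in blast)
      next
        case False
        show False
          by (rule principal [OF R(1)]) (rule T.no_central_power_char [OF q False _ R(2)])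
      qed
    qed
  qed
qed

text \<open>Finite Fourier analysis of conjugation by \<open>x\<close>: the components
  \<open>v i\<close> sum to \<open>n * z\<close>, and \<open>v 0\<close> commutes with
  \<open>x\<close>, so another component is nonzero.\<close>

lemma exists_eigenvector:
  fixes x z :: "'a::division_ring"
  assumes n: "n > 0" "x ^ n = 1" "\<And>k. 0 < k \<Longrightarrow> k < n \<Longrightarrow> x ^ k \<noteq> 1" "of_nat n \<noteq> (0::'a)"
    and z: "\<not> commutes x z"
  obtains i y where "0 < i" "i < n" "y \<noteq> 0" "y * x = x ^ Suc i * y"
proof -
  have x: "x \<noteq> 0" using n(1,2) by (auto simp: power_0_left)
  define c where "c k = x ^ k * z * inverse (x ^ k)" for k
  define v where "v i = (\<Sum>k<n. (x ^ i) ^ k * c k)" for i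
  have eigen: "x ^ i * (x * v i * inverse x) = v i" for i
  proof -
    have "x ^ i * (x * ((x ^ i) ^ k * c k) * inverse x) = (x ^ i) ^ Suc k * c (Suc k)" for k
    proof -
      have "commutes x ((x ^ i) ^ k)" by (intro commutes_power) simp
      then have "x * ((x ^ i) ^ k * c k) = (x ^ i) ^ k * (x * c k)" by (rule commutes_left_commute)
      then show ?thesis
        using x by (simp add: c_def nonzero_inverse_mult_distrib mult.assoc)
    qed
    then have "x ^ i * (x * v i * inverse x) = (\<Sum>k<n. (x ^ i) ^ Suc k * c (Suc k))"
      by (simp only: v_def sum_distrib_left sum_distrib_right)
    also have "\<dots> = (\<Sum>k<Suc n. (x ^ i) ^ k * c k) - c 0"
      by (subst sum.lessThan_Suc_shift) simp
    also have "\<dots> = v i + (x ^ i) ^ n * c n - c 0" by (simp add: v_def)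
    also have "(x ^ i) ^ n = 1" by (metis mult.commute n(2) power_mult power_one)
    finally show ?thesis by (simp add: c_def n(2))
  qed
  have "\<exists>i. 0 < i \<and> i < n \<and> v i \<noteq> 0"
  proof (rule ccontr)
    assume none: "\<not> (\<exists>i. 0 < i \<and> i < n \<and> v i \<noteq> 0)"
    \<comment> \<open>Interchanging the sums leaves geometric sums in \<open>x ^ k\<close>, which
      vanish unless \<open>k = 0\<close>.\<close>
    have "(\<Sum>i<n. v i) = (\<Sum>k<n. (\<Sum>i<n. (x ^ k) ^ i) * c k)"
      unfolding v_def sum_distrib_right
      by (subst sum.swap) (simp only: mult.commute flip: power_mult)
    also have "\<dots> = (\<Sum>k\<in>{0}. (\<Sum>i<n. (x ^ k) ^ i) * c k)"
    proof (rule sum.mono_neutral_right)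
      show "\<forall>k\<in>{..<n} - {0}. (\<Sum>i<n. (x ^ k) ^ i) * c k = 0"
      proof
        fix k assume "k \<in> {..<n} - {0}"
        then have "x ^ k \<noteq> 1" using n(3) by auto
        moreover have "(x ^ k) ^ n = 1" by (metis mult.commute n(2) power_mult power_one)
        then have "(1 - x ^ k) * (\<Sum>i<n. (x ^ k) ^ i) = 0" by (simp only: geometric_sum diff_self)
        ultimately show "(\<Sum>i<n. (x ^ k) ^ i) * c k = 0" by simp
      qed
    qed (use n(1) in auto)
    also have "\<dots> = of_nat n * z" by (simp add: c_def)
    finally have 1: "(\<Sum>i<n. v i) = of_nat n * z" .
    have "(\<Sum>i<n. v i) = (\<Sum>i\<in>{0}. v i)"
      by (rule sum.mono_neutral_right) (use none n(1) in auto)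
    then have "v 0 = of_nat n * z" using 1 by simp
    moreover have "commutes x (v 0)" using eigen [of 0] x by (simp add: commutes_conj)
    ultimately have "commutes x (inverse (of_nat n) * (of_nat n * z))"
      using commutes_mult [OF commutes_inverse [OF commutes_of_nat]] by metis
    then show False using z n(4) by (simp flip: mult.assoc)
  qed
  then obtain i where i: "0 < i" "i < n" "v i \<noteq> 0" by blast
  have "v i * x = x ^ i * (x * v i * inverse x) * x" by (simp only: eigen)
  also have "\<dots> = x ^ Suc i * v i" using x by (simp add: mult.assoc power_Suc2 del: power_Suc)
  finally show ?thesis using that i by blast
qed

lemma conj_power_range:
  fixes x y :: "'a::division_ring"
  assumes "y \<noteq> 0" "y * x * inverse y \<in> range ((^) x)"
  shows "y ^ r * x * inverse (y ^ r) \<in> range ((^) x)"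
proof (induction r)
  case 0
  show ?case by (metis inverse_1 mult_1 mult_1_right power_0 power_one_right rangeI)
next
  case (Suc r)
  then obtain i where i: "y ^ r * x * inverse (y ^ r) = x ^ i" by blast
  obtain j where j: "y * x * inverse y = x ^ j" using assms(2) by blast
  have "y ^ Suc r * x * inverse (y ^ Suc r) = y * (y ^ r * x * inverse (y ^ r)) * inverse y"
    using assms(1) by (simp add: nonzero_inverse_mult_distrib mult.assoc)
  also have "\<dots> = x ^ (j * i)"
    unfolding i conj_power [OF assms(1)] j by (simp add: power_mult)
  finally show ?case by simp
qed

text \<open>An eigenvector \<open>y\<^sub>0\<close> normalises the finite group of powers of
  \<open>x\<close>, so a power of it centralises \<open>x\<close>. For the least such exponent
  \<open>m\<close> and a prime \<open>l\<close> with \<open>m = k * l\<close>, the element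
  \<open>y\<^sub>0 ^ k\<close> works.\<close>

lemma exists_twisted_pair:
  fixes x z :: "'a::division_ring"
  assumes n: "n > 0" "x ^ n = 1" "\<And>k. 0 < k \<Longrightarrow> k < n \<Longrightarrow> x ^ k \<noteq> 1"
    and z: "\<not> commutes x z"
  obtains y l where "twisted_pair x y n l"
proof -
  have x: "x \<noteq> 0" using n(1,2) by (auto simp: power_0_left)
  \<comment> \<open>If the characteristic divided \<open>n\<close>, a smaller power of
    \<open>x\<close> would already be \<open>1\<close>.\<close>
  have n0: "of_nat n \<noteq> (0::'a)"
  proof
    assume "of_nat n = (0::'a)"
    then obtain q where q: "prime q" "of_nat q = (0::'a)" "q dvd n"
      using of_nat_eq_0_prime_factor n(1) by blast
    then obtain m where m: "n = m * q ^ 1" by (auto simp: dvd_def mult.commute)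
    have "(x ^ m) ^ (q ^ 1) = 1" using n(2) unfolding m by (simp only: power_mult)
    then have "x ^ m = 1" by (rule power_char_eq_1 [OF q(1,2)])
    moreover have "m > 0" "m < n" using m n(1) prime_gt_1_nat [OF q(1)] by auto
    ultimately show False using n(3) by blast
  qed
  obtain i y\<^sub>0 where i: "0 < i" "i < n" and y0: "y\<^sub>0 \<noteq> 0" "y\<^sub>0 * x = x ^ Suc i * y\<^sub>0"
    using exists_eigenvector [OF n n0 z] by blast
  have conj0: "y\<^sub>0 * x * inverse y\<^sub>0 = x ^ Suc i"
    using y0 by (simp add: mult.assoc)
  have nc: "\<not> commutes y\<^sub>0 x"
  proof
    assume "commutes y\<^sub>0 x"
    then have "x ^ Suc i = x" using conj0 y0(1) by (metis commutes_conj)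
    then have "x ^ i = 1" using x by (metis mult_cancel_left mult_1_right power_Suc)
    then show False using n(3) i by blast
  qed
  have rng: "y\<^sub>0 ^ r * x * inverse (y\<^sub>0 ^ r) \<in> range ((^) x)" for r
    by (rule conj_power_range [OF y0(1)]) (unfold conj0, rule rangeI)
  have "finite (range ((^) x))"
  proof -
    have "x ^ k = x ^ (k mod n)" for k
    proof -
      have "x ^ k = x ^ (n * (k div n) + k mod n)" by simp
      also have "\<dots> = x ^ (k mod n)" by (simp only: power_add power_mult n(2) power_one mult_1)
      finally show ?thesis .
    qed
    moreover have "k mod n < n" for k using n(1) by simp
    ultimately have "range ((^) x) \<subseteq> (^) x ` {..<n}" by blast
    then show ?thesis by (rule finite_subset) simp
  qed
  moreover have "range (\<lambda>r. y\<^sub>0 ^ r * x * inverse (y\<^sub>0 ^ r)) \<subseteq> range ((^) x)"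
    using rng by blast
  ultimately have "finite (range (\<lambda>r. y\<^sub>0 ^ r * x * inverse (y\<^sub>0 ^ r)))"
    by (metis finite_subset)
  then have "\<not> inj (\<lambda>r. y\<^sub>0 ^ r * x * inverse (y\<^sub>0 ^ r))"
    using finite_imageD infinite_UNIV_nat by blast
  then obtain a b where "a \<noteq> b"
    "y\<^sub>0 ^ a * x * inverse (y\<^sub>0 ^ a) = y\<^sub>0 ^ b * x * inverse (y\<^sub>0 ^ b)"
    by (auto simp: inj_on_def)
  then obtain a b where ab: "a < b"
    "y\<^sub>0 ^ a * x * inverse (y\<^sub>0 ^ a) = y\<^sub>0 ^ b * x * inverse (y\<^sub>0 ^ b)"
    by (cases a b rule: linorder_cases) auto
  have "y\<^sub>0 ^ b = y\<^sub>0 ^ a * y\<^sub>0 ^ (b - a)" using ab(1) by (simp flip: power_add)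
  then have "y\<^sub>0 ^ a * x * inverse (y\<^sub>0 ^ a) =
      y\<^sub>0 ^ a * (y\<^sub>0 ^ (b - a) * x * inverse (y\<^sub>0 ^ (b - a))) * inverse (y\<^sub>0 ^ a)"
    using ab(2) y0(1) by (simp add: nonzero_inverse_mult_distrib mult.assoc)
  then have "y\<^sub>0 ^ (b - a) * x * inverse (y\<^sub>0 ^ (b - a)) = x" using y0(1) by simp
  then have "commutes (y\<^sub>0 ^ (b - a)) x" using y0(1) by (simp add: commutes_conj)
  then have ex: "\<exists>m. m > 0 \<and> commutes (y\<^sub>0 ^ m) x" using ab(1) by (intro exI [of _ "b - a"]) auto
  define m where "m = (LEAST m. m > 0 \<and> commutes (y\<^sub>0 ^ m) x)"
  have m: "m > 0" "commutes (y\<^sub>0 ^ m) x" using LeastI_ex [OF ex] by (auto simp: m_def)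
  have min: "\<not> commutes (y\<^sub>0 ^ k) x" if "0 < k" "k < m" for k
    using not_less_Least [of k "\<lambda>m. m > 0 \<and> commutes (y\<^sub>0 ^ m) x"] that by (auto simp: m_def)
  have "m \<noteq> 1" using m nc by auto
  then obtain l where l: "prime l" "l dvd m" using prime_factor_nat by blast
  then obtain k where k: "m = k * l" by (auto simp: dvd_def mult.commute)
  have "k > 0" "k < m" using k m(1) prime_gt_1_nat [OF l(1)] by auto
  have "twisted_pair x (y\<^sub>0 ^ k) n l"
  proof
    show "y\<^sub>0 ^ k * x * inverse (y\<^sub>0 ^ k) \<in> range ((^) x)" by (rule rng)
    show "\<not> commutes (y\<^sub>0 ^ k) x" by (rule min) fact+
    show "commutes ((y\<^sub>0 ^ k) ^ l) x" using m(2) k by (simp add: power_mult)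
  qed (use n n0 y0 l in auto)
  then show ?thesis by (rule that)
qed

section \<open>Descent along an ascending series\<close>

lemma inv_mult_group: "u \<noteq> 0 \<Longrightarrow> inv\<^bsub>mult_group\<^esub> u = inverse (u :: 'a::division_ring)"
  by (rule group.inv_equality [OF group_mult_group]) (auto simp: mult_group_def)

text \<open>An element that is neither first nor a limit has some \<open>a\<close> below it with
  nothing in between; by totality \<open>a\<close> is its predecessor.\<close>

lemma well_order_cases:
  assumes r: "Well_order r" and b: "b \<in> Field r"
  obtains (zero) "underS r b = {}" | (limit) "limit_elem r b"
    | (succ) a where "a \<in> underS r b" "underS r b = under r a"
proof -
  have lin: "Refl r" "trans r" "antisym r" "Total r"
    using r by (auto simp: order_on_defs well_order_on_def)
  have "\<exists>a\<in>underS r b. underS r b = under r a" if b: "underS r b \<noteq> {}" "\<not> limit_elem r b"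
  proof -
    obtain a where a: "a \<in> underS r b" "\<And>c. c \<in> underS r b \<Longrightarrow> a \<notin> underS r c"
      using b unfolding limit_elem_def by blast
    have "underS r b = under r a"
    proof
      show "underS r b \<subseteq> under r a"
      proof
        fix c assume c: "c \<in> underS r b"
        have "c \<in> Field r" "a \<in> Field r" using c a(1) by (auto simp: underS_def Field_def)
        then have "(c, a) \<in> r \<or> (a, c) \<in> r"
          using lin(1,4) by (metis refl_onD total_on_def)
        then show "c \<in> under r a" using a(2) [OF c] c \<open>c \<in> Field r\<close> lin(1)
          by (auto simp: underS_def under_def refl_on_def)
      qed
      show "under r a \<subseteq> underS r b"
        using a(1) lin(2,3) by (auto simp: underS_def under_def trans_def antisym_def)
    qed
    then show ?thesis using a by blast
  qed
  then show ?thesis using that by blast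
qed

text \<open>Well-founded induction along the series: at a successor, normality moves the commutator
  into the previous member; at a limit, the element already lies in an earlier one.\<close>

lemma ascendant_descent:
  fixes G :: "'a::division_ring set"
  assumes asc: "ascendant TYPE('i) G (mult_group :: 'a monoid)" and x: "x \<in> G" and u: "u \<noteq> 0"
  shows "\<exists>k. (commutator_step x ^^ k) u \<in> G"
proof -
  obtain r :: "'i rel" and \<gamma> H where S: "ascending_series (mult_group :: 'a monoid) G r \<gamma> H"
    using asc unfolding ascendant_def by blast
  have wo: "Well_order r" and \<gamma>: "\<gamma> \<in> Field r" "H \<gamma> = carrier mult_group"
    and sub: "\<And>b. b \<in> under r \<gamma> \<Longrightarrow> subgroup (H b) (mult_group :: 'a monoid)"
    and zero: "\<And>b. b \<in> under r \<gamma> \<Longrightarrow> underS r b = {} \<Longrightarrow> H b = G"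
    and succ: "\<And>a b. a \<in> underS r \<gamma> \<Longrightarrow> b \<in> under r \<gamma> \<Longrightarrow> underS r b = under r a \<Longrightarrow>
      H a \<lhd> mult_group\<lparr>carrier := H b\<rparr>"
    and lim: "\<And>b. b \<in> under r \<gamma> \<Longrightarrow> limit_elem r b \<Longrightarrow> H b = (\<Union>a\<in>underS r b. H a)"
    using S unfolding ascending_series_def by blast+
  have lin: "Refl r" "trans r" "antisym r" and wf: "wf (r - Id)"
    using wo by (auto simp: order_on_defs well_order_on_def)
  have below: "a \<in> under r \<gamma>" "a \<in> underS r \<gamma>" "(a, b) \<in> r - Id"
    if "a \<in> underS r b" "b \<in> under r \<gamma>" for a b
    using that lin by (auto simp: underS_def under_def trans_def antisym_def)
  have Fld: "b \<in> Field r" if "b \<in> under r \<gamma>" for b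
    using that by (auto simp: under_def Field_def)
  \<comment> \<open>Needed to place \<open>x\<close> in the smaller member at each successor
    step.\<close>
  have G_sub: "b \<in> under r \<gamma> \<longrightarrow> G \<subseteq> H b" for b
  proof (induction b rule: wf_induct_rule [OF wf])
    case (1 b)
    show ?case
    proof
      assume b: "b \<in> under r \<gamma>"
      show "G \<subseteq> H b"
      proof (cases rule: well_order_cases [OF wo Fld [OF b]])
        case 1
        then show ?thesis using zero [OF b] by simp
      next
        case 2
        then obtain a where "a \<in> underS r b" unfolding limit_elem_def by blast
        then show ?thesis using "1.IH" [of a] below [OF _ b] lim [OF b 2] by blast
      next
        case (3 a)
        have "H a \<lhd> mult_group\<lparr>carrier := H b\<rparr>" by (rule succ [OF below(2) [OF 3(1) b] b 3(2)])
        then have "H a \<subseteq> H b" using subgroup.subset [OF normal_imp_subgroup] by fastforce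
        then show ?thesis using "1.IH" [of a] below [OF 3(1) b] by blast
      qed
    qed
  qed
  have "b \<in> under r \<gamma> \<longrightarrow> (\<forall>v\<in>H b. \<exists>k. (commutator_step x ^^ k) v \<in> G)" for b
  proof (induction b rule: wf_induct_rule [OF wf])
    case (1 b)
    show ?case
    proof (intro impI ballI)
      fix v assume b: "b \<in> under r \<gamma>" and v: "v \<in> H b"
      show "\<exists>k. (commutator_step x ^^ k) v \<in> G"
      proof (cases rule: well_order_cases [OF wo Fld [OF b]])
        case 1
        then show ?thesis using zero [OF b] v by (intro exI [of _ 0]) auto
      next
        case 2
        then obtain a where "a \<in> underS r b" "v \<in> H a" using lim [OF b 2] v by blast
        then show ?thesis using "1.IH" [of a] below [OF _ b] by blast
      next
        case (3 a)
        let ?B = "mult_group\<lparr>carrier := H b\<rparr> :: 'a monoid"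
        have norm: "H a \<lhd> ?B" by (rule succ [OF below(2) [OF 3(1) b] b 3(2)])
        interpret Ha: subgroup "H a" "mult_group :: 'a monoid"
          by (rule sub [OF below(1) [OF 3(1) b]])
        have xa: "x \<in> H a" using x G_sub [of a] below [OF 3(1) b] by blast
        have nz: "v \<noteq> 0" "x \<noteq> 0"
          using v xa subgroup.subset [OF sub [OF b]] Ha.subset by (auto simp: mult_group_def)
        have "inv\<^bsub>?B\<^esub> v = inverse v"
          using group.m_inv_consistent [OF group_mult_group sub [OF b] v] inv_mult_group [OF nz(1)]
          by simp
        then have "inverse v * x * v \<in> H a"
          using normal.inv_op_closed1 [OF norm, of v x] v xa by (simp add: mult_group_def)
        moreover have "inverse x \<in> H a"
          using Ha.m_inv_closed [OF xa] inv_mult_group [OF nz(2)] by simp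
        ultimately have "commutator_step x v \<in> H a"
          using Ha.m_closed [of "inverse v * x * v" "inverse x"]
          by (simp add: commutator_step_def mult_group_def)
        then obtain k where "(commutator_step x ^^ k) (commutator_step x v) \<in> G"
          using "1.IH" [of a] below [OF 3(1) b] by blast
        then show ?thesis by (metis comp_apply funpow_Suc_right)
      qed
    qed
  qed
  moreover have "\<gamma> \<in> under r \<gamma>" using lin(1) \<gamma>(1) by (auto simp: under_def refl_on_def)
  moreover have "u \<in> H \<gamma>" using u \<gamma>(2) by (simp add: mult_group_def)
  ultimately show ?thesis by blast
qed

lemma periodic_central:
  fixes G :: "'a::division_ring set"
  assumes asc: "ascendant TYPE('i) G (mult_group :: 'a monoid)" and rad: "radical_over G center"
    and x: "x \<in> G" and n: "n > 0" "x ^ n = 1"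
  shows "x \<in> center"
proof (rule ccontr)
  assume "x \<notin> center"
  then obtain z where z: "\<not> commutes x z" by (auto simp: center_def commutes_def)
  define m where "m = (LEAST m. m > 0 \<and> x ^ m = 1)"
  have ex: "\<exists>m. m > 0 \<and> x ^ m = 1" using n by blast
  have m: "m > 0" "x ^ m = 1" using LeastI_ex [OF ex] by (auto simp: m_def)
  have min: "x ^ k \<noteq> 1" if "0 < k" "k < m" for k
    using not_less_Least [of k "\<lambda>m. m > 0 \<and> x ^ m = 1"] that by (auto simp: m_def)
  obtain y l where pair: "twisted_pair x y m l"
    using exists_twisted_pair [OF m min z] by blast
  interpret twisted_pair x y m l by (rule pair)
  interpret G: subgroup G "mult_group :: 'a monoid" using asc by (simp add: ascendant_def)
  have G_mult: "g * h \<in> G" if "g \<in> G" "h \<in> G" for g h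
    using G.m_closed [OF that] by (simp add: mult_group_def)
  have "inverse x \<in> G"
    using G.m_inv_closed [OF x] inv_mult_group [OF x_nz] by simp
  show False
  proof (rule pair_contradiction [of G])
    show "1 \<in> G" using G.one_closed by (simp add: mult_group_def)
    show "\<exists>M>0. commutes (g ^ M) x \<and> commutes (g ^ M) y" if g: "g \<in> G" for g
    proof -
      obtain M where "M > 0" "g ^ M \<in> center" using rad g by (auto simp: radical_over_def)
      then show ?thesis by (auto simp: center_def commutes_def)
    qed
    show "x * g * inverse x \<in> G" if "g \<in> G" for g
      using G_mult x that \<open>inverse x \<in> G\<close> by blast
    show "\<exists>k. (commutator_step x ^^ k) u \<in> G" if "u \<noteq> 0" for u
      by (rule ascendant_descent [OF asc x that])
  qed (fact G_mult)
qed

section \<open>The periodic radical and its quotient\<close>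

lemma (in group) pow_mod_out:
  assumes N: "N \<lhd> G" and g: "g \<in> carrier G" and n: "(N #> g) [^]\<^bsub>G Mod N\<^esub> (n::nat) = \<one>\<^bsub>G Mod N\<^esub>"
  shows "g [^] n \<in> N"
proof -
  interpret N: normal N G by (rule N)
  have "N #> (g [^] n) = N" using n N.FactGroup_pow [OF g, of n] by simp
  then show ?thesis
    using g by (metis N.subset coset_join1 N.subgroup_axioms nat_pow_closed)
qed

theorem theorem4p3:
  fixes G :: "'a::division_ring set"
  assumes "ascendant TYPE('i) G (mult_group :: 'a monoid)"
    and "radical_over G center"
  shows "let \<G> = mult_group\<lparr>carrier := G\<rparr> in
    periodic_elems \<G> \<subseteq> center
    \<and> periodic_elems \<G> = Tor \<G>
    \<and> Tor \<G> \<lhd> \<G>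
    \<and> comm_group (\<G>\<lparr>carrier := Tor \<G>\<rparr>)
    \<and> torsion_free (\<G> Mod Tor \<G>)"
proof -
  define \<G> where "\<G> = (mult_group :: 'a monoid)\<lparr>carrier := G\<rparr>"
  interpret M: group "mult_group :: 'a monoid" by (rule group_mult_group)
  have G: "subgroup G (mult_group :: 'a monoid)" using assms(1) by (simp add: ascendant_def)
  interpret G: group \<G> unfolding \<G>_def by (rule subgroup.subgroup_is_group [OF G M.group_axioms])
  have [simp]: "carrier \<G> = G" "\<one>\<^bsub>\<G>\<^esub> = 1" "g \<otimes>\<^bsub>\<G>\<^esub> h = g * h" for g h
    by (simp_all add: \<G>_def mult_group_def)
  have pow [simp]: "g [^]\<^bsub>\<G>\<^esub> (k::nat) = g ^ k" for g k
    by (induction k) (simp_all add: nat_pow_def power_Suc2 del: power_Suc)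
  define P where "P = periodic_elems \<G>"
  have P_iff: "g \<in> P \<longleftrightarrow> g \<in> G \<and> (\<exists>k>0. g ^ k = 1)" for g
    by (auto simp: P_def periodic_elems_def)
  have P_center: "P \<subseteq> center"
    using periodic_central [OF assms] by (auto simp: P_iff)
  have P_commutes: "commutes g h" if "g \<in> P" for g h
    using that P_center by (auto simp: center_def commutes_def)
  have P_sub: "subgroup P \<G>"
  proof
    show "P \<subseteq> carrier \<G>" by (auto simp: P_iff)
    show "\<one>\<^bsub>\<G>\<^esub> \<in> P" using G.one_closed by (auto simp: P_iff)
    fix g assume g: "g \<in> P"
    then obtain i where i: "g \<in> G" "i > 0" "g ^ i = 1" by (auto simp: P_iff)
    have "(inv\<^bsub>\<G>\<^esub> g) ^ i = 1"
      using G.nat_pow_inv [of g i] G.inv_one i by simp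
    then show "inv\<^bsub>\<G>\<^esub> g \<in> P" using i G.inv_closed [of g] by (auto simp: P_iff)
    fix h assume "h \<in> P"
    then obtain k where k: "h \<in> G" "k > 0" "h ^ k = 1" by (auto simp: P_iff)
    \<comment> \<open>Periodic elements are central, so the power splits.\<close>
    have "(g * h) ^ (i * k) = (g ^ i) ^ k * (h ^ k) ^ i"
      using commutes_power_mult [OF P_commutes [OF g], of h "i * k"]
      by (metis mult.commute power_mult)
    then have "(g * h) ^ (i * k) = 1" using i k by simp
    then show "g \<otimes>\<^bsub>\<G>\<^esub> h \<in> P"
      using i k G.m_closed [of g h] by (auto simp: P_iff intro!: exI [of _ "i * k"])
  qed
  have P_normal: "P \<lhd> \<G>"
  proof (rule G.normal_inv_iff [THEN iffD2, OF conjI [OF P_sub]], intro ballI)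
    fix g h assume g: "g \<in> carrier \<G>" and h: "h \<in> P"
    have "g \<otimes>\<^bsub>\<G>\<^esub> h \<otimes>\<^bsub>\<G>\<^esub> inv\<^bsub>\<G>\<^esub> g = h \<otimes>\<^bsub>\<G>\<^esub> g \<otimes>\<^bsub>\<G>\<^esub> inv\<^bsub>\<G>\<^esub> g"
      using commutes_eq [OF P_commutes [OF h]] by simp
    also have "\<dots> = h"
      using g h G.r_inv [of g] by (metis G.inv_closed G.m_assoc G.r_one P_sub subgroup.mem_carrier)
    finally show "g \<otimes>\<^bsub>\<G>\<^esub> h \<otimes>\<^bsub>\<G>\<^esub> inv\<^bsub>\<G>\<^esub> g \<in> P" using h by simp
  qed
  \<comment> \<open>\<open>P\<close> is a periodic normal subgroup and contains every other
    one.\<close>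
  have Tor: "Tor \<G> = P"
    using P_normal by (auto simp: G.Tor_eq_Union periodic_normal_def P_def)
  have "comm_group (\<G>\<lparr>carrier := P\<rparr>)"
    by (rule group.group_comm_groupI [OF subgroup.subgroup_is_group [OF P_sub G.group_axioms]])
      (simp add: commutes_eq [OF P_commutes])
  moreover have "torsion_free (\<G> Mod P)"
    unfolding torsion_free_def
  proof
    interpret P: normal P \<G> by (rule P_normal)
    interpret Q: group "\<G> Mod P" by (rule P.factorgroup_is_group)
    show "{\<one>\<^bsub>\<G> Mod P\<^esub>} \<subseteq> periodic_elems (\<G> Mod P)"
      unfolding periodic_elems_def using Q.one_closed Q.nat_pow_one [of 1] zero_less_one by blast
    show "periodic_elems (\<G> Mod P) \<subseteq> {\<one>\<^bsub>\<G> Mod P\<^esub>}"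
    proof
      fix c assume "c \<in> periodic_elems (\<G> Mod P)"
      then obtain g and k :: nat where g: "g \<in> G" "c = P #>\<^bsub>\<G>\<^esub> g" "k > 0"
        "(P #>\<^bsub>\<G>\<^esub> g) [^]\<^bsub>\<G> Mod P\<^esub> k = \<one>\<^bsub>\<G> Mod P\<^esub>"
        by (auto simp: periodic_elems_def carrier_FactGroup)
      \<comment> \<open>A power of \<open>g\<close> is periodic, hence so is \<open>g\<close>, and
        its coset is trivial.\<close>
      then have "g ^ k \<in> P" using G.pow_mod_out [OF P_normal _ g(4)] by simp
      then obtain i where "i > 0" "(g ^ k) ^ i = 1" by (auto simp: P_iff)
      then have "g \<in> P" using g by (auto simp: P_iff intro!: exI [of _ "k * i"] simp flip: power_mult)
      then show "c \<in> {\<one>\<^bsub>\<G> Mod P\<^esub>}"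
        using g(2) G.coset_join2 [OF _ P_sub] g(1) by simp
    qed
  qed
  ultimately show ?thesis
    unfolding Let_def \<G>_def [symmetric] Tor using P_center P_normal by (simp add: P_def)
qed

end
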